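(* Let $\mathcal C$ be a constraint that is admissible for $[0,1]$. Let $(\mu^{(n)})_n$ be a sequence of random probability measures in $\mathcal P([0,1])$ such that for each $n$ the vector of moments $(m_1(\mu^{(n)}),\dots,m_n(\mu^{(n)}))$ is uniformly distributed on $\mathcal M_n^{\mathcal C}([0,1])$. Then $(\mu^{(n)})_n$ satisfies a large deviations principle with speed $n$ and good rate function $$I(\mu):=\begin{cases}\mathcal K(\mu^0|\mu)-\mathcal K(\mu^0|\mu^{\mathcal C}),&\mu^0\ll\mu\text{ and }\mu\in\mathcal P^{\mathcal C}([0,1]),\\ \infty,&\text{else},\end{cases}$$ on the space $\mathcal P([0,1])$ equipped with the weak topology.
   Context: For a Borel set $E\subset\mathbb R$, $\mathcal P(E)$ is the set of Borel probability measures on $E$ possessing moments of all orders, $m_j(\mu):=\int x^j\,d\mu(x)$, and $\mathcal M_n(E):=\{(m_1(\mu),\dots,m_n(\mu)):\mu\in\mathcal P(E)\}$. A constraint $\mathcal C=\{m_{i_1}=c_{i_1},\dots,m_{i_k}=c_{i_k}\}$ consists of finitely many integers $1\le i_1<\dots<i_k$ and real values $c_{i_1},\dots,c_{i_k}$; $k=0$ (no constraint) is allowed, with $i_k:=0$. Put $\mathcal P^{\mathcal C}(E):=\{\mu\in\mathcal P(E): m_{i_j}(\mu)=c_{i_j},\ 1\le j\le k\}$ and $\mathcal M^{\mathcal C}_n(E):=\{(m_1(\mu),\dots,m_n(\mu)):\mu\in\mathcal P^{\mathcal C}(E)\}$. $\mathcal C$ is admissible for $E$ if $\mathcal M^{\mathcal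 C}_{i_k}(E)\cap\operatorname{Int}\mathcal M_{i_k}(E)\neq\emptyset$ (automatic if $k=0$). Uniform distribution: for $n\ge i_k$ (the sequence is considered for such $n$), $\mathcal M_n^{\mathcal C}([0,1])$ is identified with its projection to the $n-k$ unconstrained coordinates $(m_j,\ 1\le j\le n,\ j\ne i_1,\dots,i_k)$, a compact convex subset of $[0,1]^{n-k}$ of positive Lebesgue measure; the uniform distribution on $\mathcal M_n^{\mathcal C}([0,1])$ is the push-forward, under this identification, of normalized $(n-k)$-dimensional Lebesgue measure on the projection. $\mu^0(dx):=\frac{1}{\pi\sqrt{x(1-x)}}dx$ on $[0,1]$ is the arcsine distribution; $\mathcal K(\mu^0|\mu):=\int\log\frac{d\mu^0}{d\mu}\,d\mu^0$ if $\mu^0\ll\mu$ and $\infty$ otherwise; $\mu^{\mathcal C}$ is the unique minimizer of $\mu\mapsto\mathcal K(\mu^0|\mu)$ over $\mathcal P^{\mathcal C}([0,1])$. A sequence of laws $\mathbb P_n$ on a topological space $\mathcal X$ (with Borel $\sigma$-field) satisfies a large deviations principle (LDP) with speed $b_n\to\infty$ and rate function $J:\mathcal X\to[0,\infty]$ if $J$ is lower semicontinuous and for all measurable $\Gamma$: $-\inf_{\operatorname{Int}\Gamma}J\le\liminf_n\frac1{b_n}\log\mathbb P_n(\Gamma)\le\limsup_n\frac1{b_n}\log\mathbb P_n(\Gamma)\le-\inf_{\overline\Gamma}J$. $J$ is good if $J^{-1}((-\infty,\alpha])$ is compact for all $\alpha\ge0$. Random elements satisfy an LDP if their laws do. *)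

theory Defs
  imports "HOL-Probability.Probability"
begin

definition prob_meas :: "real set \<Rightarrow> real measure set" where
  "prob_meas E = {\<mu>. sets \<mu> = sets (restrict_space borel E) \<and> prob_space \<mu> \<and>
     (\<forall>j::nat. integrable \<mu> (\<lambda>x. x ^ j))}"

definition mom :: "real measure \<Rightarrow> nat \<Rightarrow> real" where
  "mom \<mu> j = (\<integral>x. x ^ j \<partial>\<mu>)"

definition weak_top :: "real set \<Rightarrow> real measure topology" where
  "weak_top E = topology_generated_by
     {{\<mu> \<in> prob_meas E. (\<integral>x. f x \<partial>\<mu>) \<in> U} | f U.
        continuous_on E f \<and> bounded (f ` E) \<and> open (U :: real set)}"

lemma topspace_weak_top: "topspace (weak_top E) = prob_meas E"
proof -
  have "\<exists>f U. prob_meas E = {\<mu> \<in> prob_meas E. (\<integral>x. f x \<partial>\<mu>) \<in> U} \<and>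
      continuous_on E f \<and> bounded (f ` E) \<and> open (U :: real set)"
    by (rule exI[of _ "\<lambda>_. 0"], rule exI[of _ UNIV])
      (auto intro: finite_imp_bounded finite_subset[of _ "{0}"])
  then show ?thesis
    unfolding weak_top_def topology_generated_by_topspace by blast
qed

definition borel_of :: "'a topology \<Rightarrow> 'a measure" where
  "borel_of X = sigma (topspace X) {U. openin X U}"

definition elog :: "real \<Rightarrow> ereal" where
  "elog p = (if p \<le> 0 then - \<infinity> else ereal (ln p))"

definition rate_function :: "'a topology \<Rightarrow> ('a \<Rightarrow> ereal) \<Rightarrow> bool" where
  "rate_function X J \<longleftrightarrow>
     (\<forall>x\<in>topspace X. 0 \<le> J x) \<and> (\<forall>a. openin X {x \<in> topspace X. a < J x})"

definition good_rate_function :: "'a topology \<Rightarrow> ('a \<Rightarrow> ereal) \<Rightarrow> bool" where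
  "good_rate_function X J \<longleftrightarrow>
     rate_function X J \<and> (\<forall>a::real. 0 \<le> a \<longrightarrow> compactin X {x \<in> topspace X. J x \<le> ereal a})"

definition LDP ::
  "'a topology \<Rightarrow> (nat \<Rightarrow> 'a measure) \<Rightarrow> (nat \<Rightarrow> real) \<Rightarrow> ('a \<Rightarrow> ereal) \<Rightarrow> bool" where
  "LDP X P b J \<longleftrightarrow>
     filterlim b at_top sequentially \<and> rate_function X J \<and>
     (\<forall>\<Gamma> \<in> sets (borel_of X).
        - (INF x \<in> X interior_of \<Gamma>. J x) \<le> liminf (\<lambda>n. ereal (1 / b n) * elog (measure (P n) \<Gamma>)) \<and>
        limsup (\<lambda>n. ereal (1 / b n) * elog (measure (P n) \<Gamma>)) \<le> - (INF x \<in> X closure_of \<Gamma>. J x))"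

text \<open>
  A constraint \<open>{m\<^sub>i = c\<^sub>i | i}\<close> is the finite partial map sending each constrained index \<open>i \<ge> 1\<close>
  to its prescribed value.
\<close>

definition moment_constraint :: "(nat \<rightharpoonup> real) \<Rightarrow> bool" where
  "moment_constraint C \<longleftrightarrow> finite (dom C) \<and> 0 \<notin> dom C"

definition max_index :: "(nat \<rightharpoonup> real) \<Rightarrow> nat" where
  "max_index C = Max (insert 0 (dom C))"

definition constr_meas :: "(nat \<rightharpoonup> real) \<Rightarrow> real set \<Rightarrow> real measure set" where
  "constr_meas C E = {\<mu> \<in> prob_meas E. \<forall>i\<in>dom C. C i = Some (mom \<mu> i)}"

text \<open>
  \<open>\<real>\<^sup>n\<close> is the set of functions on \<open>{1..n}\<close>, extended by \<^const>\<open>undefined\<close>; this is the space of both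
  \<^term>\<open>powertop_real {1..n}\<close> and \<^term>\<open>\<Pi>\<^sub>M j\<in>{1..n}. (lborel :: real measure)\<close>.
\<close>

definition mom_vec :: "nat \<Rightarrow> real measure \<Rightarrow> nat \<Rightarrow> real" where
  "mom_vec n \<mu> = (\<lambda>j\<in>{1..n}. mom \<mu> j)"

definition mom_space :: "nat \<Rightarrow> real set \<Rightarrow> (nat \<Rightarrow> real) set" where
  "mom_space n E = mom_vec n ` prob_meas E"

definition constr_mom_space :: "(nat \<rightharpoonup> real) \<Rightarrow> nat \<Rightarrow> real set \<Rightarrow> (nat \<Rightarrow> real) set" where
  "constr_mom_space C n E = mom_vec n ` constr_meas C E"

definition admissible :: "(nat \<rightharpoonup> real) \<Rightarrow> real set \<Rightarrow> bool" where
  "admissible C E \<longleftrightarrow>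
     constr_mom_space C (max_index C) E \<inter>
       (powertop_real {1..max_index C} interior_of mom_space (max_index C) E) \<noteq> {}"

text \<open>
  The uniform distribution on \<open>constr_mom_space C n {0..1}\<close>, for \<open>n \<ge> max_index C\<close>: normalised
  Lebesgue measure on the projection to the unconstrained coordinates, transported back by
  reinserting the prescribed values.
\<close>

definition free_indices :: "(nat \<rightharpoonup> real) \<Rightarrow> nat \<Rightarrow> nat set" where
  "free_indices C n = {1..n} - dom C"

definition proj_mom_space :: "(nat \<rightharpoonup> real) \<Rightarrow> nat \<Rightarrow> (nat \<Rightarrow> real) set" where
  "proj_mom_space C n = (\<lambda>v. restrict v (free_indices C n)) ` constr_mom_space C n {0..1}"

definition fill_in :: "(nat \<rightharpoonup> real) \<Rightarrow> nat \<Rightarrow> (nat \<Rightarrow> real) \<Rightarrow> nat \<Rightarrow> real" where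
  "fill_in C n v = (\<lambda>j\<in>{1..n}. case C j of Some c \<Rightarrow> c | None \<Rightarrow> v j)"

definition uniform_mom :: "(nat \<rightharpoonup> real) \<Rightarrow> nat \<Rightarrow> (nat \<Rightarrow> real) measure" where
  "uniform_mom C n =
     distr (uniform_measure (\<Pi>\<^sub>M j\<in>free_indices C n. lborel) (proj_mom_space C n))
       (\<Pi>\<^sub>M j\<in>{1..n}. borel) (fill_in C n)"

definition arcsine :: "real measure" where
  "arcsine = density (restrict_space lborel {0..1}) (\<lambda>x. ennreal (1 / (pi * sqrt (x * (1 - x)))))"

text \<open>
  \<open>kl \<nu> \<mu>\<close> is \<open>\<K>(\<nu> | \<mu>) = \<integral> log (d\<nu>/d\<mu>) d\<nu>\<close> as an extended real; the library's real-valued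
  \<^const>\<open>KL_divergence\<close> would be \<open>0\<close> when the integral is infinite. The integral of the negative
  part is always finite. Note that \<^term>\<open>absolutely_continuous \<mu> \<nu>\<close> means \<open>\<nu> \<lless> \<mu>\<close>.
\<close>

definition kl :: "real measure \<Rightarrow> real measure \<Rightarrow> ereal" where
  "kl \<nu> \<mu> =
     (if absolutely_continuous \<mu> \<nu>
      then enn2ereal (\<integral>\<^sup>+x. ennreal (entropy_density (exp 1) \<mu> \<nu> x) \<partial>\<nu>)
         - enn2ereal (\<integral>\<^sup>+x. ennreal (- entropy_density (exp 1) \<mu> \<nu> x) \<partial>\<nu>)
      else \<infinity>)"

definition kl_minimizer :: "(nat \<rightharpoonup> real) \<Rightarrow> real measure" where
  "kl_minimizer C = (THE \<mu>. is_arg_min (kl arcsine) (\<lambda>\<mu>. \<mu> \<in> constr_meas C {0..1}) \<mu>)"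

definition rate :: "(nat \<rightharpoonup> real) \<Rightarrow> real measure \<Rightarrow> ereal" where
  "rate C \<mu> =
     (if absolutely_continuous \<mu> arcsine \<and> \<mu> \<in> constr_meas C {0..1}
      then kl arcsine \<mu> - kl arcsine (kl_minimizer C) else \<infinity>)"

end

theory Submission
  imports Defs "HOL-Complex_Analysis.Complex_Analysis" "HOL-Real_Asymp.Real_Asymp"
begin

text \<open>
  The substitution \<open>x = (1 - cos t) / 2\<close> turns measures on \<open>[0,1]\<close> into conjugation-symmetric measures on the
  unit circle. Let \<open>E\<^sub>n(\<mu>)\<close> be the least squared \<open>L\<^sup>2\<close>-norm of a monic polynomial of degree \<open>n\<close> there. By the Szego
  recursion \<open>E\<^sub>n\<^sub>+\<^sub>1 = E\<^sub>n (1 - \<alpha>\<^sub>n\<^sup>2)\<close>, where \<open>\<alpha>\<^sub>n\<close> is affine in the moment \<open>m\<^sub>n\<^sub>+\<^sub>1\<close> with slope a constant over \<open>E\<^sub>n\<close> and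
  \<open>\<bar>\<alpha>\<^sub>n\<bar> \<le> 1\<close> describes the fibre of the moment space. Hence integrating out the last moment turns
  the weight \<open>E\<^sub>n\<^sub>+\<^sub>1\<^sup>j\<close> into a multiple of \<open>E\<^sub>n\<^sup>j\<^sup>+\<^sup>1\<close>, so under the uniform distribution the first \<open>N\<close> moments have a density
  proportional to \<open>E\<^sub>N\<^sup>n\<^sup>-\<^sup>N\<close>. Szego's theorem, \<open>\<K>(\<mu>\<^sup>0|\<mu>) = sup\<^sub>n (- log E\<^sub>n(\<mu>))\<close>, identifies the resulting rate; it follows from
  Jensen's inequality for Bernstein-Szego measures and the Donsker-Varadhan formula.

  For the lower bound, concavity of \<open>E\<^sub>N\<close> makes a small homothetic copy of the moment space heavy enough.
  For the upper bound, the sets \<open>{E\<^sub>N < \<delta>}\<close> are open and increase with \<open>N\<close>, so by compactness of the space of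
  probability measures a single \<open>N\<close> suffices.
\<close>

section \<open>Orthogonal polynomials on the circle\<close>

text \<open>The volume of the moment space decays faster than any exponential, so rates at speed n
  can only be read off from quotients. Integrating out all moments beyond a fixed \<open>N\<close>
  leaves the same unknown constant in numerator and denominator; it cancels, and what remains is a
  Laplace asymptotics for the powers \<open>E_N^(n-N)\<close> in a fixed dimension. The
  normalisation has to be exact at this fixed \<open>N\<close>, and it is: once \<open>N\<close>
  reaches the largest constrained index, the Bernstein-Szego measure built from the first
  \<open>N\<close> moments of a constrained measure is again constrained, and its entropy is at most
  \<open>- ln E_N\<close>. Hence the maximum of \<open>E_N\<close> over the constraint set is the
  exponential of minus the least entropy, whatever \<open>N\<close> is; \<open>N\<close> is enlarged
  only to resolve the event. Measures with finitely many atoms have \<open>E_n = 0\<close> for large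
  \<open>n\<close>, and the recursion has to remain valid for them. Symmetry under conjugation makes
  all coefficients real, so real polynomials evaluated at complex points suffice.\<close>

definition cev :: "real poly \<Rightarrow> complex \<Rightarrow> complex" where
  "cev p z = poly (map_poly of_real p) z"

lemma cev_0 [simp]: "cev 0 z = 0" and cev_1 [simp]: "cev 1 z = 1"
  by (simp_all add: cev_def)

lemma cev_pCons [simp]: "cev (pCons a p) z = of_real a + z * cev p z"
  by (simp add: cev_def map_poly_pCons)

lemma cev_add [simp]: "cev (p + q) z = cev p z + cev q z"
  by (induction p q rule: poly_induct2) (simp_all add: algebra_simps)

lemma cev_smult [simp]: "cev (smult a p) z = of_real a * cev p z"
  by (induction p) (simp_all add: algebra_simps)

lemma cev_diff [simp]: "cev (p - q) z = cev p z - cev q z"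
  using cev_add[of "p - q" q z] by (simp add: algebra_simps)

lemma cev_cnj: "cev p (cnj z) = cnj (cev p z)"
  by (induction p) simp_all

lemma cev_monom: "cev (monom a n) z = of_real a * z ^ n"
  by (induction n) (simp_all add: monom_0 monom_Suc)

lemma cev_sum: "cev (\<Sum>i\<in>A. f i) z = (\<Sum>i\<in>A. cev (f i) z)"
  by (induction A rule: infinite_finite_induct) simp_all

lemma cev_eq_sum:
  assumes "\<And>k. n \<le> k \<Longrightarrow> coeff p k = 0"
  shows "cev p z = (\<Sum>k<n. of_real (coeff p k) * z ^ k)"
proof -
  have "p = (\<Sum>k<n. monom (coeff p k) k)"
    by (rule poly_eqI) (use assms in \<open>auto simp: coeff_sum coeff_monom not_less\<close>)
  then have "cev p z = cev (\<Sum>k<n. monom (coeff p k) k) z" by simp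
  then show ?thesis by (simp add: cev_sum cev_monom)
qed

lemma continuous_on_cev [continuous_intros]:
  "continuous_on S g \<Longrightarrow> continuous_on S (\<lambda>x. cev p (g x))"
  unfolding cev_def by (intro continuous_intros)

lemma holomorphic_on_cev: "cev p holomorphic_on S"
proof (induction p)
  case (pCons a p)
  have "cev (pCons a p) = (\<lambda>z. of_real a + z * cev p z)" by (simp add: fun_eq_iff)
  with pCons show ?case by (auto intro!: holomorphic_intros)
qed (auto simp: cev_def holomorphic_on_const cong: holomorphic_cong)

text \<open>\<open>circ x\<close> is the point \<open>exp (i t)\<close> of the upper half circle with \<open>x = (1 - cos t) / 2\<close>.\<close>

definition circ :: "real \<Rightarrow> complex" where
  "circ x = Complex (1 - 2 * x) (2 * sqrt (x * (1 - x)))"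

lemma cmod_circ: "x \<in> {0..1} \<Longrightarrow> cmod (circ x) = 1"
proof -
  assume x: "x \<in> {0..1}"
  then have "0 \<le> x * (1 - x)" by auto
  then have "(1 - 2 * x)\<^sup>2 + (2 * sqrt (x * (1 - x)))\<^sup>2 = 1"
    by (simp add: power_mult_distrib power2_eq_square algebra_simps)
  then show ?thesis by (simp add: circ_def cmod_def)
qed

lemma circ_mult_cnj: "x \<in> {0..1} \<Longrightarrow> circ x * cnj (circ x) = 1"
  by (simp add: complex_norm_square[symmetric] cmod_circ)

lemma inj_circ: "inj circ"
  by (auto simp: inj_on_def circ_def)

lemma continuous_on_circ [continuous_intros]: "continuous_on S circ"
  unfolding circ_def Complex_eq by (intro continuous_intros)

text \<open>The Chebyshev polynomials of the first kind in the variable 1 - 2x: with 1 - 2x = cos t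
  the values are cos (n t).\<close>

fun cheb_poly :: "nat \<Rightarrow> real poly" where
  "cheb_poly 0 = 1"
| "cheb_poly (Suc 0) = [:1, -2:]"
| "cheb_poly (Suc (Suc n)) = [:2, -4:] * cheb_poly (Suc n) - cheb_poly n"

lemma circ_sq: "x \<in> {0..1} \<Longrightarrow> circ x ^ Suc (Suc n) = of_real (2 - 4 * x) * circ x ^ Suc n - circ x ^ n"
proof -
  assume x: "x \<in> {0..1}"
  have "of_real (2 - 4 * x) - cnj (circ x) = circ x"
    by (simp add: circ_def complex_eq_iff)
  then have "circ x ^ Suc (Suc n) = (of_real (2 - 4 * x) - cnj (circ x)) * circ x ^ Suc n"
    by simp
  also have "\<dots> = of_real (2 - 4 * x) * circ x ^ Suc n - (circ x * cnj (circ x)) * circ x ^ n"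
    by (simp add: algebra_simps)
  finally show ?thesis using x by (simp add: circ_mult_cnj)
qed

lemma Re_circ_power: "x \<in> {0..1} \<Longrightarrow> Re (circ x ^ n) = poly (cheb_poly n) x"
proof (induction n rule: cheb_poly.induct)
  case (3 n)
  have "Re (circ x ^ Suc (Suc n)) = (2 - 4 * x) * Re (circ x ^ Suc n) - Re (circ x ^ n)"
    by (subst circ_sq[OF 3(3)]) (simp del: power_Suc)
  then have "Re (circ x ^ Suc (Suc n)) = (2 - 4 * x) * poly (cheb_poly (Suc n)) x - poly (cheb_poly n) x"
    using 3 by (simp only: )
  then show ?case by (simp add: algebra_simps)
qed (simp_all add: circ_def)

lemma degree_cheb_poly: "degree (cheb_poly n) \<le> n"
proof (induction n rule: cheb_poly.induct)
  case (3 n)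
  have "degree ([:2, -4:] * cheb_poly (Suc n)) \<le> Suc (Suc n)"
    using degree_mult_le[of "[:2,-4:]" "cheb_poly (Suc n)"] 3(1) by simp
  then show ?case using 3(2) by (simp add: degree_diff_le)
qed simp_all

lemma lead_coeff_cheb_poly: "coeff (cheb_poly (Suc n)) (Suc n) = - 2 * (- 4) ^ n"
proof (induction n)
  case (Suc n)
  have "coeff (cheb_poly (Suc n)) (Suc (Suc n)) = 0" "coeff (cheb_poly n) (Suc (Suc n)) = 0"
    using degree_cheb_poly[of n] degree_cheb_poly[of "Suc n"] by (auto intro!: coeff_eq_0)
  then show ?case using Suc by simp
qed simp

text \<open>Trigonometric moments in terms of power moments. Moment vectors start at index 1, so entry 0 is
  overridden by the total mass.\<close>

definition cheb :: "(nat \<Rightarrow> real) \<Rightarrow> nat \<Rightarrow> real" where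
  "cheb m j = (\<Sum>i\<le>j. coeff (cheb_poly j) i * (if i = 0 then 1 else m i))"

lemma cheb_cong: "(\<And>i. 1 \<le> i \<Longrightarrow> i \<le> j \<Longrightarrow> m i = m' i) \<Longrightarrow> cheb m j = cheb m' j"
  by (auto simp: cheb_def intro!: sum.cong)

lemma cheb_Suc:
  "cheb m (Suc n) = - 2 * (- 4) ^ n * m (Suc n) + (\<Sum>i\<le>n. coeff (cheb_poly (Suc n)) i * (if i = 0 then 1 else m i))"
  by (simp add: cheb_def lead_coeff_cheb_poly)

lemma cheb_upd: "cheb (m(Suc n := t)) (Suc n) = - 2 * (- 4) ^ n * t + cheb (m(Suc n := 0)) (Suc n)"
  by (auto simp: cheb_Suc intro!: sum.cong)

text \<open>Passing from power moments to trigonometric moments is triangular, and the diagonal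
  entries \<open>- 2 * (- 4) ^ n\<close> never vanish, so it can be inverted index by index.\<close>

lemma cheb_inj:
  assumes "\<And>j. 1 \<le> j \<Longrightarrow> j \<le> n \<Longrightarrow> cheb m j = cheb m' j"
  shows "1 \<le> j \<Longrightarrow> j \<le> n \<Longrightarrow> m j = m' j"
proof (induction j rule: less_induct)
  case (less j)
  then obtain k where k: "j = Suc k" by (cases j) auto
  have "(\<Sum>i\<le>k. coeff (cheb_poly (Suc k)) i * (if i = 0 then 1 else m i)) =
        (\<Sum>i\<le>k. coeff (cheb_poly (Suc k)) i * (if i = 0 then 1 else m' i))"
    using less k by (intro sum.cong) auto
  with assms[OF less(2,3)] show ?case unfolding k cheb_Suc by simp
qed

section \<open>Probability measures on the unit interval and their moments\<close>

abbreviation PM :: "real measure set" where "PM \<equiv> prob_meas {0..1}"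

lemma PM_D:
  assumes "\<mu> \<in> PM"
  shows "prob_space \<mu>" "sets \<mu> = sets (restrict_space borel {0..1})" "space \<mu> = {0..1}"
  using assms sets_eq_imp_space_eq[of \<mu> "restrict_space borel {0..1}"]
  by (auto simp: prob_meas_def space_restrict_space)

lemma measurable_PM_cont:
  fixes f :: "real \<Rightarrow> 'b::topological_space"
  assumes "sets \<mu> = sets (restrict_space borel {0..1::real})" "continuous_on {0..1} f"
  shows "f \<in> borel_measurable \<mu>"
  using borel_measurable_continuous_on_restrict[OF assms(2)] assms(1)
  by (simp cong: measurable_cong_sets)

lemma integrable_cont:
  fixes f :: "real \<Rightarrow> 'b::{second_countable_topology,banach}"
  assumes fin: "finite_measure \<mu>" and s: "sets \<mu> = sets (restrict_space borel {0..1::real})"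
    and f: "continuous_on {0..1} f"
  shows "integrable \<mu> f"
proof -
  have sp: "space \<mu> = {0..1}"
    using sets_eq_imp_space_eq[OF s] by (simp add: space_restrict_space)
  have "bounded (f ` {0..1})"
    by (intro compact_imp_bounded compact_continuous_image f) simp
  then obtain B where B: "\<And>x. x \<in> {0..1} \<Longrightarrow> norm (f x) \<le> B"
    by (auto simp: bounded_iff simp del: atLeastAtMost_iff)
  show ?thesis
    by (rule finite_measure.integrable_const_bound[OF fin, of _ B])
      (use B sp measurable_PM_cont[OF s f] in auto)
qed

lemma integrable_PM:
  fixes f :: "real \<Rightarrow> 'b::{second_countable_topology,banach}"
  assumes "\<mu> \<in> PM" "continuous_on {0..1} f"
  shows "integrable \<mu> f"
  using PM_D[OF assms(1)] assms(2) by (intro integrable_cont) (auto simp: prob_space_def)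

lemma PM_I:
  assumes "prob_space \<mu>" "sets \<mu> = sets (restrict_space borel {0..1})"
  shows "\<mu> \<in> PM"
  unfolding prob_meas_def using assms
  by (auto intro!: integrable_cont continuous_intros simp: prob_space_def)

lemma mom_0: "\<mu> \<in> PM \<Longrightarrow> mom \<mu> 0 = 1"
  using PM_D[of \<mu>] prob_space.prob_space[of \<mu>] by (simp add: mom_def)

lemma integral_poly:
  assumes "\<mu> \<in> PM" "degree p \<le> n"
  shows "(\<integral>x. poly p x \<partial>\<mu>) = (\<Sum>i\<le>n. coeff p i * mom \<mu> i)"
proof -
  have "poly p x = (\<Sum>i\<le>n. coeff p i * x ^ i)" for x
    unfolding poly_altdef using assms(2)
    by (intro sum.mono_neutral_left) (auto simp: coeff_eq_0)
  then show ?thesis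
    using assms(1) by (simp add: mom_def integrable_PM continuous_intros)
qed

lemma cheb_mom:
  assumes "\<mu> \<in> PM"
  shows "cheb (mom \<mu>) j = (\<integral>x. Re (circ x ^ j) \<partial>\<mu>)"
proof -
  have "(\<integral>x. Re (circ x ^ j) \<partial>\<mu>) = (\<integral>x. poly (cheb_poly j) x \<partial>\<mu>)"
    using PM_D[OF assms] by (intro Bochner_Integration.integral_cong) (auto simp: Re_circ_power)
  then show ?thesis
    using mom_0[OF assms] by (auto simp: integral_poly[OF assms degree_cheb_poly] cheb_def intro!: sum.cong)
qed

text \<open>The linear functional that sends the k-th power of z to \<open>c k\<close>. For the
  trigonometric moments of a symmetric measure on the circle it is integration.\<close>

definition Lam :: "(nat \<Rightarrow> real) \<Rightarrow> real poly \<Rightarrow> real" where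
  "Lam c p = (\<Sum>k\<le>degree p. coeff p k * c k)"

lemma Lam_eq: "degree p \<le> n \<Longrightarrow> Lam c p = (\<Sum>k\<le>n. coeff p k * c k)"
  unfolding Lam_def by (intro sum.mono_neutral_left) (auto simp: coeff_eq_0)

lemma Lam_shift: "degree p \<le> n \<Longrightarrow> Lam c (pCons 0 p) = (\<Sum>k\<le>n. coeff p k * c (Suc k))"
  using Lam_eq[of "pCons 0 p" "Suc n" c] degree_pCons_le[of 0 p]
  by (simp add: sum.atMost_Suc_shift del: sum.atMost_Suc)

lemma Lam_mom:
  assumes "\<mu> \<in> PM"
  shows "Lam (cheb (mom \<mu>)) p = (\<integral>x. Re (cev p (circ x)) \<partial>\<mu>)"
proof -
  have "Re (cev p (circ x)) = (\<Sum>k\<le>degree p. coeff p k * Re (circ x ^ k))" for x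
    by (subst cev_eq_sum[of "Suc (degree p)"]) (auto simp: coeff_eq_0 lessThan_Suc_atMost)
  then show ?thesis
    using assms by (simp add: Lam_def cheb_mom integrable_PM continuous_intros)
qed

text \<open>Szego recursion for a conjugation-symmetric measure on the circle with trigonometric moments \<open>c\<close>: the
  monic orthogonal polynomial, its reversal and its squared norm. Once the norm is \<open>0\<close>, division by zero
  makes all later Verblunsky coefficients \<open>0\<close>, which is consistent as the polynomials vanish almost everywhere.\<close>

fun szego :: "(nat \<Rightarrow> real) \<Rightarrow> nat \<Rightarrow> real poly \<times> real poly \<times> real" where
  "szego c 0 = (1, 1, 1)"
| "szego c (Suc n) = (case szego c n of (P, Q, E) \<Rightarrow>
     let a = Lam c (pCons 0 P) / E
     in (pCons 0 P - smult a Q, Q - smult a (pCons 0 P), E * (1 - a\<^sup>2)))"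

definition Phi where "Phi c n = fst (szego c n)"
definition Psi where "Psi c n = fst (snd (szego c n))"
definition En where "En c n = snd (snd (szego c n))"
definition verblunsky where "verblunsky c n = Lam c (pCons 0 (Phi c n)) / En c n"

lemma szego_0 [simp]: "Phi c 0 = 1" "Psi c 0 = 1" "En c 0 = 1"
  by (simp_all add: Phi_def Psi_def En_def)

lemma szego_Suc:
  "Phi c (Suc n) = pCons 0 (Phi c n) - smult (verblunsky c n) (Psi c n)"
  "Psi c (Suc n) = Psi c n - smult (verblunsky c n) (pCons 0 (Phi c n))"
  "En c (Suc n) = En c n * (1 - (verblunsky c n)\<^sup>2)"
  by (simp_all add: Phi_def Psi_def En_def verblunsky_def Let_def split: prod.split)

declare szego.simps [simp del]

lemma degree_szego: "degree (Phi c n) \<le> n \<and> degree (Psi c n) \<le> n"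
proof (induction n)
  case (Suc n)
  have "degree (pCons 0 (Phi c n)) \<le> Suc n" "degree (Psi c n) \<le> Suc n"
    using Suc degree_pCons_le[of 0 "Phi c n"] by auto
  then show ?case unfolding szego_Suc
    by (intro conjI degree_diff_le) (auto intro: order.trans[OF degree_smult_le])
qed simp

lemma coeff_szego: "coeff (Phi c n) n = 1" "coeff (Psi c n) 0 = 1"
proof -
  show "coeff (Phi c n) n = 1"
  proof (induction n)
    case (Suc n)
    have "coeff (Psi c n) (Suc n) = 0" using degree_szego[of c n] by (intro coeff_eq_0) auto
    with Suc show ?case by (simp add: szego_Suc)
  qed simp
  show "coeff (Psi c n) 0 = 1"
    by (induction n) (simp_all add: szego_Suc)
qed

lemma szego_cong:
  assumes "\<And>i. 1 \<le> i \<Longrightarrow> i \<le> n \<Longrightarrow> c i = c' i"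
  shows "Phi c n = Phi c' n \<and> Psi c n = Psi c' n \<and> En c n = En c' n"
  using assms
proof (induction n)
  case (Suc n)
  have "Lam c (pCons 0 (Phi c n)) = Lam c' (pCons 0 (Phi c n))"
    using degree_szego[of c n] Suc.prems by (simp add: Lam_shift[of _ n])
  then show ?case using Suc by (simp add: szego_Suc verblunsky_def)
qed simp

text \<open>Identifies \<open>Psi\<close> as the reversed polynomial, since on the circle
  conjugation inverts z. In particular \<open>Phi\<close> and \<open>Psi\<close> have the same
  modulus there.\<close>

lemma Psi_eq:
  assumes "cmod z = 1"
  shows "cev (Psi c n) z = z ^ n * cnj (cev (Phi c n) z)"
proof (induction n)
  case (Suc n)
  have z: "z * cnj z = 1" using assms by (simp add: complex_norm_square[symmetric])
  have zn: "z ^ n * cnj (z ^ n) = 1"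
    using z by (simp flip: power_mult_distrib)
  have "z ^ n * cnj (cev (Psi c n) z) = (z ^ n * cnj (z ^ n)) * cev (Phi c n) z"
    by (simp add: Suc)
  then have 1: "z ^ n * cnj (cev (Psi c n) z) = cev (Phi c n) z"
    by (simp only: zn mult_1)
  have "z ^ Suc n * cnj (cev (Phi c (Suc n)) z) =
     (z * cnj z) * (z ^ n * cnj (cev (Phi c n) z)) - verblunsky c n * (z * (z ^ n * cnj (cev (Psi c n) z)))"
    by (simp add: szego_Suc algebra_simps)
  also have "\<dots> = cev (Psi c (Suc n)) z"
    by (simp only: z 1 flip: Suc) (simp add: szego_Suc)
  finally show ?case ..
qed simp

lemma Psi_circ: "x \<in> {0..1} \<Longrightarrow> cev (Psi c n) (circ x) = circ x ^ n * cnj (cev (Phi c n) (circ x))"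
  by (simp add: Psi_eq cmod_circ)

lemma cmod_Psi_circ: "x \<in> {0..1} \<Longrightarrow> cmod (cev (Psi c n) (circ x)) = cmod (cev (Phi c n) (circ x))"
  by (simp add: Psi_circ norm_mult norm_power cmod_circ)

section \<open>Inner product and orthogonality on the circle\<close>

text \<open>The L2 inner product of the symmetric measure on the circle: the lower half circle
  contributes the complex conjugate of the upper one, so the real part over the upper half is the
  whole.\<close>

definition ip :: "real measure \<Rightarrow> real poly \<Rightarrow> real poly \<Rightarrow> real" where
  "ip \<mu> p q = (\<integral>x. Re (cev p (circ x) * cnj (cev q (circ x))) \<partial>\<mu>)"

lemma ip_linear:
  assumes "\<mu> \<in> PM"
  shows "ip \<mu> (p + q) r = ip \<mu> p r + ip \<mu> q r" "ip \<mu> (p - q) r = ip \<mu> p r - ip \<mu> q r"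
    "ip \<mu> (smult a p) r = a * ip \<mu> p r"
proof -
  show "ip \<mu> (p + q) r = ip \<mu> p r + ip \<mu> q r" "ip \<mu> (p - q) r = ip \<mu> p r - ip \<mu> q r"
    unfolding ip_def cev_add cev_diff distrib_right left_diff_distrib plus_complex.simps minus_complex.simps
    by (intro Bochner_Integration.integral_add Bochner_Integration.integral_diff
        integrable_PM[OF assms] continuous_intros)+
  have "Re (cev (smult a p) z * w) = a * Re (cev p z * w)" for z w
    by (simp add: algebra_simps)
  then show "ip \<mu> (smult a p) r = a * ip \<mu> p r"
    unfolding ip_def by (simp only: integral_mult_right_zero)
qed

lemma ip_commute: "ip \<mu> p q = ip \<mu> q p"
  unfolding ip_def by (intro Bochner_Integration.integral_cong) (auto simp: algebra_simps)

lemma ip_linear_right: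
  assumes "\<mu> \<in> PM"
  shows "ip \<mu> r (p + q) = ip \<mu> r p + ip \<mu> r q" "ip \<mu> r (p - q) = ip \<mu> r p - ip \<mu> r q"
    "ip \<mu> r (smult a p) = a * ip \<mu> r p"
  unfolding ip_commute[of \<mu> r] by (rule ip_linear[OF assms])+

lemma ip_0 [simp]: "ip \<mu> 0 p = 0" "ip \<mu> p 0 = 0"
  by (simp_all add: ip_def)

text \<open>Multiplication by z is an isometry because z has modulus 1. The Szego recursion rests on
  this property of the circle.\<close>

lemma ip_shift:
  assumes "\<mu> \<in> PM" shows "ip \<mu> (pCons 0 p) (pCons 0 q) = ip \<mu> p q"
  unfolding ip_def
proof (intro Bochner_Integration.integral_cong)
  fix x assume "x \<in> space \<mu>"
  then have "circ x * cnj (circ x) = 1" using PM_D[OF assms] by (simp add: circ_mult_cnj)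
  moreover have "cev (pCons 0 p) (circ x) * cnj (cev (pCons 0 q) (circ x)) =
     (circ x * cnj (circ x)) * (cev p (circ x) * cnj (cev q (circ x)))" by simp
  ultimately show "Re (cev (pCons 0 p) (circ x) * cnj (cev (pCons 0 q) (circ x))) = Re (cev p (circ x) * cnj (cev q (circ x)))"
    by (simp only: mult_1)
qed simp

lemma ip_self: "ip \<mu> p p = (\<integral>x. (cmod (cev p (circ x)))\<^sup>2 \<partial>\<mu>)"
  unfolding ip_def by (simp only: complex_norm_square[symmetric] Re_complex_of_real)

lemma ip_nonneg: "0 \<le> ip \<mu> p p"
  unfolding ip_self by simp

lemma Lam_ip: "\<mu> \<in> PM \<Longrightarrow> Lam (cheb (mom \<mu>)) p = ip \<mu> p 1"
  by (simp add: Lam_mom ip_def)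

text \<open>Needed for measures with finitely many atoms, where some \<open>Phi\<close> has norm
  zero without being the zero polynomial.\<close>

lemma ip_eq_0:
  assumes "\<mu> \<in> PM" "ip \<mu> p p = 0" shows "ip \<mu> p q = 0"
proof -
  have "AE x in \<mu>. (cmod (cev p (circ x)))\<^sup>2 = 0"
    using assms(2) unfolding ip_self
    by (subst (asm) integral_nonneg_eq_0_iff_AE) (auto intro!: integrable_PM[OF assms(1)] continuous_intros)
  then have "ip \<mu> p q = (\<integral>x. 0 \<partial>\<mu>)"
    unfolding ip_def
    by (intro integral_cong_AE) (auto intro!: measurable_PM_cont continuous_intros PM_D assms)
  then show ?thesis by simp
qed

definition orth :: "real measure \<Rightarrow> nat \<Rightarrow> real poly \<Rightarrow> bool" where
  "orth \<mu> n p \<longleftrightarrow> (\<forall>j<n. ip \<mu> p (monom 1 j) = 0)"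

lemma orth_ip:
  assumes "\<mu> \<in> PM" "orth \<mu> n p" "\<And>k. n \<le> k \<Longrightarrow> coeff r k = 0"
  shows "ip \<mu> p r = 0"
proof -
  have r: "(\<Sum>k<n. smult (coeff r k) (monom 1 k)) = r"
    unfolding smult_monom mult_1_right
    by (rule poly_eqI) (use assms(3) in \<open>auto simp: coeff_sum coeff_monom not_less\<close>)
  have "ip \<mu> p (\<Sum>k<m. smult (coeff r k) (monom 1 k)) = (\<Sum>k<m. coeff r k * ip \<mu> p (monom 1 k))" for m
    by (induction m) (simp_all add: ip_linear_right[OF assms(1)] del: smult_monom)
  from this[of n] show ?thesis unfolding r using assms(2) by (simp add: orth_def)
qed

text \<open>The leading terms cancel in \<open>q - p\<close>, which leaves a polynomial of degree
  below n, orthogonal to p.\<close>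

lemma ip_monic:
  assumes "\<mu> \<in> PM" "orth \<mu> n p" "degree p \<le> n" "coeff p n = 1" "degree q \<le> n" "coeff q n = 1"
  shows "ip \<mu> p q = ip \<mu> p p"
proof -
  have "ip \<mu> p (q - p) = 0"
    using assms by (intro orth_ip[OF assms(1,2)])
      (metis coeff_diff coeff_eq_0 diff_self le_neq_implies_less less_le_trans not_less)
  then show ?thesis using ip_linear_right[OF assms(1)] by simp
qed

text \<open>Conjugation turns \<open>Psi\<close> into \<open>Phi\<close> and reverses the exponents,
  so orthogonality of \<open>Phi\<close> to the powers 0 to n - 1 becomes orthogonality of
  \<open>Psi\<close> to the powers 1 to n.\<close>

lemma ip_Psi:
  assumes "\<mu> \<in> PM" "j \<le> n"
  shows "ip \<mu> (Psi c n) (monom 1 j) = ip \<mu> (Phi c n) (monom 1 (n - j))"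
  unfolding ip_def
proof (intro Bochner_Integration.integral_cong)
  fix x assume "x \<in> space \<mu>"
  then have x: "x \<in> {0..1}" using PM_D[OF assms(1)] by simp
  have 1: "circ x ^ j * cnj (circ x ^ j) = 1"
    using circ_mult_cnj[OF x] by (simp flip: power_mult_distrib)
  have "circ x ^ n = circ x ^ (n - j) * circ x ^ j" using assms(2) by (simp flip: power_add)
  then have "cev (Psi c n) (circ x) * cnj (cev (monom 1 j) (circ x)) =
      (circ x ^ j * cnj (circ x ^ j)) * (circ x ^ (n - j) * cnj (cev (Phi c n) (circ x)))"
    by (simp add: Psi_circ[OF x] cev_monom)
  also have "\<dots> = cnj (cev (Phi c n) (circ x) * cnj (cev (monom 1 (n - j)) (circ x)))"
    by (simp only: 1) (simp add: cev_monom)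
  finally show "Re (cev (Psi c n) (circ x) * cnj (cev (monom 1 j) (circ x))) =
      Re (cev (Phi c n) (circ x) * cnj (cev (monom 1 (n - j)) (circ x)))"
    by (simp only: cnj.sel)
qed simp

lemma ip_Psi_Psi:
  assumes "\<mu> \<in> PM" shows "ip \<mu> (Psi c n) (Psi c n) = ip \<mu> (Phi c n) (Phi c n)"
  unfolding ip_self using PM_D[OF assms]
  by (intro Bochner_Integration.integral_cong) (auto simp: cmod_Psi_circ)

lemma ip_monom_shift:
  "\<mu> \<in> PM \<Longrightarrow> ip \<mu> (pCons 0 p) (monom 1 (Suc j)) = ip \<mu> p (monom 1 j)"
  by (simp add: monom_Suc ip_shift)

text \<open>Against positive powers both terms of the recursion vanish separately, the shifted
  \<open>Phi\<close> by isometry and \<open>Psi\<close> by reversal; against 1 they cancel by the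
  choice of the coefficient. The hypothesis \<open>a\<close> is free of division so that it makes
  sense for norm zero.\<close>

lemma orth_Suc:
  assumes \<mu>: "\<mu> \<in> PM" and o: "orth \<mu> n (Phi c n)"
    and a: "ip \<mu> (pCons 0 (Phi c n)) 1 = verblunsky c n * ip \<mu> (Phi c n) (Phi c n)"
  shows "orth \<mu> (Suc n) (Phi c (Suc n))"
    "ip \<mu> (Phi c (Suc n)) (Phi c (Suc n)) = ip \<mu> (Phi c n) (Phi c n) * (1 - (verblunsky c n)\<^sup>2)"
proof -
  define P Q a N where "P = Phi c n" "Q = Psi c n" "a = verblunsky c n" "N = ip \<mu> P P"
  note d = this
  have P1: "ip \<mu> P (monom 1 n) = N"
    unfolding d using o by (intro ip_monic \<mu>) (simp_all add: degree_szego coeff_szego degree_monom_eq)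
  have Q0: "ip \<mu> Q 1 = N"
    using ip_Psi[OF \<mu>, of 0 n c] P1 by (simp add: d)
  show "orth \<mu> (Suc n) (Phi c (Suc n))"
    unfolding orth_def
  proof (intro allI impI)
    fix j assume j: "j < Suc n"
    show "ip \<mu> (Phi c (Suc n)) (monom 1 j) = 0"
    proof (cases j)
      case 0
      then show ?thesis using a Q0 by (simp add: szego_Suc ip_linear[OF \<mu>] d)
    next
      case (Suc i)
      have "ip \<mu> P (monom 1 i) = 0" "ip \<mu> P (monom 1 (n - j)) = 0"
        using o j Suc by (auto simp: orth_def d)
      then show ?thesis
        using ip_Psi[OF \<mu>, of j n c] j unfolding Suc
        by (simp add: szego_Suc ip_linear[OF \<mu>] ip_monom_shift[OF \<mu>] d)
    qed
  qed
  \<comment> \<open>The constant term of \<open>Q\<close> is 1. In the inner product with z P the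
    remaining multiple of z loses its factor z by isometry and then vanishes by orthogonality, so
    only the part against 1 survives.\<close>
  obtain R where QR: "Q = 1 + pCons 0 R"
  proof -
    have "poly (Q - 1) 0 = 0" using coeff_szego(2)[of c n] by (simp add: poly_0_coeff_0 d)
    then have "[:0, 1:] dvd Q - 1" using poly_eq_0_iff_dvd[of "Q - 1" 0] by simp
    then obtain R where "Q - 1 = [:0, 1:] * R" by (elim dvdE)
    then have "Q = 1 + pCons 0 R" by (simp add: algebra_simps)
    then show thesis by (rule that)
  qed
  have "coeff R k = 0" if "n \<le> k" for k
  proof -
    have "coeff Q (Suc k) = 0" using degree_szego[of c n] that by (intro coeff_eq_0) (simp add: d)
    then show ?thesis unfolding QR by simp
  qed
  then have "ip \<mu> P R = 0" by (intro orth_ip[OF \<mu>, of n]) (use o in \<open>simp_all add: d\<close>)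
  then have "ip \<mu> (pCons 0 P) Q = a * N"
    using a unfolding QR by (simp add: ip_linear_right[OF \<mu>] ip_shift[OF \<mu>] d)
  moreover have "ip \<mu> Q Q = N" by (simp add: d ip_Psi_Psi[OF \<mu>])
  ultimately show "ip \<mu> (Phi c (Suc n)) (Phi c (Suc n)) = ip \<mu> (Phi c n) (Phi c n) * (1 - (verblunsky c n)\<^sup>2)"
    using ip_commute[of \<mu> Q "pCons 0 P"] unfolding szego_Suc d[symmetric]
    by (simp add: ip_linear[OF \<mu>] ip_linear_right[OF \<mu>] ip_shift[OF \<mu>] d(4)[symmetric] power2_eq_square algebra_simps)
qed

lemma orth_Phi:
  assumes \<mu>: "\<mu> \<in> PM" and c: "c = cheb (mom \<mu>)"
  shows "orth \<mu> n (Phi c n) \<and> ip \<mu> (Phi c n) (Phi c n) = En c n"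
proof (induction n)
  case 0
  show ?case using PM_D[OF \<mu>] prob_space.prob_space[of \<mu>] by (simp add: orth_def ip_def)
next
  case (Suc n)
  have "ip \<mu> (pCons 0 (Phi c n)) 1 = verblunsky c n * En c n"
  proof (cases "En c n = 0")
    \<comment> \<open>With norm zero, z times \<open>Phi\<close> vanishes almost everywhere as well,
      so both sides are 0.\<close>
    case True
    have "ip \<mu> (pCons 0 (Phi c n)) (pCons 0 (Phi c n)) = 0"
      using Suc True by (simp add: ip_shift[OF \<mu>])
    from ip_eq_0[OF \<mu> this] have "ip \<mu> (pCons 0 (Phi c n)) 1 = 0" .
    then show ?thesis using True by simp
  next
    case False
    then show ?thesis using Lam_ip[OF \<mu>, of "pCons 0 (Phi c n)"] by (simp add: verblunsky_def c[symmetric])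
  qed
  then show ?case using orth_Suc[OF \<mu>, of n c] Suc by (simp add: szego_Suc)
qed

section \<open>The least squared norm as a functional of the measure\<close>

definition EM :: "nat \<Rightarrow> real measure \<Rightarrow> real" where
  "EM n \<mu> = En (cheb (mom \<mu>)) n"

lemma EM_nonneg: "\<mu> \<in> PM \<Longrightarrow> 0 \<le> EM n \<mu>"
  using orth_Phi[OF _ refl, of \<mu> n] ip_nonneg[of \<mu>] by (metis EM_def)

text \<open>Pythagoras: the excess of q over the orthogonal polynomial is the squared norm of their
  difference.\<close>

lemma EM_le:
  assumes \<mu>: "\<mu> \<in> PM" and q: "degree q \<le> n" "coeff q n = 1"
  shows "EM n \<mu> \<le> ip \<mu> q q"
proof -
  define P where "P = Phi (cheb (mom \<mu>)) n"
  have P: "orth \<mu> n P" "ip \<mu> P P = EM n \<mu>"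
    using orth_Phi[OF \<mu> refl, of n] by (simp_all add: P_def EM_def)
  have "ip \<mu> P q = ip \<mu> P P"
    by (rule ip_monic[OF \<mu> P(1)]) (simp_all add: P_def degree_szego coeff_szego q)
  then have "ip \<mu> (q - P) (q - P) = ip \<mu> q q - EM n \<mu>"
    using ip_commute[of \<mu> P q] P by (simp add: ip_linear[OF \<mu>] ip_linear_right[OF \<mu>])
  then show ?thesis using ip_nonneg[of \<mu> "q - P"] by simp
qed

lemma EM_Suc_le: assumes "\<mu> \<in> PM" shows "EM (Suc n) \<mu> \<le> EM n \<mu>"
  using EM_nonneg[OF assms, of n] mult_left_mono[of "1 - (verblunsky (cheb (mom \<mu>)) n)\<^sup>2" 1 "EM n \<mu>"]
  by (simp add: EM_def szego_Suc)

lemma EM_antimono: "\<mu> \<in> PM \<Longrightarrow> m \<le> n \<Longrightarrow> EM n \<mu> \<le> EM m \<mu>"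
  by (rule lift_Suc_antimono_le[of "\<lambda>n. EM n \<mu>"]) (auto intro: EM_Suc_le)

lemma EM_0 [simp]: "EM 0 \<mu> = 1" by (simp add: EM_def)

lemma EM_pos_verblunsky:
  assumes \<mu>: "\<mu> \<in> PM" and E: "EM n \<mu> > 0" and i: "i < n"
  shows "\<bar>verblunsky (cheb (mom \<mu>)) i\<bar> < 1"
proof -
  have "EM (Suc i) \<mu> > 0" using EM_antimono[OF \<mu>, of "Suc i" n] E i by simp
  then have "0 < EM i \<mu> * (1 - (verblunsky (cheb (mom \<mu>)) i)\<^sup>2)" by (simp add: EM_def szego_Suc)
  then have "(verblunsky (cheb (mom \<mu>)) i)\<^sup>2 < 1" using EM_nonneg[OF \<mu>, of i] by (simp add: zero_less_mult_iff)
  then show ?thesis by (simp add: abs_square_less_1)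
qed

text \<open>The Szego recursion run backwards: the pair at n is recovered from the pair at n + 1 up
  to the factor \<open>1 - (verblunsky c n)\<^sup>2\<close>, which is nonzero.\<close>

lemma orth_down:
  assumes \<mu>: "\<mu> \<in> PM" and o: "orth \<mu> (Suc n) (Phi c (Suc n))" and a: "\<bar>verblunsky c n\<bar> < 1"
  shows "orth \<mu> n (Phi c n)"
  unfolding orth_def
proof (intro allI impI)
  fix j assume j: "j < n"
  have "smult (1 - (verblunsky c n)\<^sup>2) (pCons 0 (Phi c n)) = Phi c (Suc n) + smult (verblunsky c n) (Psi c (Suc n))"
    by (rule poly_eqI) (simp add: szego_Suc power2_eq_square algebra_simps coeff_pCons split: nat.split)
  then have "(1 - (verblunsky c n)\<^sup>2) * ip \<mu> (pCons 0 (Phi c n)) (monom 1 (Suc j)) =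
     ip \<mu> (Phi c (Suc n)) (monom 1 (Suc j)) + verblunsky c n * ip \<mu> (Psi c (Suc n)) (monom 1 (Suc j))"
    by (simp only: ip_linear(1,3)[OF \<mu>, symmetric])
  also have "\<dots> = 0"
    using o j ip_Psi[OF \<mu>, of "Suc j" "Suc n" c] by (auto simp: orth_def)
  finally have "(1 - (verblunsky c n)\<^sup>2) * ip \<mu> (Phi c n) (monom 1 j) = 0"
    by (simp only: ip_monom_shift[OF \<mu>])
  moreover have "(verblunsky c n)\<^sup>2 < 1" using a by (simp only: abs_square_less_1)
  ultimately show "ip \<mu> (Phi c n) (monom 1 j) = 0" by simp
qed

text \<open>One orthogonality relation at degree n descends to all lower degrees. At each of them
  orthogonality to 1 fixes the next coefficient and, as \<open>Phi\<close> is monic, the next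
  moment. This recognises a Bernstein-Szego measure without computing its moments.\<close>

lemma orth_determines:
  assumes \<mu>: "\<mu> \<in> PM" and o: "orth \<mu> n (Phi c n)" and a0: "\<forall>i<n. \<bar>verblunsky c i\<bar> < 1"
  shows "1 \<le> j \<Longrightarrow> j \<le> n \<Longrightarrow> cheb (mom \<mu>) j = c j"
proof (induction j rule: less_induct)
  case (less j)
  define c' where "c' = cheb (mom \<mu>)"
  have a: "\<bar>verblunsky c i\<bar> < 1" if "i < n" for i using a0 that by blast
  obtain i where i: "j = Suc i" using less by (cases j) auto
  have o': "orth \<mu> k (Phi c k)" if "k \<le> n" for k
    using that by (induction rule: inc_induct) (rule o, rule orth_down[OF \<mu> _ a])
  have eq: "Phi c' i = Phi c i" "Psi c' i = Psi c i" "En c' i = En c i"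
    using szego_cong[of i c' c] less unfolding c'_def i by auto
  have P: "ip \<mu> (Phi c i) (Phi c i) = En c i" "orth \<mu> i (Phi c i)"
    using orth_Phi[OF \<mu> c'_def, of i] by (simp_all add: eq)
  have E: "En c k > 0" if "k \<le> n" for k
    using that
  proof (induction k)
    case (Suc k)
    then have "(verblunsky c k)\<^sup>2 < 1" using a[of k] by (simp only: abs_square_less_1)
    with Suc show ?case by (simp add: szego_Suc)
  qed simp
  have "ip \<mu> (Psi c i) 1 = ip \<mu> (Phi c i) (monom 1 i)"
    using ip_Psi[OF \<mu>, of 0 i c] by simp
  also have "\<dots> = En c i"
    using ip_monic[OF \<mu> P(2), of "monom 1 i"] P(1) by (simp add: degree_szego coeff_szego degree_monom_eq)
  finally have "ip \<mu> (Psi c i) 1 = En c i" .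
  then have "ip \<mu> (pCons 0 (Phi c i)) 1 = verblunsky c i * En c i"
  proof -
    have "ip \<mu> (Phi c (Suc i)) (monom 1 0) = 0"
      using o'[of j] less(3) unfolding i orth_def by blast
    then show ?thesis using \<open>ip \<mu> (Psi c i) 1 = En c i\<close> by (simp add: szego_Suc ip_linear[OF \<mu>])
  qed
  then have "Lam c' (pCons 0 (Phi c i)) = Lam c (pCons 0 (Phi c i))"
    using E[of i] less(3) Lam_ip[OF \<mu>, of "pCons 0 (Phi c i)"] by (simp add: verblunsky_def i c'_def[symmetric])
  moreover have "(\<Sum>k<i. coeff (Phi c i) k * c' (Suc k)) = (\<Sum>k<i. coeff (Phi c i) k * c (Suc k))"
    using less unfolding c'_def i by (intro sum.cong) auto
  ultimately have "c' (Suc i) = c (Suc i)"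
    using degree_szego[of c i] coeff_szego(1)[of c i]
    by (simp add: Lam_shift[of _ i] flip: lessThan_Suc_atMost)
  then show ?case by (simp add: c'_def i)
qed

section \<open>The arcsine distribution\<close>

text \<open>This is the squared sine of t / 2. It inverts \<open>circ\<close> on the upper half
  circle and carries the uniform law on [0, pi] to the arcsine law.\<close>

definition half_angle :: "real \<Rightarrow> real" where
  "half_angle t = (1 - cos t) / 2"

lemma half_angle_range: "half_angle t \<in> {0..1}"
  by (simp add: half_angle_def)

lemma continuous_on_half_angle [continuous_intros]: "continuous_on S half_angle"
  unfolding half_angle_def by (intro continuous_intros) auto

lemma half_angle_mult: "half_angle t * (1 - half_angle t) = (sin t / 2)\<^sup>2"
proof -
  have "half_angle t * (1 - half_angle t) = (1 - (cos t)\<^sup>2) / 4"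
    by (simp add: half_angle_def power2_eq_square field_simps)
  then show ?thesis by (simp add: power_divide sin_squared_eq)
qed

lemma circ_half_angle: "t \<in> {0..pi} \<Longrightarrow> circ (half_angle t) = cis t"
proof -
  assume "t \<in> {0..pi}"
  then have s: "0 \<le> sin t" by (simp add: sin_ge_zero)
  note half_angle_mult[of t]
  then have "2 * sqrt (half_angle t * (1 - half_angle t)) = sin t" using s by simp
  moreover have "1 - 2 * half_angle t = cos t" by (simp add: half_angle_def field_simps)
  ultimately show ?thesis by (simp only: circ_def complex_eq_iff complex.sel cis.sel)
qed

definition arc_unif :: "real measure" where
  "arc_unif = density lborel (\<lambda>t. ennreal (indicator {0..pi} t / pi))"

lemma arcsine_distr: "arcsine = distr arc_unif (restrict_space borel {0..1}) half_angle"
proof (rule measure_eqI)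
  show "sets arcsine = sets (distr arc_unif (restrict_space borel {0..1}) half_angle)"
    by (simp add: arcsine_def cong: sets_restrict_space_cong)
  fix A assume "A \<in> sets arcsine"
  then have A': "A \<in> sets (restrict_space lborel {0..1::real})" by (simp add: arcsine_def)
  then have A: "A \<in> sets borel" "A \<subseteq> {0..1}" by (auto simp: sets_restrict_space_iff)
  define f where "f = (\<lambda>x::real. 1 / (pi * sqrt (x * (1 - x))) * indicat_real A x)"
  have [measurable]: "f \<in> borel_measurable borel" using A unfolding f_def by measurable
  have [measurable]: "half_angle \<in> borel_measurable borel"
    by (intro borel_measurable_continuous_onI continuous_intros)
  have ms: "half_angle \<in> measurable arc_unif (restrict_space borel {0..1})"
    unfolding measurable_restrict_space2_iff using half_angle_range by (auto simp: arc_unif_def)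
  have "emeasure arcsine A = (\<integral>\<^sup>+x. ennreal (1 / (pi * sqrt (x * (1 - x)))) * indicator A x \<partial>restrict_space lborel {0..1})"
    unfolding arcsine_def using A'
    by (subst emeasure_density) (auto intro!: measurable_restrict_space1)
  also have "\<dots> = (\<integral>\<^sup>+x. ennreal (f x * indicat_real {0..1} x) \<partial>lborel)"
    by (subst nn_integral_restrict_space)
      (auto intro!: nn_integral_cong simp: f_def indicator_def)
  also have "\<dots> = (\<integral>\<^sup>+x. ennreal (f x * indicat_real {half_angle 0..half_angle pi} x) \<partial>lborel)"
    by (simp add: half_angle_def)
  also have "\<dots> = (\<integral>\<^sup>+t. ennreal (f (half_angle t) * (sin t / 2) * indicat_real {0..pi} t) \<partial>lborel)"
  proof (rule nn_integral_substitution)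
    show "(half_angle has_real_derivative sin t / 2) (at t)" for t
      unfolding half_angle_def by (auto intro!: derivative_eq_intros)
    show "set_borel_measurable borel {half_angle 0..half_angle pi} f"
      unfolding set_borel_measurable_def by measurable
  qed (auto intro!: continuous_intros sin_ge_zero)
  also have "\<dots> = (\<integral>\<^sup>+t. ennreal (indicator {0..pi} t / pi) * indicator (half_angle -` A) t \<partial>lborel)"
  proof (rule nn_integral_cong_AE)
    \<comment> \<open>At both endpoints the sine vanishes and the arcsine density divides by
      zero.\<close>
    have "AE t in lborel. t \<noteq> 0 \<and> t \<noteq> pi" by (intro AE_conjI AE_lborel_singleton)
    then show "AE t in lborel. ennreal (f (half_angle t) * (sin t / 2) * indicat_real {0..pi} t) =
        ennreal (indicator {0..pi} t / pi) * indicator (half_angle -` A) t"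
    proof eventually_elim
      case (elim t)
      show ?case
      proof (cases "t \<in> {0..pi}")
        case True
        then have s: "0 < sin t" using elim by (intro sin_gt_zero) auto
        note half_angle_mult[of t]
        then have "sqrt (half_angle t * (1 - half_angle t)) = sin t / 2" using s by simp
        then have "f (half_angle t) * (sin t / 2) = indicat_real A (half_angle t) / pi"
          using s unfolding f_def by (simp add: divide_simps)
        then show ?thesis using True by (simp add: indicator_def)
      qed simp
    qed
  qed
  also have "\<dots> = emeasure arc_unif (half_angle -` A \<inter> space arc_unif)"
    unfolding arc_unif_def using A measurable_sets_borel[of half_angle borel A]
    by (subst emeasure_density) (auto intro!: nn_integral_cong)
  also have "\<dots> = emeasure (distr arc_unif (restrict_space borel {0..1}) half_angle) A"
    using A by (subst emeasure_distr[OF ms]) (auto simp: sets_restrict_space_iff)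
  finally show "emeasure arcsine A = emeasure (distr arc_unif (restrict_space borel {0..1}) half_angle) A" .
qed

lemma prob_space_arc_unif: "prob_space arc_unif"
proof
  have "emeasure arc_unif UNIV = (\<integral>\<^sup>+t. ennreal (1 / pi) * indicator {0..pi} t \<partial>lborel)"
    unfolding arc_unif_def by (subst emeasure_density) (auto intro!: nn_integral_cong simp: indicator_def)
  also have "\<dots> = 1"
    by (subst nn_integral_cmult_indicator) (auto simp flip: ennreal_mult)
  finally show "emeasure arc_unif (space arc_unif) = 1" by (simp add: arc_unif_def)
qed

lemma measurable_half_angle: "half_angle \<in> measurable arc_unif (restrict_space borel {0..1})"
  unfolding measurable_restrict_space2_iff
  using half_angle_range borel_measurable_continuous_onI[OF continuous_on_half_angle]
  by (auto simp: arc_unif_def)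

lemma arcsine_PM: "arcsine \<in> PM"
  unfolding arcsine_distr
  by (intro PM_I prob_space.prob_space_distr prob_space_arc_unif measurable_half_angle) simp

lemma integral_arcsine:
  fixes f :: "real \<Rightarrow> real"
  assumes f: "continuous_on {0..1} f" and I: "((\<lambda>t. f (half_angle t)) has_integral I) {0..pi}"
  shows "(\<integral>x. f x \<partial>arcsine) = I / pi"
proof -
  have c: "continuous_on {0..pi} (\<lambda>t. f (half_angle t))"
    by (intro continuous_on_compose2[OF f] continuous_intros) (use half_angle_range in auto)
  have [measurable]: "half_angle \<in> borel_measurable borel"
    by (intro borel_measurable_continuous_onI continuous_intros)
  have fm: "f \<in> borel_measurable (restrict_space borel {0..1})"
    using f by (rule borel_measurable_continuous_on_restrict)
  have m: "(\<lambda>t. f (half_angle t)) \<in> borel_measurable lborel"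
    using measurable_compose[OF measurable_half_angle fm] by (simp add: arc_unif_def)
  have "(\<integral>x. f x \<partial>arcsine) = (\<integral>t. f (half_angle t) \<partial>arc_unif)"
    unfolding arcsine_distr by (rule integral_distr[OF measurable_half_angle fm])
  also have "\<dots> = (\<integral>t. (indicator {0..pi} t / pi) * f (half_angle t) \<partial>lborel)"
    unfolding arc_unif_def using m by (subst integral_real_density) auto
  also have "\<dots> = (LINT t:{0..pi}|lborel. f (half_angle t)) / pi"
    unfolding set_lebesgue_integral_def by (simp add: field_simps)
  also have "(LINT t:{0..pi}|lborel. f (half_angle t)) = integral {0..pi} (\<lambda>t. f (half_angle t))"
    by (intro set_borel_integral_eq_integral borel_integrable_atLeastAtMost' c)
  also have "\<dots> = I" using I by (rule integral_unique)
  finally show ?thesis .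
qed

text \<open>The mean value property: Cauchy's formula averages F over the full circle, and the
  symmetry \<open>s\<close> makes the upper half, which carries the arcsine law, account for exactly
  half of the real part.\<close>

lemma integral_arcsine_holomorphic:
  assumes c: "continuous_on (cball 0 1) F" and h: "F holomorphic_on ball 0 1"
    and s: "\<And>z. cmod z = 1 \<Longrightarrow> Re (F (cnj z)) = Re (F z)"
  shows "(\<integral>x. Re (F (circ x)) \<partial>arcsine) = Re (F 0)"
proof -
  have "((\<lambda>u. F u / (u - 0)) has_contour_integral 2 * of_real pi * \<i> * F 0) (circlepath 0 1)"
    by (rule Cauchy_integral_circlepath[OF c h]) simp
  then have "((\<lambda>t. F (cis t) / cis t * \<i> * cis t) has_integral 2 * of_real pi * \<i> * F 0) {0..2*pi}"
    unfolding circlepath_def by (subst (asm) has_contour_integral_part_circlepath_iff) simp_all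
  then have "((\<lambda>t. \<i> * F (cis t)) has_integral \<i> * (2 * of_real pi * F 0)) {0..2*pi}"
    by (simp add: mult_ac)
  from has_integral_mult_right[OF this, of "- \<i>"]
  have "((\<lambda>t. F (cis t)) has_integral 2 * of_real pi * F 0) {0..2*pi}" by simp
  from has_integral_Re[OF this]
  have I: "((\<lambda>t. Re (F (cis t))) has_integral 2 * pi * Re (F 0)) {0..2*pi}" by simp
  define h where "h = (\<lambda>t. Re (F (cis t)))"
  have hc: "continuous_on S h" for S
    unfolding h_def by (intro continuous_intros continuous_on_compose2[OF c]) auto
  define J where "J = integral {0..pi} h"
  have J: "(h has_integral J) {0..pi}"
    unfolding J_def by (intro integrable_integral integrable_continuous_real hc)
  have "(h has_integral integral {pi..2*pi} h) (cbox pi (2*pi))"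
    by (simp only: cbox_interval) (intro integrable_integral integrable_continuous_real hc)
  \<comment> \<open>The reflection t to 2 pi - t exchanges the two half circles.\<close>
  from has_integral_affinity[OF this, of "-1" "2*pi"]
  have "((\<lambda>x. h (2*pi - x)) has_integral integral {pi..2*pi} h) ((\<lambda>x. 2*pi - x) ` {pi..2*pi})"
    by (simp add: cbox_interval)
  moreover have "(\<lambda>x. 2*pi - x) ` {pi..2*pi} = {0..pi}"
    by (auto simp: image_iff intro!: bexI[of _ "2*pi - _"])
  moreover have "h (2*pi - x) = h x" for x
  proof -
    have "cis (2*pi - x) = cnj (cis x)" by (simp add: complex_eq_iff)
    then show ?thesis by (simp add: h_def s)
  qed
  ultimately have "(h has_integral integral {pi..2*pi} h) {0..pi}" by simp
  with J have e: "integral {pi..2*pi} h = J" by (rule has_integral_unique[symmetric])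
  have "2 * pi * Re (F 0) = integral {0..2*pi} h"
    using I unfolding h_def by (rule integral_unique[symmetric])
  also have "\<dots> = J + J"
    unfolding J_def by (subst Henstock_Kurzweil_Integration.integral_combine[of 0 pi "2*pi" h, symmetric])
      (auto intro!: integrable_continuous_real hc simp: e[unfolded J_def])
  finally have "J = pi * Re (F 0)" by simp
  moreover have "((\<lambda>t. Re (F (circ (half_angle t)))) has_integral J) {0..pi}"
    using J by (rule has_integral_eq[rotated]) (simp add: h_def circ_half_angle)
  moreover have "continuous_on {0..1} (\<lambda>x. Re (F (circ x)))"
    by (intro continuous_intros continuous_on_compose2[OF c]) (auto simp: cmod_circ)
  ultimately show ?thesis by (simp add: integral_arcsine)
qed

section \<open>Location of zeros and Jensen's formula\<close>

text \<open>With A = \<open>Psi\<close> and B = z \<open>Phi\<close> one recursion step multiplies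
  |A|^2 - |B|^2 by 1 - a^2, so domination of \<open>Phi\<close> by \<open>Psi\<close> persists in
  the closed disc; since |a B| < |A|, the new \<open>Psi\<close> cannot vanish.\<close>

lemma szego_disc:
  assumes "\<forall>i<n. \<bar>verblunsky c i\<bar> < 1" "cmod z \<le> 1"
  shows "cmod (cev (Phi c n) z) \<le> cmod (cev (Psi c n) z) \<and> cev (Psi c n) z \<noteq> 0"
  using assms(1)
proof (induction n)
  case (Suc n)
  define A B a where "A = cev (Psi c n) z" "B = z * cev (Phi c n) z" "a = verblunsky c n"
  note d = this
  have a: "\<bar>a\<bar> < 1" using Suc.prems by (simp add: d)
  have IH: "cmod (cev (Phi c n) z) \<le> cmod A" "A \<noteq> 0" using Suc by (auto simp: d)
  have "cmod B \<le> 1 * cmod A"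
    unfolding d norm_mult using IH assms(2) by (intro mult_mono) (auto simp: d)
  then have BA: "cmod B \<le> cmod A" by simp
  have "(cmod (A - a * B))\<^sup>2 - (cmod (B - a * A))\<^sup>2 = (1 - a\<^sup>2) * ((cmod A)\<^sup>2 - (cmod B)\<^sup>2)"
    unfolding cmod_power2 by (simp add: power2_eq_square algebra_simps)
  moreover have "0 \<le> (1 - a\<^sup>2) * ((cmod A)\<^sup>2 - (cmod B)\<^sup>2)"
    using a BA by (intro mult_nonneg_nonneg) (auto simp: abs_square_le_1 power_mono)
  ultimately have "(cmod (B - a * A))\<^sup>2 \<le> (cmod (A - a * B))\<^sup>2" by linarith
  then have "cmod (B - a * A) \<le> cmod (A - a * B)"
    by (rule power2_le_imp_le) simp
  moreover have "cmod (a * B) < cmod A"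
  proof -
    have "cmod (a * B) \<le> \<bar>a\<bar> * cmod A" using BA by (simp add: norm_mult mult_left_mono)
    also have "\<dots> < 1 * cmod A" using a IH by (intro mult_strict_right_mono) auto
    finally show ?thesis by simp
  qed
  then have "A - a * B \<noteq> 0" by auto
  ultimately have "cmod (B - a * A) \<le> cmod (A - a * B) \<and> A - a * B \<noteq> 0" ..
  then show ?case by (simp add: szego_Suc d(1-3)[symmetric]) (simp add: d algebra_simps)
qed simp

lemma Psi_at_0: "cev (Psi c n) 0 = 1"
  using coeff_szego(2)[of c n] by (cases "Psi c n") simp

lemma continuous_on_cev_id: "continuous_on S (cev p)"
  using continuous_on_cev[OF continuous_on_id] by (simp add: id_def)

text \<open>Jensen's formula without zeros: \<open>Psi\<close> has a holomorphic logarithm on a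
  slightly larger disc, and at the centre its real part is ln 1 = 0.\<close>

lemma integral_ln_Psi:
  assumes a: "\<forall>i<n. \<bar>verblunsky c i\<bar> < 1"
  shows "(\<integral>x. ln (cmod (cev (Psi c n) (circ x))) \<partial>arcsine) = 0"
proof -
  define P where "P = cev (Psi c n)"
  have nz: "P z \<noteq> 0" if "cmod z \<le> 1" for z using szego_disc[OF a that] by (simp add: P_def)
  have "open {z. P z \<noteq> 0}"
    unfolding P_def by (intro open_Collect_neq continuous_on_cev_id continuous_intros)
  moreover have "cball 0 1 \<subseteq> {z. P z \<noteq> 0}" using nz by auto
  ultimately obtain e where e: "e > 0" "{x. infdist x (cball 0 1) \<le> e} \<subseteq> {z. P z \<noteq> 0}"
    using compact_in_open_separated[of "cball (0::complex) 1" "{z. P z \<noteq> 0}"] by auto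
  \<comment> \<open>A point of modulus between 1 and 1 + e is within e of its radial projection
    \<open>sgn z\<close>, so it belongs to the neighbourhood on which \<open>P\<close> has no
    zero.\<close>
  have nz': "P z \<noteq> 0" if "z \<in> ball 0 (1 + e)" for z
  proof (cases "cmod z \<le> 1")
    case False
    have "infdist z (cball 0 1) \<le> dist z (sgn z)"
      by (intro infdist_le) (simp add: norm_sgn)
    also have "\<dots> = cmod ((of_real (cmod z) - 1) * sgn z)"
    proof -
      have "of_real (cmod z) * sgn z = z" using False by (auto simp: sgn_eq)
      then show ?thesis by (simp add: dist_norm left_diff_distrib)
    qed
    also have "\<dots> = \<bar>cmod z - 1\<bar> * cmod (sgn z)"
    proof -
      have "complex_of_real (cmod z) - 1 = of_real (cmod z - 1)" by simp
      then show ?thesis by (simp only: norm_mult norm_of_real)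
    qed
    also have "\<dots> = cmod z - 1" using False by (auto simp: norm_sgn)
    finally have "infdist z (cball 0 1) \<le> e" using that by simp
    then show ?thesis using e(2) by blast
  qed (rule nz)
  have "P holomorphic_on ball 0 (1 + e)" unfolding P_def by (rule holomorphic_on_cev)
  then obtain g where g: "g holomorphic_on ball 0 (1 + e)" "\<And>z. z \<in> ball 0 (1 + e) \<Longrightarrow> exp (g z) = P z"
    using holomorphic_logarithm_exists[of "ball 0 (1 + e)" P 0] nz' e(1) by auto
  have Re_g: "Re (g z) = ln (cmod (P z))" if "cmod z \<le> 1" for z
  proof -
    have "P z = exp (g z)" using g(2)[of z] that e(1) by simp
    then show ?thesis by simp
  qed
  have sub: "cball 0 1 \<subseteq> ball (0::complex) (1 + e)" using e by auto
  have "(\<integral>x. Re (g (circ x)) \<partial>arcsine) = Re (g 0)"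
  proof (rule integral_arcsine_holomorphic)
    show "continuous_on (cball 0 1) g"
      using g(1) sub by (meson continuous_on_subset holomorphic_on_imp_continuous_on)
    show "g holomorphic_on ball 0 1"
      using g(1) by (rule holomorphic_on_subset) (use e in auto)
    show "Re (g (cnj z)) = Re (g z)" if "cmod z = 1" for z
      using that by (simp add: Re_g P_def cev_cnj)
  qed
  also have "Re (g 0) = 0" by (simp add: Re_g) (simp add: P_def Psi_at_0)
  also have "(\<integral>x. Re (g (circ x)) \<partial>arcsine) = (\<integral>x. ln (cmod (P (circ x))) \<partial>arcsine)"
    using PM_D[OF arcsine_PM] by (intro Bochner_Integration.integral_cong) (auto simp: Re_g cmod_circ)
  finally show ?thesis by (simp add: P_def)
qed

section \<open>Relative entropy and the Donsker-Varadhan formula\<close>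

text \<open>The convex combination with weights 1 - e and e, realised as two-stage sampling: a
  Bernoulli variable selects the measure, so that mass and measurability come from the monadic
  bind.\<close>

definition mix :: "real \<Rightarrow> real measure \<Rightarrow> real measure \<Rightarrow> real measure" where
  "mix e \<mu> \<nu> = measure_pmf (bernoulli_pmf e) \<bind> (\<lambda>b. if b then \<nu> else \<mu>)"

lemma mix_kernel:
  assumes "\<mu> \<in> PM" "\<nu> \<in> PM"
  shows "(\<lambda>b. if b then \<nu> else \<mu>) \<in> measurable (count_space UNIV) (prob_algebra (restrict_space borel {0..1}))"
  using PM_D[OF assms(1)] PM_D[OF assms(2)] by (auto simp: space_prob_algebra)

lemma mix_PM:
  assumes "\<mu> \<in> PM" "\<nu> \<in> PM"
  shows "mix e \<mu> \<nu> \<in> PM"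
proof (rule PM_I)
  have "measure_pmf (bernoulli_pmf e) \<in> space (prob_algebra (count_space UNIV))"
    by (simp add: space_prob_algebra prob_space_measure_pmf)
  from prob_space_bind'[OF this mix_kernel[OF assms]] show "prob_space (mix e \<mu> \<nu>)"
    by (simp add: mix_def)
  show "sets (mix e \<mu> \<nu>) = sets (restrict_space borel {0..1})"
    unfolding mix_def using PM_D[OF assms(1)] PM_D[OF assms(2)] by (intro sets_bind) auto
qed

lemma integral_mix:
  assumes "\<mu> \<in> PM" "\<nu> \<in> PM" "0 \<le> e" "e \<le> 1"
    and f: "f \<in> borel_measurable (restrict_space borel {0..1})" "\<And>x. x \<in> {0..1} \<Longrightarrow> \<bar>f x\<bar> \<le> (B::real)"
  shows "(\<integral>x. f x \<partial>mix e \<mu> \<nu>) = (1 - e) * (\<integral>x. f x \<partial>\<mu>) + e * (\<integral>x. f x \<partial>\<nu>)"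
proof -
  have "(\<integral>x. f x \<partial>mix e \<mu> \<nu>) = (\<integral>b. integral\<^sup>L (if b then \<nu> else \<mu>) f \<partial>measure_pmf (bernoulli_pmf e))"
    unfolding mix_def
  proof (rule integral_bind[where K="restrict_space borel {0..1}" and B'=1])
    show "(\<lambda>b. if b then \<nu> else \<mu>) \<in> measurable (measure_pmf (bernoulli_pmf e)) (subprob_algebra (restrict_space borel {0..1}))"
      using measurable_prob_algebraD[OF mix_kernel[OF assms(1,2)]] by (simp cong: measurable_cong_sets)
    show "AE x in measure_pmf (bernoulli_pmf e). emeasure (if x then \<nu> else \<mu>) (space (if x then \<nu> else \<mu>)) \<le> ennreal 1"
      using PM_D(1)[OF assms(1)] PM_D(1)[OF assms(2)] by (auto simp: prob_space.emeasure_space_1)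
  qed (use f in \<open>auto simp: space_restrict_space measure_pmf.finite_measure_axioms\<close>)
  also have "\<dots> = (1 - e) * (\<integral>x. f x \<partial>\<mu>) + e * (\<integral>x. f x \<partial>\<nu>)"
    using assms by (simp add: integral_bernoulli_pmf)
  finally show ?thesis .
qed

section \<open>Approximation of integrable functions by continuous ones\<close>

definition apx :: "real measure \<Rightarrow> (real \<Rightarrow> real) \<Rightarrow> bool" where
  "apx \<mu> f \<longleftrightarrow> integrable \<mu> f \<and> (\<forall>e>0. \<exists>g. continuous_on {0..1} g \<and> (\<integral>x. \<bar>f x - g x\<bar> \<partial>\<mu>) < e)"

lemma apx_cont: "\<mu> \<in> PM \<Longrightarrow> continuous_on {0..1} f \<Longrightarrow> apx \<mu> f"
  unfolding apx_def by (auto intro!: integrable_PM exI[of _ f])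

lemma apx_cmult:
  assumes "\<mu> \<in> PM" "apx \<mu> f" shows "apx \<mu> (\<lambda>x. c * f x)"
  unfolding apx_def
proof (intro conjI allI impI)
  fix e :: real assume e: "e > 0"
  then have "e / (\<bar>c\<bar> + 1) > 0" by (intro divide_pos_pos) auto
  then obtain g where g: "continuous_on {0..1} g" "(\<integral>x. \<bar>f x - g x\<bar> \<partial>\<mu>) < e / (\<bar>c\<bar> + 1)"
    using assms(2) unfolding apx_def by blast
  have "(\<integral>x. \<bar>c * f x - c * g x\<bar> \<partial>\<mu>) = \<bar>c\<bar> * (\<integral>x. \<bar>f x - g x\<bar> \<partial>\<mu>)"
    by (simp flip: right_diff_distrib add: abs_mult)
  also have "\<dots> \<le> \<bar>c\<bar> * (e / (\<bar>c\<bar> + 1))" using g by (intro mult_left_mono) auto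
  also have "\<dots> < e" using e by (simp add: field_simps)
  finally show "\<exists>g. continuous_on {0..1} g \<and> (\<integral>x. \<bar>c * f x - g x\<bar> \<partial>\<mu>) < e"
    using g by (intro exI[of _ "\<lambda>x. c * g x"]) (auto intro!: continuous_intros)
qed (use assms in \<open>auto simp: apx_def\<close>)

lemma apx_add:
  assumes "\<mu> \<in> PM" "apx \<mu> f" "apx \<mu> h" shows "apx \<mu> (\<lambda>x. f x + h x)"
  unfolding apx_def
proof (intro conjI allI impI)
  note i = integrable_PM[OF assms(1)]
  show "integrable \<mu> (\<lambda>x. f x + h x)" using assms by (auto simp: apx_def)
  fix e :: real assume e: "e > 0"
  then have e2: "e / 2 > 0" by simp
  obtain g where g: "continuous_on {0..1} g" "(\<integral>x. \<bar>f x - g x\<bar> \<partial>\<mu>) < e / 2"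
    using assms(2) e2 unfolding apx_def by blast
  obtain k where k: "continuous_on {0..1} k" "(\<integral>x. \<bar>h x - k x\<bar> \<partial>\<mu>) < e / 2"
    using assms(3) e2 unfolding apx_def by blast
  have int: "integrable \<mu> (\<lambda>x. \<bar>f x - g x\<bar>)" "integrable \<mu> (\<lambda>x. \<bar>h x - k x\<bar>)"
    using assms i g k by (auto simp: apx_def intro!: integrable_abs Bochner_Integration.integrable_diff)
  have "(\<integral>x. \<bar>f x + h x - (g x + k x)\<bar> \<partial>\<mu>) \<le> (\<integral>x. \<bar>f x - g x\<bar> + \<bar>h x - k x\<bar> \<partial>\<mu>)"
    by (intro integral_mono Bochner_Integration.integrable_add int integrable_abs Bochner_Integration.integrable_diff)
      (use assms i g k in \<open>auto simp: apx_def\<close>)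
  also have "\<dots> < e" using g k int by simp
  finally show "\<exists>g. continuous_on {0..1} g \<and> (\<integral>x. \<bar>f x + h x - g x\<bar> \<partial>\<mu>) < e"
    using g k by (intro exI[of _ "\<lambda>x. g x + k x"]) (auto intro!: continuous_intros)
qed

lemma apx_lim:
  assumes \<mu>: "\<mu> \<in> PM" and s: "\<And>i. apx \<mu> (s i)" and f: "integrable \<mu> f" and w: "integrable \<mu> w"
    and lim: "\<And>x. x \<in> {0..1} \<Longrightarrow> (\<lambda>i. s i x) \<longlonglongrightarrow> f x"
    and dom: "\<And>i x. x \<in> {0..1} \<Longrightarrow> \<bar>s i x\<bar> \<le> w x"
  shows "apx \<mu> f"
  unfolding apx_def
proof (intro conjI allI impI f)
  note i = integrable_PM[OF \<mu>]
  have si: "integrable \<mu> (s i)" for i using s by (auto simp: apx_def)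
  have "(\<lambda>i. \<integral>x. \<bar>f x - s i x\<bar> \<partial>\<mu>) \<longlonglongrightarrow> (\<integral>x. 0 \<partial>\<mu>)"
  proof (rule integral_dominated_convergence[where w="\<lambda>x. \<bar>f x\<bar> + w x"])
    show "AE x in \<mu>. (\<lambda>i. \<bar>f x - s i x\<bar>) \<longlonglongrightarrow> 0"
    proof (rule AE_I2)
      fix x assume "x \<in> space \<mu>"
      then have "(\<lambda>i. s i x) \<longlonglongrightarrow> f x" using lim PM_D[OF \<mu>] by auto
      from tendsto_rabs[OF tendsto_diff[OF tendsto_const[of "f x"] this]]
      show "(\<lambda>i. \<bar>f x - s i x\<bar>) \<longlonglongrightarrow> 0" by simp
    qed
    show "AE x in \<mu>. norm \<bar>f x - s i x\<bar> \<le> \<bar>f x\<bar> + w x" for i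
    proof (rule AE_I2)
      fix x assume "x \<in> space \<mu>"
      then have "\<bar>s i x\<bar> \<le> w x" using dom PM_D[OF \<mu>] by auto
      then show "norm \<bar>f x - s i x\<bar> \<le> \<bar>f x\<bar> + w x" by simp
    qed
  qed (use f w si in \<open>auto intro!: borel_measurable_integrable\<close>)
  then have lim0: "(\<lambda>i. \<integral>x. \<bar>f x - s i x\<bar> \<partial>\<mu>) \<longlonglongrightarrow> 0" by simp
  fix e :: real assume e: "e > 0"
  then have e2: "e / 2 > 0" by simp
  from order_tendstoD(2)[OF lim0 e2] obtain j where j: "(\<integral>x. \<bar>f x - s j x\<bar> \<partial>\<mu>) < e / 2"
    by (auto simp: eventually_sequentially)
  obtain g where g: "continuous_on {0..1} g" "(\<integral>x. \<bar>s j x - g x\<bar> \<partial>\<mu>) < e / 2"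
    using s[of j] e2 unfolding apx_def by blast
  have int: "integrable \<mu> (\<lambda>x. \<bar>f x - s j x\<bar>)" "integrable \<mu> (\<lambda>x. \<bar>s j x - g x\<bar>)" "integrable \<mu> (\<lambda>x. \<bar>f x - g x\<bar>)"
    using si f i g by (auto intro!: integrable_abs Bochner_Integration.integrable_diff)
  have "(\<integral>x. \<bar>f x - g x\<bar> \<partial>\<mu>) \<le> (\<integral>x. \<bar>f x - s j x\<bar> + \<bar>s j x - g x\<bar> \<partial>\<mu>)"
    by (intro integral_mono Bochner_Integration.integrable_add int) auto
  also have "\<dots> < e" using g j int by simp
  finally show "\<exists>g. continuous_on {0..1} g \<and> (\<integral>x. \<bar>f x - g x\<bar> \<partial>\<mu>) < e" using g by auto
qed

lemma integrable_bdd: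
  fixes f :: "real \<Rightarrow> real"
  assumes "\<mu> \<in> PM" "f \<in> borel_measurable \<mu>" "\<And>x. x \<in> {0..1} \<Longrightarrow> \<bar>f x\<bar> \<le> B"
  shows "integrable \<mu> f"
  using PM_D[OF assms(1)] assms
  by (intro finite_measure.integrable_const_bound[of _ _ B]) (auto simp: prob_space_def)

lemma borel_measurable_PM: "\<mu> \<in> PM \<Longrightarrow> f \<in> borel_measurable borel \<Longrightarrow> f \<in> borel_measurable \<mu>"
  using PM_D[of \<mu>] by (simp add: measurable_restrict_space1 cong: measurable_cong_sets)

text \<open>Half-lines are an intersection-stable generator of the Borel sets, so by Dynkin's
  theorem it suffices to treat them and to close under complements and disjoint unions.\<close>

lemma apx_indicator:
  assumes \<mu>: "\<mu> \<in> PM" and A: "A \<in> sets borel"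
  shows "apx \<mu> (indicat_real A)"
proof -
  have sg: "A \<in> sigma_sets UNIV (range (\<lambda>a::real. {..a}))"
    using A by (simp add: borel_eq_atMost)
  have stab: "Int_stable (range (\<lambda>a::real. {..a}))"
    by (auto simp: Int_stable_def)
  show ?thesis
  proof (rule sigma_sets_induct_disjoint[OF stab _ sg])
    fix A assume "A \<in> range (\<lambda>a::real. {..a})"
    then obtain a where a: "A = {..a}" by auto
    \<comment> \<open>A ramp of slope -k: it is 1 on the half-line and, for positive k, 0 from a +
      1/k on.\<close>
    define s where "s = (\<lambda>k x. max 0 (min 1 (1 - real k * (x - a))))"
    show "apx \<mu> (indicat_real A)"
    proof (rule apx_lim[where s=s and w="\<lambda>_. 1"])
      show "apx \<mu> (s i)" for i
        unfolding s_def by (intro apx_cont[OF \<mu>] continuous_intros)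
      show "integrable \<mu> (indicat_real A)"
        using a by (intro integrable_bdd[OF \<mu>, of _ 1] borel_measurable_PM[OF \<mu>]) auto
      show "(\<lambda>i. s i x) \<longlonglongrightarrow> indicat_real A x" for x
      proof (cases "x \<le> a")
        case True
        then have "s i x = 1" for i by (simp add: s_def mult_nonneg_nonpos)
        then show ?thesis using True a by simp
      next
        case False
        then have "filterlim (\<lambda>i. real i * (x - a)) at_top sequentially"
          by (intro filterlim_at_top_mult_tendsto_pos[OF tendsto_const] filterlim_real_sequentially | simp add: mult.commute)+
        then have "eventually (\<lambda>i. 1 \<le> real i * (x - a)) sequentially"
          by (simp add: filterlim_at_top)
        then have "eventually (\<lambda>i. s i x = 0) sequentially"
          by eventually_elim (simp add: s_def)
        then show ?thesis using False a by (simp add: tendsto_eventually)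
      qed
    qed (use \<mu> in \<open>auto simp: s_def intro!: integrable_PM\<close>)
  next
    show "apx \<mu> (indicat_real {})" using apx_cont[OF \<mu>, of "\<lambda>_. 0"] by (simp add: indicator_def[abs_def])
  next
    fix A assume compl: "apx \<mu> (indicat_real A)"
    have "apx \<mu> (\<lambda>x. 1 + (-1) * indicat_real A x)"
      by (intro apx_add[OF \<mu>] apx_cmult[OF \<mu>] compl apx_cont[OF \<mu>] continuous_intros)
    also have "(\<lambda>x. 1 + (-1) * indicat_real A x) = indicat_real (UNIV - A)" by (auto simp: indicator_def)
    finally show "apx \<mu> (indicat_real (UNIV - A))" .
  next
    fix A :: "nat \<Rightarrow> real set"
    assume union: "disjoint_family A" "range A \<subseteq> sigma_sets UNIV (range (\<lambda>a::real. {..a}))"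
      "\<And>i. apx \<mu> (indicat_real (A i))"
    have m: "A i \<in> sets borel" for i using union(2) by (auto simp: borel_eq_atMost)
    have s: "apx \<mu> (\<lambda>x. \<Sum>i<n. indicat_real (A i) x)" for n
      by (induction n) (auto intro: apx_cont[OF \<mu>] apx_add[OF \<mu>] union)
    show "apx \<mu> (indicat_real (\<Union> (range A)))"
    proof (rule apx_lim[where w="\<lambda>_. 1", OF \<mu> s])
      show "integrable \<mu> (indicat_real (\<Union> (range A)))"
        using m by (intro integrable_bdd[OF \<mu>, of _ 1] borel_measurable_PM[OF \<mu>]) auto
      have sum: "(\<Sum>i<n. indicat_real (A i) x) = indicat_real (\<Union>i<n. A i) x" for n x
        using union(1) by (subst indicator_UN_disjoint) (auto simp: disjoint_family_on_def)
      show "(\<lambda>n. \<Sum>i<n. indicat_real (A i) x) \<longlonglongrightarrow> indicat_real (\<Union> (range A)) x" for x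
        unfolding sum by (rule LIMSEQ_indicator_UN)
      show "\<bar>\<Sum>i<n. indicat_real (A i) x\<bar> \<le> 1" for n x
        unfolding sum by (auto simp: indicator_def)
    qed (use \<mu> in \<open>auto intro!: integrable_PM\<close>)
  qed simp
qed

lemma apx_integrable:
  assumes \<mu>: "\<mu> \<in> PM" and f: "integrable \<mu> f"
  shows "apx \<mu> f"
  using f
proof (induction rule: integrable_induct)
  case (base A c)
  then have "A \<in> sets borel" using PM_D[OF \<mu>] by (auto simp: sets_restrict_space_iff)
  from apx_cmult[OF \<mu> apx_indicator[OF \<mu> this], of c] show ?case by (simp add: mult.commute)
next
  case (add f g)
  then show ?case by (intro apx_add[OF \<mu>])
next
  case (lim f s)
  show ?case
    by (rule apx_lim[OF \<mu>, where s=s and w="\<lambda>x. 2 * norm (f x)"])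
      (use lim PM_D[OF \<mu>] in auto)
qed

section \<open>Density of the arcsine law and relative entropy\<close>

lemma sets_arcsine: "sets arcsine = sets (restrict_space borel {0..1})" "space arcsine = {0..1}"
  using PM_D[OF arcsine_PM] by auto

abbreviation rnd :: "real measure \<Rightarrow> real \<Rightarrow> real" where
  "rnd \<mu> x \<equiv> enn2real (RN_deriv \<mu> arcsine x)"

lemma rnd_props:
  assumes \<mu>: "\<mu> \<in> PM" and ac: "absolutely_continuous \<mu> arcsine"
  shows "rnd \<mu> \<in> borel_measurable \<mu>" "rnd \<mu> \<in> borel_measurable arcsine"
    "arcsine = density \<mu> (\<lambda>x. ennreal (rnd \<mu> x))" "AE x in arcsine. 0 < rnd \<mu> x"
proof -
  have s: "sets arcsine = sets \<mu>" using PM_D[OF \<mu>] sets_arcsine by simp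
  interpret \<mu>: prob_space \<mu> using PM_D[OF \<mu>] by simp
  interpret \<nu>: prob_space arcsine using PM_D[OF arcsine_PM] by simp
  show m: "rnd \<mu> \<in> borel_measurable \<mu>" by simp
  then show "rnd \<mu> \<in> borel_measurable arcsine" using s by (simp cong: measurable_cong_sets)
  have "arcsine = density \<mu> (RN_deriv \<mu> arcsine)"
    using \<mu>.density_RN_deriv[OF ac s] by simp
  also have "\<dots> = density \<mu> (\<lambda>x. ennreal (rnd \<mu> x))"
  proof (rule density_cong)
    show "AE x in \<mu>. RN_deriv \<mu> arcsine x = ennreal (rnd \<mu> x)"
      using \<mu>.RN_deriv_finite[OF \<nu>.sigma_finite_measure_axioms ac s]
      by eventually_elim (simp add: ennreal_enn2real_if)
  qed simp_all
  finally show d: "arcsine = density \<mu> (\<lambda>x. ennreal (rnd \<mu> x))" .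
  show "AE x in arcsine. 0 < rnd \<mu> x"
    by (subst d, subst AE_density) (use m in auto)
qed

lemma nn_integral_arcsine_rnd:
  assumes \<mu>: "\<mu> \<in> PM" and ac: "absolutely_continuous \<mu> arcsine" and f: "f \<in> borel_measurable \<mu>"
  shows "(\<integral>\<^sup>+x. f x \<partial>arcsine) = (\<integral>\<^sup>+x. ennreal (rnd \<mu> x) * f x \<partial>\<mu>)"
  by (subst rnd_props(3)[OF \<mu> ac], subst nn_integral_density) (use f rnd_props(1)[OF \<mu> ac] in auto)

lemma entropy_density_ln: "entropy_density (exp 1) \<mu> arcsine x = ln (rnd \<mu> x)"
  by (simp add: entropy_density_def log_def)

text \<open>Over \<open>\<mu>\<close> the integrand becomes - g ln g, which is bounded above. The
  difference that defines \<open>kl\<close> is therefore never infinity minus infinity.\<close>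

lemma ln_rnd_neg:
  assumes \<mu>: "\<mu> \<in> PM" and ac: "absolutely_continuous \<mu> arcsine"
  shows "(\<integral>\<^sup>+x. ennreal (- ln (rnd \<mu> x)) \<partial>arcsine) \<le> 1"
proof -
  interpret \<mu>: prob_space \<mu> using PM_D[OF \<mu>] by simp
  have "(\<integral>\<^sup>+x. ennreal (- ln (rnd \<mu> x)) \<partial>arcsine) = (\<integral>\<^sup>+x. ennreal (rnd \<mu> x) * ennreal (- ln (rnd \<mu> x)) \<partial>\<mu>)"
    using rnd_props(1)[OF \<mu> ac] by (intro nn_integral_arcsine_rnd[OF \<mu> ac]) simp
  also have "\<dots> \<le> (\<integral>\<^sup>+x. 1 \<partial>\<mu>)"
  proof (rule nn_integral_mono)
    fix x
    define g where "g = rnd \<mu> x"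
    have g: "g \<ge> 0" by (simp add: g_def)
    have "g * (- ln g) \<le> 1"
    proof (cases "g = 0")
      case False
      then have "- ln g \<le> 1 / g - 1" using g ln_le_minus_one[of "1 / g"] by (simp add: ln_div)
      then have "g * (- ln g) \<le> g * (1 / g - 1)" using g by (rule mult_left_mono)
      also have "\<dots> \<le> 1" using g False by (simp add: right_diff_distrib)
      finally show ?thesis .
    qed simp
    then show "ennreal g * ennreal (- ln g) \<le> 1"
      using g by (simp flip: ennreal_mult' add: ennreal_le_1)
  qed
  also have "\<dots> = 1" by (simp add: \<mu>.emeasure_space_1)
  finally show ?thesis .
qed

lemma kl_cases:
  assumes \<mu>: "\<mu> \<in> PM" and ac: "absolutely_continuous \<mu> arcsine"
  shows "kl arcsine \<mu> = \<infinity> \<or>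
    (integrable arcsine (\<lambda>x. ln (rnd \<mu> x)) \<and> kl arcsine \<mu> = ereal (\<integral>x. ln (rnd \<mu> x) \<partial>arcsine))"
proof -
  define p q where "p = (\<integral>\<^sup>+x. ennreal (ln (rnd \<mu> x)) \<partial>arcsine)" "q = (\<integral>\<^sup>+x. ennreal (- ln (rnd \<mu> x)) \<partial>arcsine)"
  note pq = this
  have k: "kl arcsine \<mu> = enn2ereal p - enn2ereal q"
    using ac by (simp add: kl_def entropy_density_ln pq)
  have q: "q \<noteq> \<infinity>" using ln_rnd_neg[OF \<mu> ac] by (auto simp: pq top_unique)
  have m: "(\<lambda>x. ln (rnd \<mu> x)) \<in> borel_measurable arcsine" using rnd_props(2)[OF \<mu> ac] by simp
  show ?thesis
  proof (cases "p = \<infinity>")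
    case True
    then have "kl arcsine \<mu> = \<infinity>" using q by (cases q) (simp_all add: k)
    then show ?thesis ..
  next
    case False
    have i: "integrable arcsine (\<lambda>x. ln (rnd \<mu> x))"
      using m False q by (simp add: real_integrable_def pq)
    have "(\<integral>x. ln (rnd \<mu> x) \<partial>arcsine) = enn2real p - enn2real q"
      using real_lebesgue_integral_def[OF i] by (simp add: pq)
    then have "kl arcsine \<mu> = ereal (\<integral>x. ln (rnd \<mu> x) \<partial>arcsine)"
      using False q by (cases p; cases q) (simp_all add: k)
    with i show ?thesis by blast
  qed
qed

lemma integral_pos_PM:
  fixes f :: "real \<Rightarrow> real"
  assumes \<mu>: "\<mu> \<in> PM" and f: "continuous_on {0..1} f" "\<And>x. x \<in> {0..1} \<Longrightarrow> 0 < f x"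
  shows "0 < (\<integral>x. f x \<partial>\<mu>)"
proof -
  interpret prob_space \<mu> using PM_D[OF \<mu>] by simp
  obtain y where y: "y \<in> {0..1}" "\<And>x. x \<in> {0..1} \<Longrightarrow> f y \<le> f x"
    using continuous_attains_inf[OF _ _ f(1)] by auto
  have "f y = (\<integral>x. f y \<partial>\<mu>)" by (simp add: prob_space)
  also have "\<dots> \<le> (\<integral>x. f x \<partial>\<mu>)"
    using y PM_D[OF \<mu>] by (intro integral_mono integrable_PM[OF \<mu>] f continuous_intros) auto
  finally show ?thesis using f(2)[OF y(1)] by simp
qed

lemma continuous_on_ln_pos:
  fixes f :: "real \<Rightarrow> real"
  shows "continuous_on S f \<Longrightarrow> (\<And>x. x \<in> S \<Longrightarrow> 0 < f x) \<Longrightarrow> continuous_on S (\<lambda>x. ln (f x))"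
  by (intro continuous_on_ln) (auto simp: less_le)

text \<open>Let g be the density of the arcsine law and s the mean of f under \<open>\<mu>\<close>.
  Integrate ln h <= h - 1 for h = f / (g s), whose arcsine mean is at most 1. Equality forces h = 1,
  so g = f / s, and this density can be inverted.\<close>

lemma donsker_varadhan_le:
  fixes f :: "real \<Rightarrow> real"
  assumes \<mu>: "\<mu> \<in> PM" and f: "continuous_on {0..1} f" "\<And>x. x \<in> {0..1} \<Longrightarrow> 0 < f x"
  shows "ereal ((\<integral>x. ln (f x) \<partial>arcsine) - ln (\<integral>x. f x \<partial>\<mu>)) \<le> kl arcsine \<mu>" (is ?le)
    and "kl arcsine \<mu> = ereal ((\<integral>x. ln (f x) \<partial>arcsine) - ln (\<integral>x. f x \<partial>\<mu>)) \<Longrightarrow>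
      \<mu> = density arcsine (\<lambda>x. ennreal ((\<integral>x. f x \<partial>\<mu>) / f x))"
proof -
  define s where "s = (\<integral>x. f x \<partial>\<mu>)"
  have s: "s > 0" unfolding s_def by (rule integral_pos_PM[OF \<mu> f])
  have sp: "space \<mu> = {0..1}" using PM_D[OF \<mu>] by simp
  interpret \<mu>: prob_space \<mu> using PM_D[OF \<mu>] by simp
  interpret \<nu>: prob_space arcsine using PM_D[OF arcsine_PM] by simp
  have fm: "f \<in> borel_measurable \<mu>" "f \<in> borel_measurable arcsine"
    using f PM_D[OF \<mu>] sets_arcsine by (auto intro: measurable_PM_cont)
  have "?le \<and> (kl arcsine \<mu> = ereal ((\<integral>x. ln (f x) \<partial>arcsine) - ln s) \<longrightarrow>
      \<mu> = density arcsine (\<lambda>x. ennreal (s / f x)))"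
  proof (cases "kl arcsine \<mu> = \<infinity>")
    case False
    then have ac: "absolutely_continuous \<mu> arcsine" by (auto simp: kl_def split: if_splits)
    define g where "g = rnd \<mu>"
    have g: "g \<in> borel_measurable \<mu>" "g \<in> borel_measurable arcsine"
      "arcsine = density \<mu> (\<lambda>x. ennreal (g x))" "AE x in arcsine. 0 < g x"
      unfolding g_def by (rule rnd_props[OF \<mu> ac])+
    have g0: "g x \<ge> 0" for x by (simp add: g_def)
    from kl_cases[OF \<mu> ac] False
    have i: "integrable arcsine (\<lambda>x. ln (g x))" and k: "kl arcsine \<mu> = ereal (\<integral>x. ln (g x) \<partial>arcsine)"
      by (auto simp: g_def)
    define h where "h = (\<lambda>x. f x / (g x * s))"
    have hm: "h \<in> borel_measurable \<mu>" "h \<in> borel_measurable arcsine"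
      using g fm by (simp_all add: h_def)
    have h0: "0 \<le> h x" if "x \<in> {0..1}" for x
      using f(2)[OF that] g0[of x] s by (simp add: h_def)
    \<comment> \<open>This is g h, the integrand over \<open>\<mu>\<close>. It falls short of f / s
      exactly on the set where g vanishes, which carries the part of \<open>\<mu>\<close> singular
      to the arcsine law.\<close>
    define k where "k = (\<lambda>x. if 0 < g x then f x / s else 0)"
    have f_s: "(\<integral>\<^sup>+x. ennreal (f x / s) \<partial>\<mu>) = 1"
      using s f by (subst nn_integral_eq_integral)
        (auto intro!: integrable_PM[OF \<mu>] AE_I2 continuous_intros simp: sp s_def[symmetric] less_imp_le)
    have gh: "(\<integral>\<^sup>+x. ennreal (h x) \<partial>arcsine) = (\<integral>\<^sup>+x. ennreal (k x) \<partial>\<mu>)"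
    proof -
      have "(\<integral>\<^sup>+x. ennreal (h x) \<partial>arcsine) = (\<integral>\<^sup>+x. ennreal (g x) * ennreal (h x) \<partial>\<mu>)"
        unfolding g_def using hm by (intro nn_integral_arcsine_rnd[OF \<mu> ac]) simp
      also have "\<dots> = (\<integral>\<^sup>+x. ennreal (k x) \<partial>\<mu>)"
      proof (intro nn_integral_cong)
        fix x assume "x \<in> space \<mu>"
        then have "x \<in> {0..1}" using sp by simp
        moreover have "g x * h x = k x" using g0[of x] by (auto simp: h_def k_def)
        ultimately show "ennreal (g x) * ennreal (h x) = ennreal (k x)"
          using g0[of x] h0[of x] by (simp flip: ennreal_mult)
      qed
      finally show ?thesis .
    qed
    also have "\<dots> \<le> (\<integral>\<^sup>+x. ennreal (f x / s) \<partial>\<mu>)"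
      using f(2) s by (intro nn_integral_mono) (auto simp: k_def sp intro!: ennreal_leI)
    finally have h1: "(\<integral>\<^sup>+x. ennreal (h x) \<partial>arcsine) \<le> 1" using f_s by simp
    have hA: "AE x in arcsine. 0 \<le> h x" using h0 sets_arcsine(2) by (intro AE_I2) auto
    have hi: "integrable arcsine h"
      using h1 hm hA by (intro integrableI_nonneg) (auto simp: le_less_trans)
    have h2: "(\<integral>x. h x \<partial>arcsine) \<le> 1"
    proof -
      have "ennreal (\<integral>x. h x \<partial>arcsine) \<le> ennreal 1"
        using nn_integral_eq_integral[OF hi hA] h1 by simp
      then show ?thesis by (subst (asm) ennreal_le_iff) auto
    qed
    have lf: "integrable arcsine (\<lambda>x. ln (f x))"
      by (intro integrable_PM[OF arcsine_PM] continuous_on_ln_pos f)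
    \<comment> \<open>The defect h - 1 - ln h; its integral is zero in the equality case.\<close>
    define u where "u = (\<lambda>x. h x - 1 - (ln (f x) - ln (g x) - ln s))"
    have ui: "integrable arcsine u" unfolding u_def using hi lf i by simp
    have uA: "AE x in arcsine. 0 \<le> u x \<and> (u x = 0 \<longrightarrow> h x = 1)"
      using g(4) AE_space
    proof eventually_elim
      case (elim x)
      then have fx: "0 < f x" using f(2) sets_arcsine by auto
      have gx: "0 < g x" using elim by (simp add: g_def)
      with fx s have hp: "0 < h x" by (simp add: h_def)
      have "ln (h x) = ln (f x) - ln (g x) - ln s"
        using fx gx s by (simp add: h_def ln_div ln_mult)
      then have "u x = h x - 1 - ln (h x)" by (simp add: u_def)
      then show ?case using hp ln_le_minus_one[of "h x"] ln_eq_minus_one[of "h x"] by auto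
    qed
    have iu: "(\<integral>x. u x \<partial>arcsine) = (\<integral>x. h x \<partial>arcsine) - 1 - ((\<integral>x. ln (f x) \<partial>arcsine) - (\<integral>x. ln (g x) \<partial>arcsine) - ln s)"
      unfolding u_def using hi lf i by (simp add: \<nu>.prob_space)
    have u0: "0 \<le> (\<integral>x. u x \<partial>arcsine)" using uA by (intro integral_nonneg_AE) auto
    have le: ?le using u0 h2 unfolding iu \<open>kl arcsine \<mu> = _\<close> s_def[symmetric] by simp
    have "\<mu> = density arcsine (\<lambda>x. ennreal (s / f x))" if eq: "kl arcsine \<mu> = ereal ((\<integral>x. ln (f x) \<partial>arcsine) - ln s)"
    proof -
      from eq have "(\<integral>x. u x \<partial>arcsine) = (\<integral>x. h x \<partial>arcsine) - 1"
        unfolding iu \<open>kl arcsine \<mu> = ereal (\<integral>x. ln (g x) \<partial>arcsine)\<close> by simp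
      with u0 h2 have "(\<integral>x. u x \<partial>arcsine) = 0" by linarith
      then have "AE x in arcsine. u x = 0"
        using uA by (subst (asm) integral_nonneg_eq_0_iff_AE[OF ui]) auto
      with uA have h_eq: "AE x in arcsine. h x = 1" by eventually_elim auto
      then have "(\<integral>\<^sup>+x. ennreal (h x) \<partial>arcsine) = (\<integral>\<^sup>+x. 1 \<partial>arcsine)"
        by (intro nn_integral_cong_AE) (auto elim: eventually_mono)
      then have k1: "(\<integral>\<^sup>+x. ennreal (k x) \<partial>\<mu>) = 1" using gh by (simp add: \<nu>.emeasure_space_1)
      have km: "k \<in> borel_measurable \<mu>" unfolding k_def using g fm by measurable
      have "(\<integral>\<^sup>+x. ennreal (f x / s) - ennreal (k x) \<partial>\<mu>) = 1 - 1"
        using km fm k1 f_s f(2) s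
        by (subst nn_integral_diff) (auto simp: sp k_def intro!: AE_I2 ennreal_leI)
      then have "(\<integral>\<^sup>+x. ennreal (f x / s) - ennreal (k x) \<partial>\<mu>) = 0" by simp
      then have "AE x in \<mu>. ennreal (f x / s) - ennreal (k x) = 0"
        using km fm by (subst (asm) nn_integral_0_iff_AE) auto
      \<comment> \<open>Equality leaves no room for a singular part, since f / s is positive
        everywhere.\<close>
      with AE_space have gp: "AE x in \<mu>. 0 < g x"
      proof eventually_elim
        case (elim x)
        then have "0 < f x / s" using f(2) sp s by simp
        with elim show ?case by (auto simp: k_def split: if_splits)
      qed
      have "AE x in density \<mu> (\<lambda>x. ennreal (g x)). h x = 1"
        using h_eq by (simp only: g(3)[symmetric])
      then have "AE x in \<mu>. 0 < ennreal (g x) \<longrightarrow> h x = 1"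
        using g(1) by (subst (asm) AE_density) auto
      with gp have AE1: "AE x in \<mu>. h x = 1 \<and> 0 < g x" by eventually_elim auto
      have m2: "(\<lambda>x. ennreal (s / f x)) \<in> borel_measurable \<mu>" using fm by simp
      have "density arcsine (\<lambda>x. ennreal (s / f x)) = density (density \<mu> (\<lambda>x. ennreal (g x))) (\<lambda>x. ennreal (s / f x))"
        by (simp only: g(3)[symmetric])
      also have "\<dots> = density \<mu> (\<lambda>x. ennreal (g x) * ennreal (s / f x))"
        using g(1) m2 by (intro density_density_eq) auto
      also have "\<dots> = density \<mu> (\<lambda>_. 1)"
      proof (rule density_cong)
        show "AE x in \<mu>. ennreal (g x) * ennreal (s / f x) = 1"
          using AE1 AE_space
        proof eventually_elim
          case (elim x)
          then have "f x = g x * s" "0 < f x" using s f(2) sp by (auto simp: h_def field_simps)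
          then have "g x * (s / f x) = 1" using elim s by simp
          then show ?case using elim s by (simp flip: ennreal_mult' add: \<open>f x = g x * s\<close>)
        qed
      qed (use g fm in auto)
      also have "\<dots> = \<mu>" by (rule density_1)
      finally show ?thesis by simp
    qed
    with le show ?thesis by blast
  qed auto
  then show ?le and "kl arcsine \<mu> = ereal ((\<integral>x. ln (f x) \<partial>arcsine) - ln (\<integral>x. f x \<partial>\<mu>)) \<Longrightarrow>
      \<mu> = density arcsine (\<lambda>x. ennreal ((\<integral>x. f x \<partial>\<mu>) / f x))"
    unfolding s_def by auto
qed

lemma abs_ln_diff_le:
  fixes a x y :: real
  assumes "0 < a" "a \<le> x" "a \<le> y"
  shows "\<bar>ln x - ln y\<bar> \<le> \<bar>x - y\<bar> / a"
proof -
  have *: "ln u - ln v \<le> \<bar>u - v\<bar> / a" if "a \<le> u" "a \<le> v" for u v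
  proof -
    have "ln u - ln v = ln (u / v)" using that assms by (simp add: ln_div)
    also have "\<dots> \<le> u / v - 1" using that assms by (intro ln_le_minus_one) auto
    also have "\<dots> = (u - v) / v" using that assms by (simp add: field_simps)
    also have "\<dots> \<le> \<bar>u - v\<bar> / v" using that assms by (intro divide_right_mono) auto
    also have "\<dots> \<le> \<bar>u - v\<bar> / a" using that assms by (intro divide_left_mono) auto
    finally show ?thesis .
  qed
  from *[OF assms(2,3)] *[OF assms(3,2)] show ?thesis by (simp add: abs_le_iff abs_minus_commute)
qed

text \<open>The inequality passes from continuous to bounded measurable test functions by approximation
  in \<open>L\<^sup>1\<close> of the mean of \<open>\<mu>\<close> and the arcsine law.\<close>

lemma donsker_varadhan_measurable:
  fixes f :: "real \<Rightarrow> real" and \<kappa> :: real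
  assumes \<mu>: "\<mu> \<in> PM"
    and hyp: "\<And>f :: real \<Rightarrow> real. continuous_on {0..1} f \<Longrightarrow> (\<And>x. x \<in> {0..1} \<Longrightarrow> 0 < f x) \<Longrightarrow>
        (\<integral>x. ln (f x) \<partial>arcsine) \<le> \<kappa> + ln (\<integral>x. f x \<partial>\<mu>)"
    and f: "f \<in> borel_measurable (restrict_space borel {0..1})"
    and ab: "0 < a" "\<And>x. x \<in> {0..1} \<Longrightarrow> a \<le> f x" "\<And>x. x \<in> {0..1} \<Longrightarrow> f x \<le> b"
  shows "(\<integral>x. ln (f x) \<partial>arcsine) \<le> \<kappa> + ln (\<integral>x. f x \<partial>\<mu>)"
proof (rule field_le_epsilon)
  note i = integrable_PM[OF \<mu>] integrable_PM[OF arcsine_PM]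
  note sp = PM_D[OF \<mu>] PM_D[OF arcsine_PM]
  interpret \<mu>: prob_space \<mu> using sp by simp
  interpret \<nu>: prob_space arcsine using sp by simp
  have fm: "f \<in> borel_measurable \<mu>" "f \<in> borel_measurable arcsine"
    using f sp by (simp_all cong: measurable_cong_sets)
  define \<rho> where "\<rho> = mix (1/2) \<mu> arcsine"
  have \<rho>: "\<rho> \<in> PM" unfolding \<rho>_def by (intro mix_PM \<mu> arcsine_PM)
  have fb: "\<bar>f x\<bar> \<le> b" if "x \<in> {0..1}" for x using ab that by (smt (verit))
  have fi: "integrable \<mu> f" "integrable arcsine f" "integrable \<rho> f"
    using fm f PM_D[OF \<rho>]
    by (auto intro!: integrable_bdd[OF \<mu> _ fb] integrable_bdd[OF arcsine_PM _ fb] integrable_bdd[OF \<rho> _ fb]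
        cong: measurable_cong_sets)
  have lnb: "\<bar>ln (f x)\<bar> \<le> \<bar>ln a\<bar> + \<bar>ln b\<bar>" if "x \<in> {0..1}" for x
  proof -
    have "ln a \<le> ln (f x)" "ln (f x) \<le> ln b" using ab(1) ab(2,3)[OF that] by auto
    then show ?thesis by linarith
  qed
  have lnf: "integrable arcsine (\<lambda>x. ln (f x))"
    by (rule integrable_bdd[OF arcsine_PM _ lnb]) (use fm in auto)
  fix e :: real assume e: "e > 0"
  \<comment> \<open>Replacing f by h on each side of the inequality costs at most 2 d / a, which is
    e / 2.\<close>
  define d where "d = e * a / 4"
  have d: "d > 0" using e ab by (simp add: d_def)
  obtain g where g: "continuous_on {0..1} g" "(\<integral>x. \<bar>f x - g x\<bar> \<partial>\<rho>) < d"
    using apx_integrable[OF \<rho> fi(3)] d by (auto simp: apx_def)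
  \<comment> \<open>Clamping to [a, b] does not increase the distance to f, whose values lie there,
    and keeps h in the region where ln has Lipschitz constant 1 / a.\<close>
  define h where "h = (\<lambda>x. max a (min b (g x)))"
  have hc: "continuous_on {0..1} h" unfolding h_def by (intro continuous_intros g)
  have ha: "a \<le> h x" for x by (simp add: h_def)
  have hf: "\<bar>f x - h x\<bar> \<le> \<bar>f x - g x\<bar>" if "x \<in> {0..1}" for x
    using ab(2,3)[OF that] by (simp add: h_def max_def min_def abs_if)
  have hb: "\<bar>f x - h x\<bar> \<le> 2 * b" if "x \<in> {0..1}" for x
    using ab(1) ab(2,3)[OF that] by (simp add: h_def max_def min_def abs_if)
  have hm: "h \<in> borel_measurable (restrict_space borel {0..1})"
    using hc by (rule borel_measurable_continuous_on_restrict)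
  have gr: "integrable \<rho> g" by (rule integrable_PM[OF \<rho> g(1)])
  have "(\<integral>x. \<bar>f x - h x\<bar> \<partial>\<rho>) \<le> (\<integral>x. \<bar>f x - g x\<bar> \<partial>\<rho>)"
    using hf PM_D[OF \<rho>] fi(3) gr integrable_PM[OF \<rho> hc]
    by (intro integral_mono integrable_abs Bochner_Integration.integrable_diff) auto
  with g have "(\<integral>x. \<bar>f x - h x\<bar> \<partial>\<rho>) < d" by simp
  moreover have "(\<integral>x. \<bar>f x - h x\<bar> \<partial>\<rho>) = (1 - 1/2) * (\<integral>x. \<bar>f x - h x\<bar> \<partial>\<mu>) + 1/2 * (\<integral>x. \<bar>f x - h x\<bar> \<partial>arcsine)"
    unfolding \<rho>_def by (rule integral_mix[OF \<mu> arcsine_PM, where B="2 * b"]) (use f hm hb in auto)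
  moreover have "0 \<le> (\<integral>x. \<bar>f x - h x\<bar> \<partial>\<mu>)" "0 \<le> (\<integral>x. \<bar>f x - h x\<bar> \<partial>arcsine)" by auto
  ultimately have D0: "(\<integral>x. \<bar>f x - h x\<bar> \<partial>\<mu>) / 2 + (\<integral>x. \<bar>f x - h x\<bar> \<partial>arcsine) / 2 < d"
    "0 \<le> (\<integral>x. \<bar>f x - h x\<bar> \<partial>\<mu>)" "0 \<le> (\<integral>x. \<bar>f x - h x\<bar> \<partial>arcsine)" by simp_all
  then have D: "(\<integral>x. \<bar>f x - h x\<bar> \<partial>\<mu>) \<le> 2 * d" "(\<integral>x. \<bar>f x - h x\<bar> \<partial>arcsine) \<le> 2 * d"
    by linarith+
  have lnh: "integrable arcsine (\<lambda>x. ln (h x))"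
    by (intro i continuous_on_ln_pos hc) (use ha ab(1) in \<open>auto intro: less_le_trans\<close>)
  have "(\<integral>x. ln (f x) \<partial>arcsine) - (\<integral>x. ln (h x) \<partial>arcsine) = (\<integral>x. ln (f x) - ln (h x) \<partial>arcsine)"
    using lnf lnh by simp
  also have "\<dots> \<le> (\<integral>x. \<bar>f x - h x\<bar> / a \<partial>arcsine)"
  proof (rule integral_mono)
    fix x assume "x \<in> space arcsine"
    then have "x \<in> {0..1}" using sp by simp
    then show "ln (f x) - ln (h x) \<le> \<bar>f x - h x\<bar> / a"
      using abs_ln_diff_le[OF ab(1) ab(2) ha, of x x] by simp
  qed (use lnf lnh fi i(2)[OF hc] in auto)
  also have "\<dots> \<le> e / 2" using D(2) ab(1) by (simp add: d_def field_simps)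
  finally have 1: "(\<integral>x. ln (f x) \<partial>arcsine) \<le> (\<integral>x. ln (h x) \<partial>arcsine) + e / 2" by simp
  have 2: "(\<integral>x. ln (h x) \<partial>arcsine) \<le> \<kappa> + ln (\<integral>x. h x \<partial>\<mu>)"
    using hc by (rule hyp) (use ha ab(1) in \<open>auto intro: less_le_trans\<close>)
  have ge: "a \<le> (\<integral>x. k x \<partial>\<mu>)" if "integrable \<mu> k" "\<And>x. x \<in> {0..1} \<Longrightarrow> a \<le> k x" for k
  proof -
    have "(\<integral>x. a \<partial>\<mu>) \<le> (\<integral>x. k x \<partial>\<mu>)" using that sp by (intro integral_mono) auto
    then show ?thesis by (simp add: \<mu>.prob_space)
  qed
  have "ln (\<integral>x. h x \<partial>\<mu>) - ln (\<integral>x. f x \<partial>\<mu>) \<le> \<bar>(\<integral>x. h x \<partial>\<mu>) - (\<integral>x. f x \<partial>\<mu>)\<bar> / a"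
    using abs_ln_diff_le[OF ab(1) ge ge, OF i(1)[OF hc] ha fi(1) ab(2)] by simp
  also have "\<bar>(\<integral>x. h x \<partial>\<mu>) - (\<integral>x. f x \<partial>\<mu>)\<bar> \<le> (\<integral>x. \<bar>f x - h x\<bar> \<partial>\<mu>)"
    using fi(1) i(1)[OF hc] integral_abs_bound[of \<mu> "\<lambda>x. f x - h x"] by (simp add: abs_minus_commute)
  also note D(1)
  finally have "ln (\<integral>x. h x \<partial>\<mu>) - ln (\<integral>x. f x \<partial>\<mu>) \<le> 2 * d / a"
    using ab(1) by (simp add: divide_right_mono)
  also have "\<dots> = e / 2" using ab(1) by (simp add: d_def)
  finally show "(\<integral>x. ln (f x) \<partial>arcsine) \<le> \<kappa> + ln (\<integral>x. f x \<partial>\<mu>) + e"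
    using 1 2 by simp
qed

text \<open>Step functions that are large on a null set of \<open>\<mu>\<close> force absolute
  continuity. The optimal test function is then the density itself; it is truncated from both sides,
  and Fatou's lemma removes the truncation.\<close>

lemma donsker_varadhan_ge:
  assumes \<mu>: "\<mu> \<in> PM"
    and hyp: "\<And>f :: real \<Rightarrow> real. continuous_on {0..1} f \<Longrightarrow> (\<And>x. x \<in> {0..1} \<Longrightarrow> 0 < f x) \<Longrightarrow>
        (\<integral>x. ln (f x) \<partial>arcsine) \<le> \<kappa> + ln (\<integral>x. f x \<partial>\<mu>)"
  shows "kl arcsine \<mu> \<le> ereal \<kappa>"
proof -
  have ext: "(\<integral>x. ln (f x) \<partial>arcsine) \<le> \<kappa> + ln (\<integral>x. f x \<partial>\<mu>)"
    if "f \<in> borel_measurable (restrict_space borel {0..1})" "0 < a" "\<And>x. x \<in> {0..1} \<Longrightarrow> a \<le> f x"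
      "\<And>x. x \<in> {0..1} \<Longrightarrow> f x \<le> b" for f :: "real \<Rightarrow> real" and a b
    by (rule donsker_varadhan_measurable[OF \<mu> hyp that])
  note sp = PM_D[OF \<mu>] PM_D[OF arcsine_PM]
  interpret \<mu>: prob_space \<mu> using sp by simp
  interpret \<nu>: prob_space arcsine using sp by simp
  have ss: "sets \<mu> = sets arcsine" using sp by simp
  have ac: "absolutely_continuous \<mu> arcsine"
    unfolding absolutely_continuous_def
  proof
    fix A assume "A \<in> null_sets \<mu>"
    then have A: "A \<in> sets \<mu>" "emeasure \<mu> A = 0" by auto
    then have As: "A \<in> sets (restrict_space borel {0..1})" "A \<in> sets arcsine" using sp by auto
    \<comment> \<open>The test function exp t on A has mean 1 under \<open>\<mu>\<close>. The bound
      is uniform in t, so letting t grow leaves A no arcsine mass.\<close>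
    have le: "t * measure arcsine A \<le> \<kappa>" if t: "t > 0" for t
    proof -
      define f where "f = (\<lambda>x. 1 + (exp t - 1) * indicat_real A x)"
      have f1: "f x = (if x \<in> A then exp t else 1)" for x by (simp add: f_def)
      have "(\<integral>x. ln (f x) \<partial>arcsine) \<le> \<kappa> + ln (\<integral>x. f x \<partial>\<mu>)"
      proof (rule ext[where a=1 and b="exp t"])
        show "f \<in> borel_measurable (restrict_space borel {0..1})" unfolding f_def using As by simp
      qed (use t in \<open>auto simp: f1\<close>)
      also have "(\<integral>x. f x \<partial>\<mu>) = 1"
      proof -
        have "AE x in \<mu>. x \<notin> A" using A by (intro AE_not_in) (simp add: null_sets_def)
        then have "AE x in \<mu>. f x = 1" by eventually_elim (simp add: f_def)
        then have "(\<integral>x. f x \<partial>\<mu>) = (\<integral>x. 1 \<partial>\<mu>)"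
          using A by (intro integral_cong_AE) (auto simp: f_def)
        then show ?thesis by (simp add: \<mu>.prob_space)
      qed
      also have "(\<lambda>x. ln (f x)) = (\<lambda>x. t * indicat_real A x)" using f1 by (auto simp: fun_eq_iff)
      finally show ?thesis using As by simp
    qed
    have "measure arcsine A = 0"
    proof (rule ccontr)
      assume "measure arcsine A \<noteq> 0"
      then have p: "measure arcsine A > 0" by (simp add: less_le)
      have "0 < (\<bar>\<kappa>\<bar> + 1) / measure arcsine A" using p by simp
      from le[OF this] p show False by simp
    qed
    then show "A \<in> null_sets arcsine" using As by (auto simp: null_sets_def \<nu>.emeasure_eq_measure)
  qed
  define g where "g = rnd \<mu>"
  have g0: "g x \<ge> 0" for x by (simp add: g_def)
  have gm: "g \<in> borel_measurable \<mu>" "g \<in> borel_measurable arcsine"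
    using rnd_props(1,2)[OF \<mu> ac] by (simp_all add: g_def)
  have gp: "AE x in arcsine. 0 < g x" using rnd_props(4)[OF \<mu> ac] by (simp add: g_def)
  have g1: "(\<integral>\<^sup>+x. ennreal (g x) \<partial>\<mu>) = 1"
    using nn_integral_arcsine_rnd[OF \<mu> ac, of "\<lambda>_. 1"] by (simp add: g_def \<nu>.emeasure_space_1)
  then have gi: "integrable \<mu> g" using gm g0 by (intro integrableI_nonneg) auto
  have gI: "(\<integral>x. g x \<partial>\<mu>) = 1"
    using g1 g0 by (simp add: integral_eq_nn_integral gm)
  define N where "N = enn2real (\<integral>\<^sup>+x. ennreal (- ln (g x)) \<partial>arcsine)"
  have Nfin: "(\<integral>\<^sup>+x. ennreal (- ln (g x)) \<partial>arcsine) = ennreal N"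
    using ln_rnd_neg[OF \<mu> ac] unfolding N_def g_def by (intro ennreal_enn2real[symmetric]) (auto intro: le_less_trans)
  have N0: "N \<ge> 0" by (simp add: N_def)
  define neg where "neg = (\<lambda>x. max 0 (- ln (g x)))"
  have negI: "integrable arcsine neg" "(\<integral>x. neg x \<partial>arcsine) = N"
  proof -
    have e: "(\<integral>\<^sup>+x. ennreal (neg x) \<partial>arcsine) = ennreal N"
      unfolding Nfin[symmetric] neg_def by (intro nn_integral_cong) (simp add: ennreal_max_0)
    then show "integrable arcsine neg"
      using gm by (intro integrableI_nonneg) (auto simp: neg_def)
    show "(\<integral>x. neg x \<partial>arcsine) = N"
      using e gm N0 by (subst integral_eq_nn_integral) (auto simp: neg_def)
  qed
  define p where "p = (\<lambda>n x. min (max 0 (ln (g x))) (ln (real (Suc n))))"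
  have pb: "0 \<le> p n x" "p n x \<le> ln (real (Suc n))" for n x by (auto simp: p_def)
  have pI: "integrable arcsine (p n)" for n
    using pb[of n] gm by (intro integrable_bdd[OF arcsine_PM, of _ "ln (real (Suc n))"]) (auto simp: p_def)
  have pn: "(\<integral>x. p n x \<partial>arcsine) \<le> \<kappa> + 1 / real (Suc n) + N" for n
  proof -
    \<comment> \<open>The truncated density. The cut from below only raises its logarithm, which
      therefore dominates \<open>p n - neg\<close>.\<close>
    define f where "f = (\<lambda>x. max (1 / real (Suc n)) (min (g x) (real (Suc n))))"
    have fm: "f \<in> borel_measurable (restrict_space borel {0..1})"
      using gm(1) sp(2) unfolding f_def by (simp cong: measurable_cong_sets)
    have f1: "1 / real (Suc n) \<le> f x" "f x \<le> real (Suc n)" for x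
      by (auto simp: f_def field_simps)
    have f2: "\<bar>f x\<bar> \<le> real (Suc n)" for x
    proof -
      have "0 \<le> 1 / real (Suc n)" by simp
      with f1[of x] show ?thesis by linarith
    qed
    have fi: "integrable \<mu> f"
      using f2 fm sp(2) by (intro integrable_bdd[OF \<mu>, of _ "real (Suc n)"]) (auto cong: measurable_cong_sets)
    have "(\<integral>x. p n x \<partial>arcsine) - N = (\<integral>x. p n x - neg x \<partial>arcsine)"
      using pI negI by simp
    also have "\<dots> \<le> (\<integral>x. ln (f x) \<partial>arcsine)"
    proof (rule integral_mono_AE)
      show "integrable arcsine (\<lambda>x. ln (f x))"
      proof (rule integrable_bdd[OF arcsine_PM])
        show "(\<lambda>x. ln (f x)) \<in> borel_measurable arcsine" using gm unfolding f_def by simp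
        fix x :: real
        have "ln (1 / real (Suc n)) \<le> ln (f x)" by (subst ln_le_cancel_iff) (use f1(1)[of x] in \<open>auto intro: less_le_trans[rotated]\<close>)
        moreover have "ln (f x) \<le> ln (real (Suc n))"
          by (subst ln_le_cancel_iff) (use f1[of x] in \<open>auto intro: less_le_trans[rotated]\<close>)
        ultimately show "\<bar>ln (f x)\<bar> \<le> ln (real (Suc n))" by (simp add: ln_div)
      qed
      show "AE x in arcsine. p n x - neg x \<le> ln (f x)"
        using gp
      proof eventually_elim
        case (elim x)
        define m where "m = real (Suc n)"
        have m: "m \<ge> 1" by (simp add: m_def)
        have "ln (f x) = max (ln (1 / m)) (min (ln (g x)) (ln m))"
        proof -
          have "f x = max (1 / m) (min (g x) m)" by (simp only: f_def m_def)
          moreover have "0 < 1 / m" "0 < m" using m by auto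
          ultimately show ?thesis using elim by (auto simp: max_def min_def)
        qed
        moreover have "ln m \<ge> 0" "ln (1 / m) = - ln m" using m by (auto simp: ln_div)
        moreover have "p n x = min (max 0 (ln (g x))) (ln m)" by (simp only: p_def m_def)
        ultimately show ?case by (simp add: neg_def max_def min_def)
      qed
    qed (use pI negI in auto)
    also have "\<dots> \<le> \<kappa> + ln (\<integral>x. f x \<partial>\<mu>)"
      by (rule ext[OF fm, of "1 / real (Suc n)" "real (Suc n)"]) (use f1 in auto)
    also have "ln (\<integral>x. f x \<partial>\<mu>) \<le> (\<integral>x. f x \<partial>\<mu>) - 1"
    proof (rule ln_le_minus_one)
      have "(\<integral>x. 1 / real (Suc n) \<partial>\<mu>) \<le> (\<integral>x. f x \<partial>\<mu>)"
        using f1 fi by (intro integral_mono) auto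
      then show "0 < (\<integral>x. f x \<partial>\<mu>)" by (simp add: \<mu>.prob_space less_le_trans[rotated])
    qed
    \<comment> \<open>The cut from below adds at most 1 / (n + 1) to g, and g has mean 1.\<close>
    also have "(\<integral>x. f x \<partial>\<mu>) \<le> (\<integral>x. g x + 1 / real (Suc n) \<partial>\<mu>)"
    proof (rule integral_mono)
      fix x
      have "0 \<le> 1 / real (Suc n)" by simp
      then show "f x \<le> g x + 1 / real (Suc n)" using g0[of x] unfolding f_def by linarith
    qed (use gi fi in auto)
    also have "\<dots> = 1 + 1 / real (Suc n)" using gi gI by (simp add: \<mu>.prob_space)
    finally show ?thesis by simp
  qed
  have "(\<integral>\<^sup>+x. ennreal (ln (g x)) \<partial>arcsine) = (\<integral>\<^sup>+x. liminf (\<lambda>n. ennreal (p n x)) \<partial>arcsine)"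
  proof (intro nn_integral_cong)
    fix x
    have "eventually (\<lambda>n. p n x = max 0 (ln (g x))) sequentially"
    proof -
      have "filterlim (\<lambda>n. ln (real (Suc n))) at_top sequentially" by real_asymp
      then have "eventually (\<lambda>n. max 0 (ln (g x)) \<le> ln (real (Suc n))) sequentially"
        by (simp add: filterlim_at_top)
      then show ?thesis by eventually_elim (simp add: p_def)
    qed
    then have "(\<lambda>n. ennreal (p n x)) \<longlonglongrightarrow> ennreal (ln (g x))"
      by (intro tendsto_eventually) (auto elim!: eventually_mono simp: ennreal_max_0)
    then show "ennreal (ln (g x)) = liminf (\<lambda>n. ennreal (p n x))"
      by (simp add: lim_imp_Liminf)
  qed
  also have "\<dots> \<le> liminf (\<lambda>n. \<integral>\<^sup>+x. ennreal (p n x) \<partial>arcsine)"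
    using pI by (intro nn_integral_liminf) auto
  also have "\<dots> \<le> liminf (\<lambda>n. ennreal (\<kappa> + 1 / real (Suc n) + N))"
    using pn pb(1) pI by (intro Liminf_mono always_eventually allI) (subst nn_integral_eq_integral, auto intro!: ennreal_leI)
  also have "\<dots> = ennreal (\<kappa> + N)"
  proof -
    have "(\<lambda>n. \<kappa> + 1 / real (Suc n) + N) \<longlonglongrightarrow> \<kappa> + N" by real_asymp
    then have "(\<lambda>n. ennreal (\<kappa> + 1 / real (Suc n) + N)) \<longlonglongrightarrow> ennreal (\<kappa> + N)" by (rule tendsto_ennrealI)
    then show ?thesis by (simp add: lim_imp_Liminf)
  qed
  finally have P: "(\<integral>\<^sup>+x. ennreal (ln (g x)) \<partial>arcsine) \<le> ennreal (\<kappa> + N)" .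
  \<comment> \<open>\<open>ennreal\<close> sends negative reals to 0, so \<open>P\<close> yields a
    real bound only when its right side is nonnegative.\<close>
  have kN: "0 \<le> \<kappa> + N"
  proof (rule LIMSEQ_le_const)
    show "(\<lambda>n. \<kappa> + 1 / real (Suc n) + N) \<longlonglongrightarrow> \<kappa> + N" by real_asymp
    have "0 \<le> \<kappa> + 1 / real (Suc n) + N" for n
    proof -
      have "0 \<le> (\<integral>x. p n x \<partial>arcsine)" using pb(1)[of n] by (intro Bochner_Integration.integral_nonneg)
      with pn[of n] show ?thesis by linarith
    qed
    then show "\<exists>m. \<forall>n\<ge>m. 0 \<le> \<kappa> + 1 / real (Suc n) + N" by blast
  qed
  have "kl arcsine \<mu> = enn2ereal (\<integral>\<^sup>+x. ennreal (ln (g x)) \<partial>arcsine) - enn2ereal (ennreal N)"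
    using ac Nfin by (simp add: kl_def entropy_density_ln g_def)
  also have "\<dots> \<le> enn2ereal (ennreal (\<kappa> + N)) - enn2ereal (ennreal N)"
    using P by (intro ereal_minus_mono) (simp_all add: less_eq_ennreal.rep_eq)
  also have "\<dots> = ereal \<kappa>" using kN N0 by simp
  finally show ?thesis .
qed

section \<open>Bernstein-Szego measures and Szego's theorem\<close>

lemma weierstrass:
  fixes f :: "real \<Rightarrow> real"
  assumes "continuous_on {0..1} f" "e > 0"
  obtains p :: "real poly" where "\<And>x. x \<in> {0..1} \<Longrightarrow> \<bar>f x - poly p x\<bar> < e"
proof -
  obtain g where g: "real_polynomial_function g" "\<And>x. x \<in> {0..1} \<Longrightarrow> \<bar>f x - g x\<bar> < e"
    using Stone_Weierstrass_real_polynomial_function[OF compact_Icc assms] by blast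
  from g(1) obtain a n where a: "g = (\<lambda>x. \<Sum>i\<le>n. a i * x ^ i)"
    unfolding real_polynomial_function_iff_sum by blast
  have "g x = poly (\<Sum>i\<le>n. monom (a i) i) x" for x
    by (simp add: a poly_sum poly_monom)
  with g(2) show thesis by (intro that[of "\<Sum>i\<le>n. monom (a i) i"]) simp
qed

lemma integral_approx:
  fixes f g :: "real \<Rightarrow> real"
  assumes \<mu>: "\<mu> \<in> PM" and f: "continuous_on {0..1} f" and g: "continuous_on {0..1} g"
    and e: "\<And>x. x \<in> {0..1} \<Longrightarrow> \<bar>f x - g x\<bar> \<le> e"
  shows "\<bar>(\<integral>x. f x \<partial>\<mu>) - (\<integral>x. g x \<partial>\<mu>)\<bar> \<le> e"
proof -
  interpret prob_space \<mu> using PM_D[OF \<mu>] by simp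
  have i: "integrable \<mu> f" "integrable \<mu> g" by (auto intro: integrable_PM[OF \<mu>] f g)
  have "\<bar>(\<integral>x. f x \<partial>\<mu>) - (\<integral>x. g x \<partial>\<mu>)\<bar> = \<bar>\<integral>x. f x - g x \<partial>\<mu>\<bar>" using i by simp
  also have "\<dots> \<le> (\<integral>x. \<bar>f x - g x\<bar> \<partial>\<mu>)" by (rule integral_abs_bound)
  also have "\<dots> \<le> (\<integral>x. e \<partial>\<mu>)"
    using i e PM_D[OF \<mu>] by (intro integral_mono) auto
  also have "\<dots> = e" by (simp add: prob_space)
  finally show ?thesis .
qed

lemma integral_poly_eq:
  assumes "\<mu> \<in> PM" "\<nu> \<in> PM" "degree p \<le> n" "\<And>j. 1 \<le> j \<Longrightarrow> j \<le> n \<Longrightarrow> mom \<mu> j = mom \<nu> j"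
  shows "(\<integral>x. poly p x \<partial>\<mu>) = (\<integral>x. poly p x \<partial>\<nu>)"
proof -
  have "mom \<mu> i = mom \<nu> i" if "i \<le> n" for i
    using assms(4)[of i] mom_0[OF assms(1)] mom_0[OF assms(2)] that by (cases i) auto
  then show ?thesis by (simp add: integral_poly[OF _ assms(3)] assms(1,2))
qed

text \<open>The Bernstein-Szego measure has density proportional to \<open>1 / \<bar>\<Psi>\<^sub>n\<bar>\<^sup>2\<close> on the circle.\<close>

lemma bernstein_szego:
  assumes a: "\<forall>i<n. \<bar>verblunsky c i\<bar> < 1"
  obtains \<nu> where "\<nu> \<in> PM" "\<And>j. 1 \<le> j \<Longrightarrow> j \<le> n \<Longrightarrow> cheb (mom \<nu>) j = c j"
    "kl arcsine \<nu> \<le> ereal (- ln (En c n))"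
proof -
  interpret \<mu>0: prob_space arcsine using PM_D[OF arcsine_PM] by simp
  note i = integrable_PM[OF arcsine_PM]
  define Q where "Q = (\<lambda>x. cev (Psi c n) (circ x))"
  have Qc: "continuous_on {0..1} Q" unfolding Q_def by (intro continuous_intros)
  have Q0: "Q x \<noteq> 0" if "x \<in> {0..1}" for x
    using szego_disc[OF a, of "circ x"] that by (simp add: Q_def cmod_circ)
  define v where "v = (\<lambda>x. 1 / (cmod (Q x))\<^sup>2)"
  have vc: "continuous_on {0..1} v" unfolding v_def by (intro continuous_intros Qc) (use Q0 in auto)
  have v0: "0 < v x" if "x \<in> {0..1}" for x using Q0[OF that] by (simp add: v_def)
  define s where "s = (\<integral>x. v x \<partial>arcsine)"
  have s: "s > 0" unfolding s_def by (rule integral_pos_PM[OF arcsine_PM vc v0])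
  define \<nu> where "\<nu> = density arcsine (\<lambda>x. ennreal (v x / s))"
  have vm: "v \<in> borel_measurable arcsine" using sets_arcsine vc by (auto intro: measurable_PM_cont)
  have \<nu>: "\<nu> \<in> PM"
  proof (rule PM_I)
    have "emeasure \<nu> (space \<nu>) = (\<integral>\<^sup>+x. ennreal (v x / s) \<partial>arcsine)"
      unfolding \<nu>_def using vm by (subst emeasure_density) (auto intro!: nn_integral_cong)
    also have "\<dots> = ennreal (\<integral>x. v x / s \<partial>arcsine)"
      using v0 s sets_arcsine by (intro nn_integral_eq_integral i continuous_intros vc AE_I2) (auto simp: less_imp_le)
    also have "\<dots> = 1" using s by (simp add: s_def[symmetric])
    finally show "prob_space \<nu>" by (rule prob_spaceI)
  qed (use sets_arcsine in \<open>simp add: \<nu>_def\<close>)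
  have I: "(\<integral>x. f x \<partial>\<nu>) = (\<integral>x. v x / s * f x \<partial>arcsine)" if "continuous_on {0..1} f" for f :: "real \<Rightarrow> real"
    unfolding \<nu>_def
    using vm v0 s that sets_arcsine
    by (subst integral_real_density) (auto intro!: measurable_PM_cont AE_I2 simp: less_imp_le)
  have o: "orth \<nu> n (Phi c n)"
    unfolding orth_def
  proof (intro allI impI)
    fix j assume j: "j < n"
    \<comment> \<open>On the circle \<open>Psi\<close> is the reversal of \<open>Phi\<close>, so v
      times \<open>Phi\<close> times the conjugate of the j-th power equals F. This F is holomorphic
      in the disc and vanishes at 0 because j < n.\<close>
    define F where "F = (\<lambda>z. z ^ (n - j) / cev (Psi c n) z)"
    have nz: "cev (Psi c n) z \<noteq> 0" if "cmod z \<le> 1" for z using szego_disc[OF a that] by simp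
    have "ip \<nu> (Phi c n) (monom 1 j) = (\<integral>x. v x / s * Re (cev (Phi c n) (circ x) * cnj (cev (monom 1 j) (circ x))) \<partial>arcsine)"
      unfolding ip_def by (rule I) (intro continuous_intros)
    also have "\<dots> = (\<integral>x. 1 / s * Re (F (circ x)) \<partial>arcsine)"
    proof (intro Bochner_Integration.integral_cong refl)
      fix x assume "x \<in> space arcsine"
      then have x: "x \<in> {0..1}" using sets_arcsine by simp
      define z P where "z = circ x" "P = cev (Phi c n) z"
      have z: "z * cnj z = 1" "z \<noteq> 0" using circ_mult_cnj[OF x] by (auto simp: z_P_def)
      have QP: "Q x = z ^ n * cnj P" by (simp add: Q_def z_P_def Psi_circ[OF x])
      then have P0: "P \<noteq> 0" using Q0[OF x] by auto
      have cm: "cmod (Q x) = cmod P" by (simp add: QP norm_mult norm_power z_P_def cmod_circ[OF x])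
      have vP: "complex_of_real (v x) = 1 / (P * cnj P)"
        unfolding v_def cm complex_norm_square[symmetric] by simp
      have zj: "z ^ j * cnj z ^ j = 1"
        by (simp only: z power_mult_distrib[symmetric] power_one)
      have "z ^ n = z ^ (n - j) * z ^ j" using j by (simp flip: power_add)
      then have zn: "z ^ n * cnj z ^ j = z ^ (n - j)" by (simp only: zj mult.assoc mult_1_right)
      have "complex_of_real (v x) * (P * cnj (z ^ j)) = cnj z ^ j / cnj P"
        using P0 by (simp add: vP)
      also have "\<dots> = (z ^ n * cnj z ^ j) / (z ^ n * cnj P)"
        by (subst mult_divide_mult_cancel_left) (use z(2) in simp_all)
      also have "\<dots> = F z" by (simp only: zn QP[symmetric]) (simp add: F_def Q_def z_P_def)
      finally have "Re (complex_of_real (v x) * (P * cnj (z ^ j))) = Re (F z)" by (rule arg_cong)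
      then have "v x * Re (P * cnj (z ^ j)) = Re (F z)"
        by (simp only: Re_complex_of_real Im_complex_of_real mult_zero_left diff_zero times_complex.sel(1))
      then show "v x / s * Re (cev (Phi c n) (circ x) * cnj (cev (monom 1 j) (circ x))) = 1 / s * Re (F (circ x))"
        by (simp add: z_P_def cev_monom)
    qed
    also have "\<dots> = 1 / s * (\<integral>x. Re (F (circ x)) \<partial>arcsine)" by simp
    also have "(\<integral>x. Re (F (circ x)) \<partial>arcsine) = Re (F 0)"
    proof (rule integral_arcsine_holomorphic)
      show "continuous_on (cball 0 1) F"
        unfolding F_def using nz by (intro continuous_intros continuous_on_cev_id) auto
      show "F holomorphic_on ball 0 1"
        unfolding F_def using nz by (intro holomorphic_intros holomorphic_on_cev) auto
    qed (simp add: F_def cev_cnj flip: complex_cnj_power complex_cnj_divide)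
    also have "Re (F 0) = 0" using j by (simp add: F_def power_0_left)
    finally show "ip \<nu> (Phi c n) (monom 1 j) = 0" by simp
  qed
  have ch: "cheb (mom \<nu>) j = c j" if "1 \<le> j" "j \<le> n" for j
    using orth_determines[OF \<nu> o a that] by simp
  define c' where "c' = cheb (mom \<nu>)"
  have eq: "Phi c' n = Phi c n" "En c' n = En c n"
    using szego_cong[of n c' c] ch by (auto simp: c'_def)
  \<comment> \<open>The density v cancels the squared modulus of \<open>Phi\<close> on the circle,
    so the norm is the reciprocal of the normalising constant s.\<close>
  have "En c n = ip \<nu> (Phi c n) (Phi c n)"
    using orth_Phi[OF \<nu> c'_def, of n] by (simp add: eq)
  also have "\<dots> = (\<integral>x. v x / s * (cmod (cev (Phi c n) (circ x)))\<^sup>2 \<partial>arcsine)"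
    unfolding ip_self by (rule I) (intro continuous_intros)
  also have "\<dots> = (\<integral>x. 1 / s \<partial>arcsine)"
  proof (rule Bochner_Integration.integral_cong[OF refl])
    fix x assume "x \<in> space arcsine"
    then have x: "x \<in> {0..1}" using sets_arcsine by simp
    then show "v x / s * (cmod (cev (Phi c n) (circ x)))\<^sup>2 = 1 / s"
      using Q0[OF x] by (simp add: v_def Q_def flip: cmod_Psi_circ[OF x])
  qed
  also have "\<dots> = 1 / s" using \<mu>0.prob_space by simp
  finally have Es: "En c n = 1 / s" .
  have "kl arcsine \<nu> \<le> ereal (- ln (En c n))"
  proof (rule donsker_varadhan_ge[OF \<nu>])
    fix f :: "real \<Rightarrow> real"
    assume f: "continuous_on {0..1} f" "\<And>x. x \<in> {0..1} \<Longrightarrow> 0 < f x"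
    define t where "t = (\<integral>x. f x \<partial>\<nu>)"
    have t: "t > 0" unfolding t_def by (rule integral_pos_PM[OF \<nu> f])
    have te: "t = (\<integral>x. v x / s * f x \<partial>arcsine)" unfolding t_def by (rule I[OF f(1)])
    have lf: "integrable arcsine (\<lambda>x. ln (f x))" by (rule i, rule continuous_on_ln_pos[OF f])
    have lQ: "integrable arcsine (\<lambda>x. ln (cmod (Q x)))"
      by (rule i, rule continuous_on_ln_pos) (use Q0 in \<open>auto intro!: continuous_on_norm Qc\<close>)
    \<comment> \<open>Jensen's inequality for the logarithm in the form ln y <= y - 1. The term with
      \<open>Q\<close> integrates to zero, so the density v / s contributes only - ln s, which is ln
      (\<open>En c n\<close>).\<close>
    have "(\<integral>x. ln (f x) - 2 * ln (cmod (Q x)) - ln s - ln t \<partial>arcsine) \<le> (\<integral>x. v x / s * f x / t - 1 \<partial>arcsine)"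
    proof (rule integral_mono)
      fix x assume "x \<in> space arcsine"
      then have x: "x \<in> {0..1}" using sets_arcsine(2) by simp
      have "ln (v x / s * f x / t) = ln (f x) - 2 * ln (cmod (Q x)) - ln s - ln t"
        using v0[OF x] f(2)[OF x] s t Q0[OF x] by (simp add: v_def ln_div ln_mult ln_realpow)
      moreover have "0 < v x / s * f x / t" using v0[OF x] f(2)[OF x] s t by simp
      ultimately show "ln (f x) - 2 * ln (cmod (Q x)) - ln s - ln t \<le> v x / s * f x / t - 1"
        using ln_le_minus_one[of "v x / s * f x / t"] by simp
    next
      show "integrable arcsine (\<lambda>x. ln (f x) - 2 * ln (cmod (Q x)) - ln s - ln t)"
        using lf lQ by simp
      show "integrable arcsine (\<lambda>x. v x / s * f x / t - 1)"
        by (rule i, intro continuous_intros vc f(1)) (use s t in auto)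
    qed
    also have "\<dots> = 0"
    proof -
      define w where "w = (\<lambda>x. v x / s * f x)"
      have "integrable arcsine w"
        unfolding w_def by (rule i, intro continuous_intros vc f(1)) (use s in auto)
      then have "(\<integral>x. w x / t - 1 \<partial>arcsine) = (\<integral>x. w x \<partial>arcsine) / t - 1"
        by (simp add: \<mu>0.prob_space)
      also have "(\<integral>x. w x \<partial>arcsine) = t" by (simp only: te w_def)
      finally show ?thesis using t by (simp add: w_def)
    qed
    also have "(\<integral>x. ln (f x) - 2 * ln (cmod (Q x)) - ln s - ln t \<partial>arcsine) =
        (\<integral>x. ln (f x) \<partial>arcsine) - 2 * (\<integral>x. ln (cmod (Q x)) \<partial>arcsine) - ln s - ln t"
      using lf lQ by (simp add: \<mu>0.prob_space)
    also have "(\<integral>x. ln (cmod (Q x)) \<partial>arcsine) = 0"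
      unfolding Q_def by (rule integral_ln_Psi[OF a])
    finally have "(\<integral>x. ln (f x) \<partial>arcsine) - ln s - ln t \<le> 0" by simp
    then show "(\<integral>x. ln (f x) \<partial>arcsine) \<le> - ln (En c n) + ln (\<integral>x. f x \<partial>\<nu>)"
      using s by (simp add: Es ln_div t_def)
  qed
  with \<nu> ch show thesis by (rule that)
qed

text \<open>Replaces a measure by one with the same first n moments whose entropy is controlled by
  these moments alone, even if the given measure has infinite entropy.\<close>

lemma bernstein_szego_PM:
  assumes \<mu>: "\<mu> \<in> PM" and E: "EM n \<mu> > 0"
  obtains \<nu> where "\<nu> \<in> PM" "\<And>j. 1 \<le> j \<Longrightarrow> j \<le> n \<Longrightarrow> mom \<nu> j = mom \<mu> j"
    "kl arcsine \<nu> \<le> ereal (- ln (EM n \<mu>))"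
proof -
  have "\<forall>i<n. \<bar>verblunsky (cheb (mom \<mu>)) i\<bar> < 1" using EM_pos_verblunsky[OF \<mu> E] by blast
  from bernstein_szego[OF this]
  obtain \<nu> where \<nu>: "\<nu> \<in> PM" "\<And>j. 1 \<le> j \<Longrightarrow> j \<le> n \<Longrightarrow> cheb (mom \<nu>) j = cheb (mom \<mu>) j"
    "kl arcsine \<nu> \<le> ereal (- ln (EM n \<mu>))" unfolding EM_def by blast
  show thesis by (rule that[OF \<nu>(1) cheb_inj[OF \<nu>(2)] \<nu>(3)])
qed

text \<open>\<open>Phi\<close> has its zeros inside the disc, so the logarithm is integrated through
  \<open>Psi\<close>, which has the same modulus on the circle.\<close>

lemma integral_ln_Phi:
  assumes \<mu>: "\<mu> \<in> PM" and E: "EM n \<mu> > 0"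
  shows "x \<in> {0..1} \<Longrightarrow> 0 < (cmod (cev (Phi (cheb (mom \<mu>)) n) (circ x)))\<^sup>2"
    and "(\<integral>x. ln ((cmod (cev (Phi (cheb (mom \<mu>)) n) (circ x)))\<^sup>2) \<partial>arcsine) = 0"
proof -
  define c where "c = cheb (mom \<mu>)"
  have a: "\<forall>i<n. \<bar>verblunsky c i\<bar> < 1" using EM_pos_verblunsky[OF \<mu> E] by (simp add: c_def)
  have p: "0 < cmod (cev (Phi c n) (circ x))" if "x \<in> {0..1}" for x
    using szego_disc[OF a, of "circ x"] that cmod_Psi_circ[OF that, of c n] by (auto simp: cmod_circ)
  then show "x \<in> {0..1} \<Longrightarrow> 0 < (cmod (cev (Phi (cheb (mom \<mu>)) n) (circ x)))\<^sup>2"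
    by (auto simp: c_def)
  have "(\<integral>x. ln ((cmod (cev (Phi c n) (circ x)))\<^sup>2) \<partial>arcsine) = (\<integral>x. 2 * ln (cmod (cev (Psi c n) (circ x))) \<partial>arcsine)"
    using p sets_arcsine(2)
    by (intro Bochner_Integration.integral_cong) (auto simp: ln_realpow cmod_Psi_circ)
  also have "\<dots> = 0" using integral_ln_Psi[OF a] by simp
  finally show "(\<integral>x. ln ((cmod (cev (Phi (cheb (mom \<mu>)) n) (circ x)))\<^sup>2) \<partial>arcsine) = 0"
    by (simp add: c_def)
qed

lemma finite_circ_roots:
  assumes "p \<noteq> 0" shows "finite {x. cev p (circ x) = 0}"
proof -
  have "map_poly complex_of_real p \<noteq> 0" using assms by (simp add: map_poly_eq_0_iff)
  then have "finite {z. cev p z = 0}" unfolding cev_def by (rule poly_roots_finite)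
  then have "finite (circ -` {z. cev p z = 0})" by (rule finite_vimageI[OF _ inj_circ])
  then show ?thesis by (simp add: vimage_def)
qed

text \<open>With norm zero \<open>\<mu>\<close> is carried by the finitely many zeros of
  \<open>Phi\<close>, a null set of the arcsine law.\<close>

lemma EM_0_not_ac:
  assumes \<mu>: "\<mu> \<in> PM" and E: "EM n \<mu> = 0"
  shows "\<not> absolutely_continuous \<mu> arcsine"
proof
  assume ac: "absolutely_continuous \<mu> arcsine"
  interpret \<nu>: prob_space arcsine using PM_D[OF arcsine_PM] by simp
  define P where "P = Phi (cheb (mom \<mu>)) n"
  have "ip \<mu> P P = 0" using orth_Phi[OF \<mu> refl, of n] E by (simp add: P_def EM_def)
  then have "AE x in \<mu>. (cmod (cev P (circ x)))\<^sup>2 = 0"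
    unfolding ip_self
    by (subst (asm) integral_nonneg_eq_0_iff_AE) (auto intro!: integrable_PM[OF \<mu>] continuous_intros)
  then have "AE x in arcsine. (cmod (cev P (circ x)))\<^sup>2 = 0"
    using ac PM_D[OF \<mu>] sets_arcsine by (intro absolutely_continuous_AE[of arcsine \<mu>]) auto
  then have "AE x in arcsine. x \<in> {x. cev P (circ x) = 0}" by eventually_elim simp
  moreover
  have fin: "finite {x. cev P (circ x) = 0}"
    using coeff_szego(1)[of "cheb (mom \<mu>)" n] by (intro finite_circ_roots) (auto simp: P_def)
  have "AE x in arcsine. x \<notin> {x. cev P (circ x) = 0}"
  proof -
    have "AE x in lborel. x \<notin> {x. cev P (circ x) = 0}"
      using finite_imp_null_set_lborel[OF fin] by (rule AE_not_in)
    then have "AE x in restrict_space lborel {0..1}. x \<notin> {x. cev P (circ x) = 0}"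
      by (subst AE_restrict_space_iff) (auto elim: eventually_mono)
    then show ?thesis
      unfolding arcsine_def by (subst AE_density) (auto intro!: measurable_restrict_space1 elim: eventually_mono)
  qed
  ultimately have "AE x in arcsine. False" by eventually_elim simp
  then show False by (simp only: \<nu>.AE_const)
qed

text \<open>The squared modulus of \<open>Phi\<close> is a test function with mean
  \<open>EM n \<mu>\<close> under \<open>\<mu>\<close> and logarithmic mean 0, which bounds the
  entropy from below. Conversely the Bernstein-Szego measures share ever more moments with
  \<open>\<mu>\<close> and have entropies at most the supremum, so each Donsker-Varadhan inequality
  passes from them to \<open>\<mu>\<close>.\<close>

theorem szego_kl:
  assumes \<mu>: "\<mu> \<in> PM"
  shows "kl arcsine \<mu> = (SUP n. - elog (EM n \<mu>))"
proof (rule antisym)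
  show "(SUP n. - elog (EM n \<mu>)) \<le> kl arcsine \<mu>"
  proof (rule SUP_least)
    fix n
    show "- elog (EM n \<mu>) \<le> kl arcsine \<mu>"
    proof (cases "EM n \<mu> > 0")
      case True
      define f where "f = (\<lambda>x. (cmod (cev (Phi (cheb (mom \<mu>)) n) (circ x)))\<^sup>2)"
      have "(\<integral>x. f x \<partial>\<mu>) = EM n \<mu>"
        using orth_Phi[OF \<mu> refl, of n] by (simp add: f_def EM_def ip_self)
      moreover have "(\<integral>x. ln (f x) \<partial>arcsine) = 0" unfolding f_def by (rule integral_ln_Phi[OF \<mu> True])
      moreover have "ereal ((\<integral>x. ln (f x) \<partial>arcsine) - ln (\<integral>x. f x \<partial>\<mu>)) \<le> kl arcsine \<mu>"
        unfolding f_def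
        by (intro donsker_varadhan_le[OF \<mu>] continuous_intros integral_ln_Phi[OF \<mu> True])
      ultimately show ?thesis using True by (simp add: elog_def)
    next
      case False
      then have "EM n \<mu> = 0" using EM_nonneg[OF \<mu>, of n] by simp
      then show ?thesis using EM_0_not_ac[OF \<mu>] by (simp add: kl_def)
    qed
  qed
  show "kl arcsine \<mu> \<le> (SUP n. - elog (EM n \<mu>))" (is "_ \<le> ?S")
  proof (cases ?S)
    case (real \<kappa>)
    have le: "- elog (EM n \<mu>) \<le> ereal \<kappa>" for n
      using SUP_upper[of n UNIV "\<lambda>n. - elog (EM n \<mu>)"] real by simp
    have pos: "EM n \<mu> > 0" for n using le[of n] by (auto simp: elog_def split: if_splits)
    have lnE: "- ln (EM n \<mu>) \<le> \<kappa>" for n using le[of n] pos[of n] by (simp add: elog_def)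
    have "kl arcsine \<mu> \<le> ereal \<kappa>"
    proof (rule donsker_varadhan_ge[OF \<mu>])
      fix f :: "real \<Rightarrow> real"
      assume f: "continuous_on {0..1} f" "\<And>x. x \<in> {0..1} \<Longrightarrow> 0 < f x"
      define L where "L = (\<integral>x. ln (f x) \<partial>arcsine)"
      have "exp (L - \<kappa>) \<le> (\<integral>x. f x \<partial>\<mu>)"
      proof (rule field_le_epsilon)
        fix e :: real assume e: "e > 0"
        then have "e / 2 > 0" by simp
        then obtain p where p: "\<And>x. x \<in> {0..1} \<Longrightarrow> \<bar>f x - poly p x\<bar> < e / 2"
          using weierstrass[OF f(1)] by blast
        \<comment> \<open>The number of shared moments is the degree of p, so p has the same
          integral under both measures.\<close>
        obtain \<nu> where \<nu>: "\<nu> \<in> PM" "\<And>j. 1 \<le> j \<Longrightarrow> j \<le> degree p \<Longrightarrow> mom \<nu> j = mom \<mu> j"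
            "kl arcsine \<nu> \<le> ereal (- ln (EM (degree p) \<mu>))"
          using bernstein_szego_PM[OF \<mu> pos] by blast
        have "ereal (L - ln (\<integral>x. f x \<partial>\<nu>)) \<le> ereal (- ln (EM (degree p) \<mu>))"
          using donsker_varadhan_le(1)[OF \<nu>(1) f] \<nu>(3) unfolding L_def by (rule order.trans)
        with lnE[of "degree p"] have "L - \<kappa> \<le> ln (\<integral>x. f x \<partial>\<nu>)" by simp
        then have "exp (L - \<kappa>) \<le> (\<integral>x. f x \<partial>\<nu>)"
          using integral_pos_PM[OF \<nu>(1) f] by (simp add: ln_ge_iff)
        moreover have "\<bar>(\<integral>x. f x \<partial>\<nu>) - (\<integral>x. poly p x \<partial>\<nu>)\<bar> \<le> e / 2"
          by (rule integral_approx[OF \<nu>(1) f(1)]) (intro continuous_intros, rule less_imp_le, rule p)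
        moreover have "\<bar>(\<integral>x. f x \<partial>\<mu>) - (\<integral>x. poly p x \<partial>\<mu>)\<bar> \<le> e / 2"
          by (rule integral_approx[OF \<mu> f(1)]) (intro continuous_intros, rule less_imp_le, rule p)
        moreover have "(\<integral>x. poly p x \<partial>\<nu>) = (\<integral>x. poly p x \<partial>\<mu>)"
          by (rule integral_poly_eq[OF \<nu>(1) \<mu> order.refl]) (use \<nu> in auto)
        ultimately show "exp (L - \<kappa>) \<le> (\<integral>x. f x \<partial>\<mu>) + e" by linarith
      qed
      then have "L - \<kappa> \<le> ln (\<integral>x. f x \<partial>\<mu>)"
        using integral_pos_PM[OF \<mu> f] by (simp add: ln_ge_iff)
      then show "(\<integral>x. ln (f x) \<partial>arcsine) \<le> \<kappa> + ln (\<integral>x. f x \<partial>\<mu>)" by (simp add: L_def)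
    qed
    then show ?thesis using real by simp
  next
    case MInf
    have "- elog (EM 0 \<mu>) \<le> ?S" by (rule SUP_upper) simp
    then show ?thesis using MInf by (simp add: elog_def)
  qed simp
qed

section \<open>The weak topology\<close>

lemma tendsto_coordinatewise:
  fixes l :: "nat \<Rightarrow> real"
  assumes "\<And>i. ((\<lambda>k. f k i) \<longlongrightarrow> l i) F"
  shows "(f \<longlongrightarrow> l) F"
proof -
  have "limitin (product_topology (\<lambda>_::nat. euclideanreal) UNIV) f l F"
    unfolding limitin_componentwise using assms by simp
  then show ?thesis by (simp add: euclidean_product_topology)
qed

lemma integral_distr_PM:
  fixes f :: "real \<Rightarrow> real"
  assumes "\<mu> \<in> PM" "f \<in> borel_measurable borel"
  shows "(\<integral>x. f x \<partial>distr \<mu> borel (\<lambda>x. x)) = (\<integral>x. f x \<partial>\<mu>)"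
  by (rule integral_distr) (rule borel_measurable_PM[OF assms(1)], simp, rule assms(2))

text \<open>Helly selection on the real line: the interval makes the sequence tight. The limit lives
  on the line and has to be shown to charge only the interval.\<close>

lemma PM_sequentially_compact:
  assumes \<mu>: "\<And>k. \<mu> k \<in> PM"
  obtains \<nu> r where "\<nu> \<in> PM" "strict_mono (r :: nat \<Rightarrow> nat)" "\<And>j. (\<lambda>k. mom (\<mu> (r k)) j) \<longlonglongrightarrow> mom \<nu> j"
proof -
  define N where "N = (\<lambda>k. distr (\<mu> k) borel (\<lambda>x. x))"
  have idm: "(\<lambda>x. x) \<in> borel_measurable (\<mu> k)" for k
    by (rule borel_measurable_PM[OF \<mu>]) simp
  have rd: "real_distribution (N k)" for k
    unfolding N_def using idm PM_D(1)[OF \<mu>]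
    by (intro real_distribution.intro prob_space.prob_space_distr) (auto simp: real_distribution_axioms_def)
  have "measure (N k) {-1<..2} = 1" for k
  proof -
    have "measure (N k) {-1<..2} = measure (\<mu> k) ((\<lambda>x. x) -` {-1<..2} \<inter> space (\<mu> k))"
      unfolding N_def by (rule measure_distr[OF idm]) simp
    also have "(\<lambda>x. x) -` {-1<..2} \<inter> space (\<mu> k) = space (\<mu> k)" using PM_D(3)[OF \<mu>] by auto
    also have "measure (\<mu> k) (space (\<mu> k)) = 1" by (rule prob_space.prob_space[OF PM_D(1)[OF \<mu>]])
    finally show ?thesis .
  qed
  then have "tight N"
    unfolding tight_def using rd
    by (intro conjI allI impI exI[of _ "- 1 :: real"] exI[of _ "2 :: real"]) auto
  from tight_imp_convergent_subsubsequence[OF this strict_mono_id]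
  obtain r M where r: "strict_mono (r :: nat \<Rightarrow> nat)" and M: "real_distribution M" and conv: "weak_conv_m (N \<circ> r) M"
    by (auto simp: id_def comp_def)
  interpret M: real_distribution M by (rule M)
  have lim: "(\<lambda>k. \<integral>x. f x \<partial>\<mu> (r k)) \<longlonglongrightarrow> (\<integral>x. f x \<partial>M)"
    if f: "continuous_on UNIV f" "\<And>x. \<bar>f x\<bar> \<le> 1" for f :: "real \<Rightarrow> real"
  proof -
    have "(\<lambda>k. integral\<^sup>L ((N \<circ> r) k) f) \<longlonglongrightarrow> integral\<^sup>L M f"
      using rd M conv f by (intro weak_conv_imp_integral_bdd_continuous_conv[where B=1])
        (auto simp: continuous_on_eq_continuous_at comp_def)
    then show ?thesis
      using f(1) by (simp add: N_def integral_distr_PM[OF \<mu>] borel_measurable_continuous_onI)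
  qed
  \<comment> \<open>Bounded, continuous, nonnegative and zero exactly on [0, 1]: its zero integral
    passes to the limit and confines the limit to the interval.\<close>
  define h where "h = (\<lambda>x::real. min 1 (max 0 (max (- x) (x - 1))))"
  have hc: "continuous_on UNIV h" unfolding h_def by (intro continuous_intros)
  have "(\<integral>x. h x \<partial>\<mu> k) = (\<integral>x. 0 \<partial>\<mu> k)" for k
    using PM_D(3)[OF \<mu>] by (intro Bochner_Integration.integral_cong) (auto simp: h_def)
  then have "(\<lambda>k. 0) \<longlonglongrightarrow> (\<integral>x. h x \<partial>M)"
    using lim[OF hc] by (simp add: h_def)
  then have h0: "(\<integral>x. h x \<partial>M) = 0" using LIMSEQ_unique tendsto_const by blast
  have "integrable M h"
    using hc by (intro M.integrable_const_bound[where B=1]) (auto simp: h_def borel_measurable_continuous_onI)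
  then have "AE x in M. h x = 0"
    using h0 by (subst (asm) integral_nonneg_eq_0_iff_AE) (auto simp: h_def)
  then have M01: "AE x in M. x \<in> {0..1}"
    by eventually_elim (auto simp: h_def min_def max_def split: if_splits)
  define \<nu> where "\<nu> = restrict_space M {0..1}"
  have s\<nu>: "sets \<nu> = sets (restrict_space borel {0..1})"
    unfolding \<nu>_def by (intro sets_restrict_space_cong) simp
  have \<nu>: "\<nu> \<in> PM"
  proof (rule PM_I[OF _ s\<nu>])
    have "emeasure M {0..1} = 1" using M01 by (intro M.emeasure_eq_1_AE) auto
    then show "prob_space \<nu>"
      by (intro prob_spaceI) (simp add: \<nu>_def emeasure_restrict_space space_restrict_space)
  qed
  have int: "(\<integral>x. f x \<partial>\<nu>) = (\<integral>x. f x \<partial>M)" if f: "continuous_on UNIV f" for f :: "real \<Rightarrow> real"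
  proof -
    have fm: "f \<in> borel_measurable borel" using f by (rule borel_measurable_continuous_onI)
    have "(\<integral>x. f x \<partial>\<nu>) = (\<integral>x. indicator {0..1} x * f x \<partial>M)"
      unfolding \<nu>_def by (subst integral_restrict_space) auto
    also have "\<dots> = (\<integral>x. f x \<partial>M)"
      using M01 fm by (intro integral_cong_AE) (auto elim: eventually_mono)
    finally show ?thesis .
  qed
  have "(\<lambda>k. mom (\<mu> (r k)) j) \<longlonglongrightarrow> mom \<nu> j" for j
  proof -
    \<comment> \<open>The power with its argument clamped to [0, 1], a bounded test function on the
      whole line.\<close>
    define g where "g = (\<lambda>x::real. (max 0 (min 1 x)) ^ j)"
    have gc: "continuous_on UNIV g" unfolding g_def by (intro continuous_intros)
    have g1: "\<bar>g x\<bar> \<le> 1" for x unfolding g_def by (auto simp: power_abs abs_le_iff power_le_one)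
    have m: "mom \<rho> j = (\<integral>x. g x \<partial>\<rho>)" if "\<rho> \<in> PM" for \<rho>
      unfolding mom_def using PM_D(3)[OF that]
      by (intro Bochner_Integration.integral_cong) (auto simp: g_def max_def min_def)
    show ?thesis using lim[OF gc g1] by (simp add: m \<mu> \<nu> int[OF gc])
  qed
  with \<nu> r show thesis by (rule that)
qed

text \<open>Compactness is proved for moment sequences because their space is metrizable, where
  convergent subsequences suffice; it is transported to the weak topology afterwards.\<close>

lemma compact_moment_sequences: "compact (mom ` PM)"
  unfolding compact_eq_seq_compact_metric seq_compact_def
proof (intro allI impI)
  fix m :: "nat \<Rightarrow> nat \<Rightarrow> real" assume "\<forall>k. m k \<in> mom ` PM"
  then have "\<forall>k. \<exists>\<mu>. \<mu> \<in> PM \<and> m k = mom \<mu>" by auto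
  from choice[OF this] obtain \<mu> where \<mu>: "\<forall>k. \<mu> k \<in> PM \<and> m k = mom (\<mu> k)" ..
  then have "\<And>k. \<mu> k \<in> PM" by blast
  from PM_sequentially_compact[of \<mu>, OF this] obtain \<nu> r
    where \<nu>: "\<nu> \<in> PM" "strict_mono (r :: nat \<Rightarrow> nat)" "\<And>j. (\<lambda>k. mom (\<mu> (r k)) j) \<longlonglongrightarrow> mom \<nu> j" by blast
  have "(m \<circ> r) \<longlonglongrightarrow> mom \<nu>"
    by (rule tendsto_coordinatewise) (use \<nu>(3) \<mu> in simp)
  with \<nu> show "\<exists>l\<in>mom ` PM. \<exists>r. strict_mono r \<and> (m \<circ> r) \<longlonglongrightarrow> l" by blast
qed

text \<open>Determinacy of the Hausdorff moment problem: Weierstrass extends equality from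
  polynomials to continuous functions, and L1 approximation under the mean of both measures extends
  it to Borel sets.\<close>

lemma mom_inj:
  assumes \<mu>: "\<mu> \<in> PM" and \<nu>: "\<nu> \<in> PM" and eq: "mom \<mu> = mom \<nu>"
  shows "\<mu> = \<nu>"
proof -
  have ceq: "(\<integral>x. f x \<partial>\<mu>) = (\<integral>x. f x \<partial>\<nu>)" if f: "continuous_on {0..1} f" for f :: "real \<Rightarrow> real"
  proof -
    have "\<bar>(\<integral>x. f x \<partial>\<mu>) - (\<integral>x. f x \<partial>\<nu>)\<bar> \<le> 0 + e" if e: "e > 0" for e
    proof -
      have "e / 2 > 0" using e by simp
      then obtain p where p: "\<And>x. x \<in> {0..1} \<Longrightarrow> \<bar>f x - poly p x\<bar> < e / 2"
        using weierstrass[OF f] by blast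
      have "\<bar>(\<integral>x. f x \<partial>\<mu>) - (\<integral>x. poly p x \<partial>\<mu>)\<bar> \<le> e / 2"
        by (rule integral_approx[OF \<mu> f]) (intro continuous_intros, rule less_imp_le, rule p)
      moreover have "\<bar>(\<integral>x. f x \<partial>\<nu>) - (\<integral>x. poly p x \<partial>\<nu>)\<bar> \<le> e / 2"
        by (rule integral_approx[OF \<nu> f]) (intro continuous_intros, rule less_imp_le, rule p)
      moreover have "(\<integral>x. poly p x \<partial>\<mu>) = (\<integral>x. poly p x \<partial>\<nu>)"
        by (rule integral_poly_eq[OF \<mu> \<nu> order.refl]) (simp add: eq)
      ultimately show ?thesis by linarith
    qed
    then have "\<bar>(\<integral>x. f x \<partial>\<mu>) - (\<integral>x. f x \<partial>\<nu>)\<bar> \<le> 0" by (rule field_le_epsilon)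
    then show ?thesis by simp
  qed
  interpret \<mu>: prob_space \<mu> using PM_D[OF \<mu>] by simp
  interpret \<nu>: prob_space \<nu> using PM_D[OF \<nu>] by simp
  show ?thesis
  proof (rule measure_eqI)
    show "sets \<mu> = sets \<nu>" using PM_D[OF \<mu>] PM_D[OF \<nu>] by simp
    fix A assume A: "A \<in> sets \<mu>"
    then have Ar: "A \<in> sets (restrict_space borel {0..1})" "A \<in> sets \<nu>"
      using PM_D[OF \<mu>] PM_D[OF \<nu>] by auto
    define \<rho> where "\<rho> = mix (1/2) \<mu> \<nu>"
    have \<rho>: "\<rho> \<in> PM" unfolding \<rho>_def by (rule mix_PM[OF \<mu> \<nu>])
    have iA: "indicat_real A \<in> borel_measurable (restrict_space borel {0..1})" using Ar by simp
    have Ab: "A \<in> sets borel" using Ar by (auto simp: sets_restrict_space_iff)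
    have "\<bar>measure \<mu> A - measure \<nu> A\<bar> \<le> 0 + e" if e: "e > 0" for e
    proof -
      have "e / 2 > 0" using e by simp
      then obtain g where g: "continuous_on {0..1} g" "(\<integral>x. \<bar>indicat_real A x - g x\<bar> \<partial>\<rho>) < e / 2"
        using apx_indicator[OF \<rho> Ab] unfolding apx_def by blast
      have gm: "g \<in> borel_measurable (restrict_space borel {0..1})"
        using g(1) by (rule borel_measurable_continuous_on_restrict)
      have "bounded (g ` {0..1})" by (intro compact_imp_bounded compact_continuous_image g) simp
      then obtain B where B: "\<And>x. x \<in> {0..1} \<Longrightarrow> \<bar>g x\<bar> \<le> B" by (auto simp: bounded_iff simp del: atLeastAtMost_iff)
      have "(\<integral>x. \<bar>indicat_real A x - g x\<bar> \<partial>\<rho>) =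
          (1 - 1/2) * (\<integral>x. \<bar>indicat_real A x - g x\<bar> \<partial>\<mu>) + 1/2 * (\<integral>x. \<bar>indicat_real A x - g x\<bar> \<partial>\<nu>)"
        unfolding \<rho>_def
      proof (rule integral_mix[OF \<mu> \<nu>, where B="1 + B"])
        show "\<bar>\<bar>indicat_real A x - g x\<bar>\<bar> \<le> 1 + B" if "x \<in> {0..1}" for x
          using B[OF that] by (auto simp: indicator_def)
      qed (use iA gm in auto)
      then have d: "(\<integral>x. \<bar>indicat_real A x - g x\<bar> \<partial>\<mu>) / 2 + (\<integral>x. \<bar>indicat_real A x - g x\<bar> \<partial>\<nu>) / 2 < e / 2"
        using g by simp
      have 1: "\<bar>measure \<mu> A - (\<integral>x. g x \<partial>\<mu>)\<bar> \<le> (\<integral>x. \<bar>indicat_real A x - g x\<bar> \<partial>\<mu>)"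
      proof -
        have "measure \<mu> A - (\<integral>x. g x \<partial>\<mu>) = (\<integral>x. indicat_real A x - g x \<partial>\<mu>)"
          using A integrable_PM[OF \<mu> g(1)] apx_indicator[OF \<mu> Ab] by (simp add: apx_def)
        then show ?thesis by (simp only: integral_abs_bound)
      qed
      have 2: "\<bar>measure \<nu> A - (\<integral>x. g x \<partial>\<nu>)\<bar> \<le> (\<integral>x. \<bar>indicat_real A x - g x\<bar> \<partial>\<nu>)"
      proof -
        have "measure \<nu> A - (\<integral>x. g x \<partial>\<nu>) = (\<integral>x. indicat_real A x - g x \<partial>\<nu>)"
          using Ar integrable_PM[OF \<nu> g(1)] apx_indicator[OF \<nu> Ab] by (simp add: apx_def)
        then show ?thesis by (simp only: integral_abs_bound)
      qed
      from 1 2 d ceq[OF g(1)] show ?thesis by linarith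
    qed
    then have "\<bar>measure \<mu> A - measure \<nu> A\<bar> \<le> 0" by (rule field_le_epsilon)
    then show "emeasure \<mu> A = emeasure \<nu> A" by (simp add: \<mu>.emeasure_eq_measure \<nu>.emeasure_eq_measure)
  qed
qed

section \<open>Neighbourhoods and compactness in the weak topology\<close>

abbreviation W :: "real measure topology" where "W \<equiv> weak_top {0..1}"

lemma topspace_W: "topspace W = PM"
  by (rule topspace_weak_top)

lemma openin_W_integral:
  assumes "continuous_on {0..1} f" "open (U :: real set)"
  shows "openin W {\<mu> \<in> PM. (\<integral>x. f x \<partial>\<mu>) \<in> U}"
proof -
  have "bounded (f ` {0..1})" by (intro compact_imp_bounded compact_continuous_image assms) simp
  then show ?thesis
    unfolding weak_top_def using assms by (intro topology_generated_by_Basis) blast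
qed

lemma openin_W_mom: "open U \<Longrightarrow> openin W {\<mu> \<in> PM. mom \<mu> j \<in> U}"
  unfolding mom_def by (intro openin_W_integral continuous_intros)

text \<open>\<open>EM n\<close> is a minimum, attained at \<open>Phi\<close>, of integrals of
  continuous functions. Being below b is therefore witnessed by a single competitor, which makes it
  an open condition.\<close>

lemma openin_W_EM: "openin W {\<mu> \<in> PM. EM n \<mu> < b}"
proof -
  have "{\<mu> \<in> PM. EM n \<mu> < b} = (\<Union>q\<in>{q. degree q \<le> n \<and> coeff q n = 1}. {\<mu> \<in> PM. ip \<mu> q q \<in> {..<b}})"
    (is "?L = ?R")
  proof
    show "?L \<subseteq> ?R"
    proof
      fix \<mu> assume "\<mu> \<in> ?L"
      then show "\<mu> \<in> ?R"
        using orth_Phi[OF _ refl, of \<mu> n] degree_szego coeff_szego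
        by (auto intro!: exI[of _ "Phi (cheb (mom \<mu>)) n"] simp: EM_def)
    qed
    show "?R \<subseteq> ?L" using EM_le by (auto intro: le_less_trans)
  qed
  also have "openin W \<dots>"
  proof (intro openin_Union ballI, elim imageE, hypsubst)
    show "openin W {\<mu> \<in> PM. ip \<mu> q q \<in> {..<b}}" for q
      unfolding ip_self by (intro openin_W_integral open_lessThan continuous_intros)
  qed
  finally show ?thesis .
qed

text \<open>On a bounded interval finitely many moments control a weak neighbourhood, because
  continuous test functions are uniformly close to polynomials.\<close>

lemma W_neighbourhood:
  assumes "openin W U" "\<mu> \<in> U"
  obtains N e where "e > 0" "\<forall>\<nu>\<in>PM. (\<forall>j. 1 \<le> j \<and> j \<le> N \<longrightarrow> \<bar>mom \<nu> j - mom \<mu> j\<bar> < e) \<longrightarrow> \<nu> \<in> U"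
proof -
  have \<mu>: "\<mu> \<in> PM" using openin_subset[OF assms(1)] assms(2) topspace_W by auto
  define P where "P = (\<lambda>U. \<mu> \<in> U \<longrightarrow> (\<exists>N e. e > 0 \<and> (\<forall>\<nu>\<in>PM. (\<forall>j. 1 \<le> j \<and> j \<le> N \<longrightarrow> \<bar>mom \<nu> j - mom \<mu> j\<bar> < e) \<longrightarrow> \<nu> \<in> U)))"
  have "P U"
    using openin_topology_generated_by[OF assms(1)[unfolded weak_top_def]]
  proof induction
    case (Int a b)
    show ?case
      unfolding P_def
    proof
      assume "\<mu> \<in> a \<inter> b"
      with Int obtain N e N' e' where "e > 0" "\<forall>\<nu>\<in>PM. (\<forall>j. 1 \<le> j \<and> j \<le> N \<longrightarrow> \<bar>mom \<nu> j - mom \<mu> j\<bar> < e) \<longrightarrow> \<nu> \<in> a"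
        "e' > 0" "\<forall>\<nu>\<in>PM. (\<forall>j. 1 \<le> j \<and> j \<le> N' \<longrightarrow> \<bar>mom \<nu> j - mom \<mu> j\<bar> < e') \<longrightarrow> \<nu> \<in> b"
        unfolding P_def by blast
      then show "\<exists>N e. e > 0 \<and> (\<forall>\<nu>\<in>PM. (\<forall>j. 1 \<le> j \<and> j \<le> N \<longrightarrow> \<bar>mom \<nu> j - mom \<mu> j\<bar> < e) \<longrightarrow> \<nu> \<in> a \<inter> b)"
        by (intro exI[of _ "max N N'"] exI[of _ "min e e'"]) auto
    qed
  next
    case (UN K)
    then show ?case unfolding P_def by blast
  next
    case (Basis s)
    then have "\<exists>f U. s = {\<mu> \<in> PM. (\<integral>x. f x \<partial>\<mu>) \<in> U} \<and>
        continuous_on {0..1} f \<and> bounded (f ` {0..1}) \<and> open (U :: real set)"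
      by (simp only: mem_Collect_eq)
    then obtain f U where "s = {\<mu> \<in> PM. (\<integral>x. f x \<partial>\<mu>) \<in> U} \<and>
        continuous_on {0..1} f \<and> bounded (f ` {0..1}) \<and> open (U :: real set)"
      by (elim exE)
    then have s: "s = {\<mu> \<in> PM. (\<integral>x. f x \<partial>\<mu>) \<in> U}" and f: "continuous_on {0..1} f" and U: "open U"
      by (simp_all only: simp_thms)
    show ?case
      unfolding P_def
    proof
      assume "\<mu> \<in> s"
      then have "(\<integral>x. f x \<partial>\<mu>) \<in> U" using s by simp
      then obtain d where d: "d > 0" "ball (\<integral>x. f x \<partial>\<mu>) d \<subseteq> U" using U open_contains_ball by blast
      then have "d / 3 > 0" by simp
      then obtain p where p: "\<And>x. x \<in> {0..1} \<Longrightarrow> \<bar>f x - poly p x\<bar> < d / 3"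
        using weierstrass[OF f] by blast
      define S where "S = (\<Sum>i\<le>degree p. \<bar>coeff p i\<bar>)"
      have S: "S \<ge> 0" unfolding S_def by (intro sum_nonneg) simp
      \<comment> \<open>Moves the integral of p by less than d / 3; the other two thirds pay for
        replacing f by p. The added 1 covers p = 0.\<close>
      define e where "e = d / (3 * (S + 1))"
      have e: "e > 0" using d S by (simp add: e_def)
      have "\<nu> \<in> s" if \<nu>: "\<nu> \<in> PM" and m: "\<forall>j. 1 \<le> j \<and> j \<le> degree p \<longrightarrow> \<bar>mom \<nu> j - mom \<mu> j\<bar> < e" for \<nu>
      proof -
        have m': "\<bar>mom \<nu> i - mom \<mu> i\<bar> \<le> e" if "i \<le> degree p" for i
          using m[rule_format, of i] that e mom_0[OF \<mu>] mom_0[OF \<nu>] by (cases i) auto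
        have "(\<integral>x. poly p x \<partial>\<nu>) - (\<integral>x. poly p x \<partial>\<mu>) = (\<Sum>i\<le>degree p. coeff p i * (mom \<nu> i - mom \<mu> i))"
          by (simp add: integral_poly[OF \<nu> order.refl] integral_poly[OF \<mu> order.refl] right_diff_distrib sum_subtractf)
        also have "\<bar>\<dots>\<bar> \<le> (\<Sum>i\<le>degree p. \<bar>coeff p i * (mom \<nu> i - mom \<mu> i)\<bar>)" by (rule sum_abs)
        also have "\<dots> \<le> (\<Sum>i\<le>degree p. \<bar>coeff p i\<bar> * e)"
          using m' by (intro sum_mono) (auto simp: abs_mult intro: mult_left_mono)
        also have "\<dots> = S * e" by (simp add: S_def sum_distrib_right)
        also have "\<dots> < (S + 1) * e" using e by simp
        also have "\<dots> = d / 3" using S by (simp add: e_def field_simps)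
        finally have "\<bar>(\<integral>x. poly p x \<partial>\<nu>) - (\<integral>x. poly p x \<partial>\<mu>)\<bar> < d / 3" .
        moreover have "\<bar>(\<integral>x. f x \<partial>\<mu>) - (\<integral>x. poly p x \<partial>\<mu>)\<bar> \<le> d / 3"
          by (rule integral_approx[OF \<mu> f]) (intro continuous_intros, rule less_imp_le, rule p)
        moreover have "\<bar>(\<integral>x. f x \<partial>\<nu>) - (\<integral>x. poly p x \<partial>\<nu>)\<bar> \<le> d / 3"
          by (rule integral_approx[OF \<nu> f]) (intro continuous_intros, rule less_imp_le, rule p)
        ultimately have "\<bar>(\<integral>x. f x \<partial>\<mu>) - (\<integral>x. f x \<partial>\<nu>)\<bar> < d" by linarith
        then have "(\<integral>x. f x \<partial>\<nu>) \<in> ball (\<integral>x. f x \<partial>\<mu>) d" by (simp add: dist_real_def)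
        then show ?thesis using d \<nu> by (auto simp: s)
      qed
      then show "\<exists>N e. e > 0 \<and> (\<forall>\<nu>\<in>PM. (\<forall>j. 1 \<le> j \<and> j \<le> N \<longrightarrow> \<bar>mom \<nu> j - mom \<mu> j\<bar> < e) \<longrightarrow> \<nu> \<in> s)"
        using e by blast
    qed
  qed (simp add: P_def)
  then have "\<exists>N e. e > 0 \<and> (\<forall>\<nu>\<in>PM. (\<forall>j. 1 \<le> j \<and> j \<le> N \<longrightarrow> \<bar>mom \<nu> j - mom \<mu> j\<bar> < e) \<longrightarrow> \<nu> \<in> U)"
    using assms(2) by (simp only: P_def simp_thms)
  then show thesis by (elim exE conjE) (rule that)
qed

text \<open>Recovering a measure from its moments is a continuous map by
  \<open>W_neighbourhood\<close>, and it is defined on a compact set.\<close>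

lemma compactin_W: "compactin W PM"
proof -
  define h where "h = (\<lambda>m. SOME \<mu>. \<mu> \<in> PM \<and> mom \<mu> = m)"
  have h: "h m \<in> PM \<and> mom (h m) = m" if "m \<in> mom ` PM" for m
    unfolding h_def by (rule someI_ex) (use that in auto)
  have hmom: "h (mom \<mu>) = \<mu>" if "\<mu> \<in> PM" for \<mu>
    using h[of "mom \<mu>"] that by (intro mom_inj) auto
  have "continuous_map (top_of_set (mom ` PM)) W h"
    unfolding continuous_map_alt
  proof (intro conjI allI impI)
    show "h \<in> topspace (top_of_set (mom ` PM)) \<rightarrow> topspace W" using h by (auto simp: topspace_W)
    fix U assume U: "openin W U"
    show "openin (top_of_set (mom ` PM)) (h -` U \<inter> topspace (top_of_set (mom ` PM)))"
    proof (subst openin_subopen, intro ballI)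
      fix m assume "m \<in> h -` U \<inter> topspace (top_of_set (mom ` PM))"
      then obtain \<mu> where \<mu>: "\<mu> \<in> PM" "m = mom \<mu>" "\<mu> \<in> U" by (auto simp: hmom)
      obtain N e where e: "e > 0"
        "\<forall>\<nu>\<in>PM. (\<forall>j. 1 \<le> j \<and> j \<le> N \<longrightarrow> \<bar>mom \<nu> j - mom \<mu> j\<bar> < e) \<longrightarrow> \<nu> \<in> U"
        by (rule W_neighbourhood[OF U \<mu>(3)])
      define V where "V = (\<Inter>j\<in>{1..N}. {k :: nat \<Rightarrow> real. \<bar>k j - m j\<bar> < e})"
      have "open V"
        unfolding V_def by (intro open_INT ballI open_Collect_less continuous_intros continuous_on_product_coordinates) auto
      then have "openin (top_of_set (mom ` PM)) (mom ` PM \<inter> V)" by blast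
      moreover have "m \<in> mom ` PM \<inter> V" using \<mu> e by (auto simp: V_def)
      moreover have "mom ` PM \<inter> V \<subseteq> h -` U \<inter> topspace (top_of_set (mom ` PM))"
        using e(2) \<mu>(2) by (auto simp: V_def hmom)
      ultimately show "\<exists>T. openin (top_of_set (mom ` PM)) T \<and> m \<in> T \<and> T \<subseteq> h -` U \<inter> topspace (top_of_set (mom ` PM))"
        by blast
    qed
  qed
  moreover have "compactin (top_of_set (mom ` PM)) (mom ` PM)"
    using compact_moment_sequences by (simp add: compactin_subtopology)
  ultimately have "compactin W (h ` mom ` PM)" by (rule image_compactin[rotated])
  moreover have "h ` mom ` PM = PM" using hmom by (force simp: image_iff)
  ultimately show ?thesis by simp
qed

section \<open>The entropy minimizer\<close>

lemma kl_nonneg: "\<mu> \<in> PM \<Longrightarrow> 0 \<le> kl arcsine \<mu>"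
  using SUP_upper[of 0 UNIV "\<lambda>n. - elog (EM n \<mu>)"] by (simp add: szego_kl) (simp add: elog_def zero_ereal_def)

lemma uminus_elog_gt: "ereal b < - elog e \<longleftrightarrow> e < exp (- b)"
proof (cases "e \<le> 0")
  case True
  then have "e < exp (- b)" using exp_gt_zero[of "- b"] by linarith
  with True show ?thesis by (simp add: elog_def)
next
  case False
  then have "ln e < - b \<longleftrightarrow> e < exp (- b)" by (metis exp_less_cancel_iff exp_ln not_le)
  with False show ?thesis by (auto simp: elog_def)
qed

lemma kl_gt_iff: "\<mu> \<in> PM \<Longrightarrow> ereal b < kl arcsine \<mu> \<longleftrightarrow> (\<exists>n. EM n \<mu> < exp (- b))"
  by (simp add: szego_kl less_SUP_iff uminus_elog_gt)

lemma EM_ge_kl: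
  assumes "\<mu> \<in> PM" "kl arcsine \<mu> \<le> ereal k"
  shows "exp (- k) \<le> EM n \<mu>"
  using kl_gt_iff[OF assms(1), of k] assms(2) by (auto simp: not_less)

text \<open>By Szego's theorem the entropy is a supremum of lower semicontinuous functions.\<close>

lemma openin_W_kl: "openin W {\<mu> \<in> PM. ereal b < kl arcsine \<mu>}"
proof -
  have "{\<mu> \<in> PM. ereal b < kl arcsine \<mu>} = (\<Union>n. {\<mu> \<in> PM. EM n \<mu> < exp (- b)})"
    by (auto simp: kl_gt_iff)
  also have "openin W \<dots>" by (intro openin_Union) (auto intro: openin_W_EM)
  finally show ?thesis .
qed

text \<open>Compactness of closed sets in the form needed both for the existence of the minimizer
  and for the upper bound: an increasing open cover has a single member that suffices.\<close>

lemma W_increasing_cover: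
  assumes F: "F \<subseteq> PM" "openin W (PM - F)" and V: "\<And>n. openin W (V n)" "mono V" "F \<subseteq> (\<Union>n::nat. V n)"
  obtains n where "F \<subseteq> V n"
proof -
  have "\<exists>\<F>. finite \<F> \<and> \<F> \<subseteq> insert (PM - F) (range V) \<and> PM \<subseteq> \<Union> \<F>"
    using compactin_W F V unfolding compactin_def by (elim conjE allE[of _ "insert (PM - F) (range V)"]) auto
  then obtain \<F> where \<F>: "finite \<F>" "\<F> \<subseteq> insert (PM - F) (range V)" "PM \<subseteq> \<Union> \<F>" by blast
  have "finite (\<F> - {PM - F})" "\<F> - {PM - F} \<subseteq> range V" using \<F> by auto
  then obtain I where I: "finite I" "\<F> - {PM - F} = V ` I" by (meson finite_subset_image subset_UNIV)
  have "F \<subseteq> V (Max (insert 0 I))"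
  proof
    fix \<mu> assume \<mu>: "\<mu> \<in> F"
    then obtain S where "S \<in> \<F>" "\<mu> \<in> S" using F \<F> by blast
    then have "S \<in> V ` I" using I \<mu> by blast
    then obtain i where "i \<in> I" "\<mu> \<in> V i" using \<open>\<mu> \<in> S\<close> by auto
    moreover have "i \<le> Max (insert 0 I)" using I \<open>i \<in> I\<close> by auto
    ultimately show "\<mu> \<in> V (Max (insert 0 I))" using monoD[OF V(2)] by blast
  qed
  then show thesis by (rule that)
qed

section \<open>Measures satisfying the constraint\<close>

abbreviation PC :: "(nat \<rightharpoonup> real) \<Rightarrow> real measure set" where "PC C \<equiv> constr_meas C {0..1}"

lemma PC_PM: "\<mu> \<in> PC C \<Longrightarrow> \<mu> \<in> PM"
  by (simp add: constr_meas_def)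

lemma PC_iff: "\<mu> \<in> PC C \<longleftrightarrow> \<mu> \<in> PM \<and> (\<forall>i\<in>dom C. mom \<mu> i = the (C i))"
proof -
  have "C i = Some (mom \<mu> i) \<longleftrightarrow> mom \<mu> i = the (C i)" if "i \<in> dom C" for i
    using that by (auto simp: dom_def)
  then show ?thesis by (simp add: constr_meas_def)
qed

lemma openin_W_not_PC: "openin W (PM - PC C)"
proof -
  have "PM - PC C = (\<Union>i\<in>dom C. {\<mu> \<in> PM. mom \<mu> i \<in> - {the (C i)}})"
    by (rule set_eqI) (simp only: PC_iff Diff_iff UN_iff mem_Collect_eq Compl_iff singleton_iff, blast)
  also have "openin W \<dots>" by (intro openin_Union) (auto intro!: openin_W_mom simp del: Compl_iff)
  finally show ?thesis .
qed

lemma max_index_ge: "moment_constraint C \<Longrightarrow> i \<in> dom C \<Longrightarrow> 1 \<le> i \<and> i \<le> max_index C"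
  by (auto simp: moment_constraint_def max_index_def intro!: Suc_leI gr0I)

lemma PC_cong:
  assumes C: "moment_constraint C" and "\<mu> \<in> PC C" "\<nu> \<in> PM" "max_index C \<le> n"
    and "\<And>j. 1 \<le> j \<Longrightarrow> j \<le> n \<Longrightarrow> mom \<nu> j = mom \<mu> j"
  shows "\<nu> \<in> PC C"
  unfolding PC_iff
proof (intro conjI ballI)
  fix i assume "i \<in> dom C"
  then have "mom \<nu> i = mom \<mu> i" using max_index_ge[OF C] assms(4) by (intro assms(5)) (auto intro: order.trans)
  with \<open>i \<in> dom C\<close> assms(2) show "mom \<nu> i = the (C i)" by (simp add: PC_iff)
qed (rule assms(3))

lemma mom_mix:
  assumes "\<mu> \<in> PM" "\<nu> \<in> PM" "0 \<le> e" "e \<le> 1"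
  shows "mom (mix e \<mu> \<nu>) j = (1 - e) * mom \<mu> j + e * mom \<nu> j"
  unfolding mom_def
  by (rule integral_mix[OF assms, where B=1])
    (auto intro!: borel_measurable_continuous_on_restrict continuous_intros simp: power_abs power_le_one)

lemma ip_mix:
  assumes "\<mu> \<in> PM" "\<nu> \<in> PM" "0 \<le> e" "e \<le> 1"
  shows "ip (mix e \<mu> \<nu>) p q = (1 - e) * ip \<mu> p q + e * ip \<nu> p q"
proof -
  define f where "f = (\<lambda>x. Re (cev p (circ x) * cnj (cev q (circ x))))"
  have f: "continuous_on {0..1} f" unfolding f_def by (intro continuous_intros)
  have "bounded (f ` {0..1})" by (intro compact_imp_bounded compact_continuous_image f) simp
  then obtain B where "\<And>x. x \<in> {0..1} \<Longrightarrow> \<bar>f x\<bar> \<le> B" by (auto simp: bounded_iff simp del: atLeastAtMost_iff)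
  from integral_mix[OF assms borel_measurable_continuous_on_restrict[OF f] this]
  show ?thesis by (simp add: ip_def f_def)
qed

lemma PC_mix: "\<mu> \<in> PC C \<Longrightarrow> \<nu> \<in> PC C \<Longrightarrow> 0 \<le> e \<Longrightarrow> e \<le> 1 \<Longrightarrow> mix e \<mu> \<nu> \<in> PC C"
  by (auto simp: PC_iff mix_PM mom_mix algebra_simps)

text \<open>Since \<open>EM n\<close> is a minimum of functions that are affine in the measure, it is concave.\<close>

lemma EM_mix_ge:
  assumes "\<mu> \<in> PM" "\<nu> \<in> PM" "0 \<le> e" "e \<le> 1"
  shows "(1 - e) * EM n \<mu> + e * EM n \<nu> \<le> EM n (mix e \<mu> \<nu>)"
proof -
  define P where "P = Phi (cheb (mom (mix e \<mu> \<nu>))) n"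
  have "EM n (mix e \<mu> \<nu>) = ip (mix e \<mu> \<nu>) P P"
    using orth_Phi[OF mix_PM[OF assms(1,2), of e] refl, of n] by (simp add: EM_def P_def)
  also have "\<dots> = (1 - e) * ip \<mu> P P + e * ip \<nu> P P" by (rule ip_mix[OF assms])
  also have "\<dots> \<ge> (1 - e) * EM n \<mu> + e * EM n \<nu>"
    using assms by (intro add_mono mult_left_mono EM_le) (auto simp: P_def degree_szego coeff_szego)
  finally show ?thesis .
qed

lemma EM_le_inf_kl:
  assumes C: "moment_constraint C" and \<mu>: "\<mu> \<in> PC C" and n: "max_index C \<le> n"
    and a: "\<And>\<nu>. \<nu> \<in> PC C \<Longrightarrow> ereal a \<le> kl arcsine \<nu>"
  shows "EM n \<mu> \<le> exp (- a)"
proof (cases "EM n \<mu> > 0")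
  case True
  obtain \<nu> where \<nu>: "\<nu> \<in> PM" "\<And>j. 1 \<le> j \<Longrightarrow> j \<le> n \<Longrightarrow> mom \<nu> j = mom \<mu> j"
    "kl arcsine \<nu> \<le> ereal (- ln (EM n \<mu>))"
    using bernstein_szego_PM[OF PC_PM[OF \<mu>] True] by blast
  have "\<nu> \<in> PC C" by (rule PC_cong[OF C \<mu> \<nu>(1) n \<nu>(2)])
  then have "ereal a \<le> ereal (- ln (EM n \<mu>))" using a \<nu>(3) by (blast intro: order.trans)
  then have "ln (EM n \<mu>) \<le> - a" by simp
  then show ?thesis using True by (metis exp_le_cancel_iff exp_ln)
qed (use exp_gt_zero[of "- a"] in linarith)

text \<open>The Donsker-Varadhan inequality, tested with \<open>\<bar>\<Phi>\<^sub>n\<bar>\<^sup>2\<close> for the midpoint of two minimizers, is an equality for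
  both, and its equality case determines the measure.\<close>

lemma kl_minimizer_unique:
  assumes C: "moment_constraint C" and \<mu>: "\<mu> \<in> PC C" "kl arcsine \<mu> = ereal a"
    and \<nu>: "\<nu> \<in> PC C" "kl arcsine \<nu> = ereal a"
    and a: "\<And>\<rho>. \<rho> \<in> PC C \<Longrightarrow> ereal a \<le> kl arcsine \<rho>"
  shows "\<mu> = \<nu>"
proof -
  define n where "n = max_index C"
  define \<rho> where "\<rho> = mix (1/2) \<mu> \<nu>"
  have \<rho>: "\<rho> \<in> PC C" unfolding \<rho>_def by (rule PC_mix[OF \<mu>(1) \<nu>(1)]) auto
  note P = PC_PM[OF \<mu>(1)] PC_PM[OF \<nu>(1)] PC_PM[OF \<rho>]
  define Q where "Q = Phi (cheb (mom \<rho>)) n"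
  define f where "f = (\<lambda>x. (cmod (cev Q (circ x)))\<^sup>2)"
  have ge: "exp (- a) \<le> EM n \<mu>" "exp (- a) \<le> EM n \<nu>"
    using EM_ge_kl[OF P(1), of a] EM_ge_kl[OF P(2), of a] \<mu> \<nu> by auto
  have ip: "EM n \<mu> \<le> ip \<mu> Q Q" "EM n \<nu> \<le> ip \<nu> Q Q"
    by (auto intro!: EM_le P simp: Q_def degree_szego coeff_szego)
  have mid: "EM n \<rho> = (1 - 1/2) * ip \<mu> Q Q + 1/2 * ip \<nu> Q Q"
    using orth_Phi[OF P(3) refl, of n] ip_mix[OF P(1,2), of "1/2" Q Q] by (simp add: EM_def Q_def \<rho>_def)
  have le: "EM n \<rho> \<le> exp (- a)" by (rule EM_le_inf_kl[OF C \<rho> _ a]) (simp add: n_def)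
  from mid have mid': "EM n \<rho> = ip \<mu> Q Q / 2 + ip \<nu> Q Q / 2" by simp
  \<comment> \<open>Both values are at least exp (- a) while their mean is at most exp (-
    a).\<close>
  from ge ip mid' le have eq: "ip \<mu> Q Q = exp (- a)" "ip \<nu> Q Q = exp (- a)" by linarith+
  then have pos: "0 < EM n \<rho>" using mid' by simp
  have f: "continuous_on {0..1} f" "\<And>x. x \<in> {0..1} \<Longrightarrow> 0 < f x" "(\<integral>x. ln (f x) \<partial>arcsine) = 0"
    unfolding f_def Q_def
    by (intro continuous_intros, rule integral_ln_Phi(1)[OF P(3) pos], assumption, rule integral_ln_Phi(2)[OF P(3) pos])
  have "\<kappa> = density arcsine (\<lambda>x. ennreal (exp (- a) / f x))"
    if "\<kappa> \<in> PM" "kl arcsine \<kappa> = ereal a" "ip \<kappa> Q Q = exp (- a)" for \<kappa>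
    using donsker_varadhan_le(2)[OF that(1) f(1,2)] that(2,3) f(3) by (simp add: ip_self f_def)
  from this[OF P(1) \<mu>(2) eq(1)] this[OF P(2) \<nu>(2) eq(2)] show ?thesis by simp
qed

lemma kl_minimizer_exists:
  assumes "\<mu> \<in> PC C" "kl arcsine \<mu> \<noteq> \<infinity>"
  obtains \<nu> a where "\<nu> \<in> PC C" "kl arcsine \<nu> = ereal a" "\<And>\<rho>. \<rho> \<in> PC C \<Longrightarrow> ereal a \<le> kl arcsine \<rho>"
proof -
  define I where "I = (INF \<nu>\<in>PC C. kl arcsine \<nu>)"
  have I0: "0 \<le> I" unfolding I_def using kl_nonneg PC_PM by (intro INF_greatest) auto
  have le: "I \<le> kl arcsine \<nu>" if "\<nu> \<in> PC C" for \<nu> unfolding I_def using that by (rule INF_lower)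
  have "I \<noteq> \<infinity>" using le[OF assms(1)] assms(2) by auto
  then obtain a where a: "I = ereal a" using I0 by (cases I) auto
  have "\<exists>\<nu>\<in>PC C. kl arcsine \<nu> \<le> ereal a"
  proof (rule ccontr)
    assume "\<not> (\<exists>\<nu>\<in>PC C. kl arcsine \<nu> \<le> ereal a)"
    then have gt: "ereal a < kl arcsine \<nu>" if "\<nu> \<in> PC C" for \<nu> using that by (auto simp: not_le)
    \<comment> \<open>If the infimum were not attained, these open sets would cover the constraint
      set; one of them would then contain it, and the infimum would exceed a.\<close>
    define V where "V = (\<lambda>n. {\<mu> \<in> PM. ereal (a + 1 / real (Suc n)) < kl arcsine \<mu>})"
    have "PC C \<subseteq> (\<Union>n. V n)"
    proof
      fix \<nu> assume \<nu>: "\<nu> \<in> PC C"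
      obtain b where b: "ereal a < b" "b < kl arcsine \<nu>" using dense[OF gt[OF \<nu>]] by blast
      then obtain b' where b': "b = ereal b'" by (cases b) auto
      then have "0 < b' - a" using b by simp
      then obtain n where "1 / real (Suc n) < b' - a"
        using reals_Archimedean[of "b' - a"] unfolding inverse_eq_divide by blast
      then have "ereal (a + 1 / real (Suc n)) < b" using b' by simp
      then have "ereal (a + 1 / real (Suc n)) < kl arcsine \<nu>" using b(2) by (rule less_trans)
      then show "\<nu> \<in> (\<Union>n. V n)" using PC_PM[OF \<nu>] by (auto simp: V_def)
    qed
    moreover have "mono V"
    proof (rule monoI)
      fix m n :: nat assume "m \<le> n"
      then have "a + 1 / real (Suc n) \<le> a + 1 / real (Suc m)" by (simp add: field_simps)
      then have "ereal (a + 1 / real (Suc n)) \<le> ereal (a + 1 / real (Suc m))" by simp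
      then show "V m \<subseteq> V n" unfolding V_def using order.strict_trans1 by blast
    qed
    moreover have "openin W (V n)" for n unfolding V_def by (rule openin_W_kl)
    moreover have "PC C \<subseteq> PM" using PC_PM by blast
    ultimately obtain n where "PC C \<subseteq> V n"
      using W_increasing_cover[of "PC C" V] openin_W_not_PC by blast
    then have "ereal (a + 1 / real (Suc n)) \<le> I"
      unfolding I_def by (intro INF_greatest) (auto simp: V_def)
    then show False using a by simp
  qed
  then obtain \<nu> where \<nu>: "\<nu> \<in> PC C" "kl arcsine \<nu> \<le> ereal a" by blast
  with le[of \<nu>] a have "kl arcsine \<nu> = ereal a" by (intro antisym) auto
  with \<nu>(1) le a show thesis by (intro that[of \<nu> a]) auto
qed

lemma kl_minimizer_props:
  assumes C: "moment_constraint C" and \<mu>: "\<mu> \<in> PC C" "kl arcsine \<mu> \<noteq> \<infinity>"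
  obtains a where "kl_minimizer C \<in> PC C" "kl arcsine (kl_minimizer C) = ereal a"
    "\<And>\<rho>. \<rho> \<in> PC C \<Longrightarrow> ereal a \<le> kl arcsine \<rho>"
proof -
  from kl_minimizer_exists[OF \<mu>] obtain \<nu> a where \<nu>: "\<nu> \<in> PC C" "kl arcsine \<nu> = ereal a"
    and a: "\<And>\<rho>. \<rho> \<in> PC C \<Longrightarrow> ereal a \<le> kl arcsine \<rho>" by blast
  have "kl_minimizer C = \<nu>"
    unfolding kl_minimizer_def
  proof (rule the_equality)
    show "is_arg_min (kl arcsine) (\<lambda>\<mu>. \<mu> \<in> PC C) \<nu>"
      using \<nu> a by (auto simp: is_arg_min_def not_less)
    fix \<rho> assume "is_arg_min (kl arcsine) (\<lambda>\<mu>. \<mu> \<in> PC C) \<rho>"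
    then have \<rho>: "\<rho> \<in> PC C" "kl arcsine \<rho> \<le> kl arcsine \<nu>"
      using \<nu>(1) by (auto simp: is_arg_min_def not_less)
    then have "kl arcsine \<rho> = ereal a" using a[OF \<rho>(1)] \<nu>(2) by (intro antisym) auto
    then show "\<rho> = \<nu>" by (rule kl_minimizer_unique[OF C \<rho>(1) _ \<nu> a])
  qed
  with \<nu> a show thesis by (intro that) auto
qed

section \<open>Semicontinuity and compactness for the rate function\<close>

lemma rate_eq:
  assumes "kl arcsine (kl_minimizer C) = ereal a"
  shows "rate C \<mu> = (if \<mu> \<in> PC C then kl arcsine \<mu> - ereal a else \<infinity>)"
proof (cases "absolutely_continuous \<mu> arcsine")
  case False
  then have "kl arcsine \<mu> = \<infinity>" by (simp add: kl_def)
  with False show ?thesis by (simp add: rate_def)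
qed (simp add: rate_def assms)

lemma rate_gt_iff:
  assumes "kl arcsine (kl_minimizer C) = ereal a"
  shows "ereal b < rate C \<mu> \<longleftrightarrow> \<mu> \<notin> PC C \<or> ereal (a + b) < kl arcsine \<mu>"
  using kl_nonneg[OF PC_PM, of \<mu> C]
  by (cases "kl arcsine \<mu>") (auto simp: rate_eq[OF assms] algebra_simps)

lemma rate_function_rate:
  assumes a: "kl arcsine (kl_minimizer C) = ereal a" and min: "\<And>\<rho>. \<rho> \<in> PC C \<Longrightarrow> ereal a \<le> kl arcsine \<rho>"
  shows "rate_function W (rate C)"
  unfolding rate_function_def
proof (intro conjI allI ballI)
  have nn: "0 \<le> rate C \<mu>" for \<mu>
    using min[of \<mu>] by (cases "kl arcsine \<mu>") (auto simp: rate_eq[OF a])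
  then show "0 \<le> rate C \<mu>" for \<mu> .
  fix b :: ereal
  show "openin W {x \<in> topspace W. b < rate C x}"
  proof (cases b)
    case (real r)
    have "{x \<in> topspace W. b < rate C x} = (PM - PC C) \<union> {\<mu> \<in> PM. ereal (a + r) < kl arcsine \<mu>}"
      by (auto simp: real rate_gt_iff[OF a] topspace_W)
    then show ?thesis by (simp add: openin_W_not_PC openin_W_kl openin_Un)
  next
    case MInf
    then have "{x \<in> topspace W. b < rate C x} = topspace W" using nn by (auto intro: less_le_trans)
    then show ?thesis by simp
  qed simp
qed

lemma good_rate_function_rate:
  assumes a: "kl arcsine (kl_minimizer C) = ereal a" and min: "\<And>\<rho>. \<rho> \<in> PC C \<Longrightarrow> ereal a \<le> kl arcsine \<rho>"
  shows "good_rate_function W (rate C)"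
  unfolding good_rate_function_def
proof (intro conjI allI impI)
  show rf: "rate_function W (rate C)" by (rule rate_function_rate[OF assms])
  fix b :: real
  have "{x \<in> topspace W. rate C x \<le> ereal b} = topspace W - {x \<in> topspace W. ereal b < rate C x}"
    by (auto simp: not_less)
  moreover have "openin W {x \<in> topspace W. ereal b < rate C x}" using rf by (simp add: rate_function_def)
  ultimately have "closedin W {x \<in> topspace W. rate C x \<le> ereal b}" by (simp add: closedin_diff)
  then have "compactin W (PM \<inter> {x \<in> topspace W. rate C x \<le> ereal b})"
    using compactin_W by (rule compact_Int_closedin[rotated])
  then show "compactin W {x \<in> topspace W. rate C x \<le> ereal b}"
    by (simp add: topspace_W Int_def cong: conj_cong)
qed

section \<open>Fibres of the moment spaces\<close>

lemma compact_mom_PC: "compact (mom ` PC C)"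
proof -
  have "mom ` PC C = mom ` PM \<inter> (\<Inter>i\<in>dom C. {m. m i = the (C i)})"
  proof (intro equalityI subsetI)
    fix m assume "m \<in> mom ` PC C"
    then obtain \<mu> where "\<mu> \<in> PC C" "m = mom \<mu>" by (elim imageE)
    then show "m \<in> mom ` PM \<inter> (\<Inter>i\<in>dom C. {m. m i = the (C i)})" by (simp add: PC_iff)
  next
    fix m assume m: "m \<in> mom ` PM \<inter> (\<Inter>i\<in>dom C. {m. m i = the (C i)})"
    then obtain \<mu> where \<mu>: "\<mu> \<in> PM" "m = mom \<mu>" by (elim IntE imageE)
    with m have "\<mu> \<in> PC C" unfolding PC_iff by (simp only: Int_iff INT_iff mem_Collect_eq) simp
    with \<mu>(2) show "m \<in> mom ` PC C" by simp
  qed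
  moreover have "closed (\<Inter>i\<in>dom C. {m :: nat \<Rightarrow> real. m i = the (C i)})"
    by (intro closed_INT ballI closed_Collect_eq continuous_on_const continuous_on_product_coordinates)
  ultimately show ?thesis using compact_moment_sequences by (simp add: compact_Int_closed)
qed

abbreviation free_lborel :: "(nat \<rightharpoonup> real) \<Rightarrow> nat \<Rightarrow> (nat \<Rightarrow> real) measure" where
  "free_lborel C n \<equiv> (\<Pi>\<^sub>M j\<in>free_indices C n. lborel)"

definition free_moms :: "(nat \<rightharpoonup> real) \<Rightarrow> nat \<Rightarrow> real measure \<Rightarrow> nat \<Rightarrow> real" where
  "free_moms C n \<mu> = (\<lambda>j\<in>free_indices C n. mom \<mu> j)"

lemma finite_free_indices [simp]: "finite (free_indices C n)"
  by (simp add: free_indices_def)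

lemma proj_mom_space_eq: "proj_mom_space C n = free_moms C n ` PC C"
proof -
  have "restrict (mom_vec n \<mu>) (free_indices C n) = free_moms C n \<mu>" for \<mu>
    by (auto simp: mom_vec_def free_moms_def free_indices_def restrict_def)
  then show ?thesis by (simp add: proj_mom_space_def constr_mom_space_def image_image)
qed

lemma space_free_lborel: "space (free_lborel C n) = extensional (free_indices C n)"
  by (simp add: space_PiM PiE_def)

text \<open>Padding by zeros embeds the free coordinates into the space of all sequences. There the
  moments of the compact constraint set have a compact, hence Borel, image, and the projection is
  its preimage.\<close>

lemma proj_mom_space_sets: "proj_mom_space C n \<in> sets (free_lborel C n)"
proof -
  define F where "F = free_indices C n"
  define pad where "pad = (\<lambda>(m :: nat \<Rightarrow> real) j. if j \<in> F then m j else 0)"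
  have "continuous_on (mom ` PC C) pad"
  proof (rule continuous_on_coordinatewise_then_product)
    fix i
    show "continuous_on (mom ` PC C) (\<lambda>m. pad m i)"
      by (cases "i \<in> F") (auto simp: pad_def intro: continuous_on_subset[OF continuous_on_product_coordinates])
  qed
  then have "compact (pad ` mom ` PC C)" by (rule compact_continuous_image[OF _ compact_mom_PC])
  then have K: "pad ` mom ` PC C \<in> sets borel" by (intro borel_closed compact_imp_closed)
  have "pad \<in> measurable (free_lborel C n) (\<Pi>\<^sub>M i\<in>UNIV. borel)"
  proof (rule measurable_PiM_single')
    fix i
    show "(\<lambda>v. pad v i) \<in> measurable (free_lborel C n) borel"
      by (cases "i \<in> F") (auto simp: pad_def F_def)
  qed auto
  then have "pad \<in> borel_measurable (free_lborel C n)"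
    by (simp add: sets_PiM_equal_borel cong: measurable_cong_sets)
  from measurable_sets[OF this K]
  have "pad -` (pad ` mom ` PC C) \<inter> space (free_lborel C n) \<in> sets (free_lborel C n)" .
  also have "pad -` (pad ` mom ` PC C) \<inter> space (free_lborel C n) = proj_mom_space C n"
  proof (intro set_eqI iffI)
    fix v assume "v \<in> pad -` (pad ` mom ` PC C) \<inter> space (free_lborel C n)"
    then obtain \<mu> where \<mu>: "\<mu> \<in> PC C" "pad v = pad (mom \<mu>)" and v: "v \<in> extensional F"
      by (auto simp: space_free_lborel F_def)
    have "v = free_moms C n \<mu>"
    proof
      fix j show "v j = free_moms C n \<mu> j"
        using fun_cong[OF \<mu>(2), of j] v
        by (cases "j \<in> F") (auto simp: pad_def free_moms_def F_def[symmetric] extensional_def)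
    qed
    with \<mu> show "v \<in> proj_mom_space C n" by (simp add: proj_mom_space_eq)
  next
    fix v assume "v \<in> proj_mom_space C n"
    then obtain \<mu> where \<mu>: "\<mu> \<in> PC C" "v = free_moms C n \<mu>" by (auto simp: proj_mom_space_eq)
    then have "pad v = pad (mom \<mu>)" by (auto simp: pad_def free_moms_def F_def)
    with \<mu> show "v \<in> pad -` (pad ` mom ` PC C) \<inter> space (free_lborel C n)"
      by (auto simp: space_free_lborel free_moms_def)
  qed
  finally show ?thesis .
qed

lemma fill_in_free_moms: "\<mu> \<in> PC C \<Longrightarrow> fill_in C n (free_moms C n \<mu>) = mom_vec n \<mu>"
  by (auto simp: fill_in_def mom_vec_def free_moms_def free_indices_def constr_meas_def restrict_def fun_eq_iff
      split: option.split)

definition free_En :: "(nat \<rightharpoonup> real) \<Rightarrow> nat \<Rightarrow> (nat \<Rightarrow> real) \<Rightarrow> real" where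
  "free_En C n v = En (cheb (fill_in C n v)) n"

text \<open>Up to a constant, this is the density of the free moments up to index n when a moment
  vector of length n + j is uniform.\<close>

abbreviation weight :: "(nat \<rightharpoonup> real) \<Rightarrow> nat \<Rightarrow> nat \<Rightarrow> (nat \<Rightarrow> real) \<Rightarrow> ennreal" where
  "weight C n j v \<equiv> indicator (proj_mom_space C n) v * ennreal (free_En C n v ^ j)"

lemma szego_cheb_cong:
  assumes "\<And>j. 1 \<le> j \<Longrightarrow> j \<le> n \<Longrightarrow> m j = m' j"
  shows "Phi (cheb m) n = Phi (cheb m') n \<and> Psi (cheb m) n = Psi (cheb m') n \<and> En (cheb m) n = En (cheb m') n"
  by (intro szego_cong cheb_cong assms) auto

lemma free_En_free_moms: "\<mu> \<in> PC C \<Longrightarrow> free_En C n (free_moms C n \<mu>) = EM n \<mu>"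
  using szego_cheb_cong[of n "mom_vec n \<mu>" "mom \<mu>"]
  by (simp add: free_En_def EM_def fill_in_free_moms mom_vec_def)

lemma borel_measurable_szego:
  assumes c: "\<And>i. (\<lambda>x. c x i) \<in> borel_measurable M"
  shows "(\<lambda>x. En (c x) n) \<in> borel_measurable M \<and> (\<forall>k. (\<lambda>x. coeff (Phi (c x) n) k) \<in> borel_measurable M)
     \<and> (\<forall>k. (\<lambda>x. coeff (Psi (c x) n) k) \<in> borel_measurable M)"
proof (induction n)
  case (Suc n)
  note [measurable] = c
  have [measurable]: "(\<lambda>x. En (c x) n) \<in> borel_measurable M"
    "(\<lambda>x. coeff (Phi (c x) n) k) \<in> borel_measurable M" "(\<lambda>x. coeff (Psi (c x) n) k) \<in> borel_measurable M" for k
    using Suc by auto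
  have "verblunsky (c x) n = (\<Sum>k\<le>n. coeff (Phi (c x) n) k * c x (Suc k)) / En (c x) n" for x
    using degree_szego[of "c x" n] by (simp add: verblunsky_def Lam_shift[of _ n])
  then have [measurable]: "(\<lambda>x. verblunsky (c x) n) \<in> borel_measurable M" by simp
  have "(\<lambda>x. coeff (pCons 0 (Phi (c x) n)) k) \<in> borel_measurable M" for k
    by (cases k) simp_all
  note [measurable] = this
  show ?case unfolding szego_Suc coeff_diff coeff_smult by (intro conjI allI) measurable
qed simp

lemma borel_measurable_free_En: "free_En C n \<in> borel_measurable (free_lborel C n)"
proof -
  have f: "(\<lambda>v. fill_in C n v i) \<in> borel_measurable (free_lborel C n)" for i
  proof (cases "i \<in> {1..n}")
    case True
    then show ?thesis
      by (cases "C i") (auto simp: fill_in_def free_indices_def dom_def)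
  next
    case False
    then have "(\<lambda>v. fill_in C n v i) = (\<lambda>v. undefined)" by (simp only: fill_in_def restrict_def if_False)
    then show ?thesis by simp
  qed
  have "(\<lambda>v. cheb (fill_in C n v) i) \<in> borel_measurable (free_lborel C n)" for i
  proof -
    note [measurable] = f
    show ?thesis unfolding cheb_def by measurable
  qed
  from borel_measurable_szego[of "\<lambda>v. cheb (fill_in C n v)", OF this] show ?thesis unfolding free_En_def by blast
qed

lemma free_indices_Suc: "moment_constraint C \<Longrightarrow> max_index C \<le> n \<Longrightarrow> free_indices C (Suc n) = insert (Suc n) (free_indices C n)"
  using max_index_ge[of C "Suc n"] by (auto simp: free_indices_def)

lemma Suc_notin_free_indices: "Suc n \<notin> free_indices C n"
  by (simp add: free_indices_def)

lemma free_moms_upd: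
  assumes C: "moment_constraint C" "max_index C \<le> n"
    and eq: "\<And>j. 1 \<le> j \<Longrightarrow> j \<le> Suc n \<Longrightarrow> mom \<nu> j = ((mom \<mu>)(Suc n := t)) j"
  shows "free_moms C (Suc n) \<nu> = (free_moms C n \<mu>)(Suc n := t)"
proof
  fix j
  have "Suc n \<notin> dom C" using max_index_ge[OF C(1), of "Suc n"] C(2) by auto
  then show "free_moms C (Suc n) \<nu> j = ((free_moms C n \<mu>)(Suc n := t)) j"
    using eq[of j] by (auto simp: free_moms_def free_indices_Suc[OF C] free_indices_def)
qed

text \<open>Divided by \<^term>\<open>En (cheb m) n\<close>, this is the Verblunsky coefficient of index \<open>n\<close>; its slope in the last moment
  does not depend on \<open>m\<close>.\<close>

lemma verblunsky_affine:
  "\<exists>\<beta>. \<forall>t. Lam (cheb (m(Suc n := t))) (pCons 0 (Phi (cheb m) n)) = - 2 * (- 4) ^ n * t + \<beta>"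
proof -
  define P where "P = Phi (cheb m) n"
  have "Lam (cheb (m(Suc n := t))) (pCons 0 P) =
      - 2 * (- 4) ^ n * t + (cheb (m(Suc n := 0)) (Suc n) + (\<Sum>k<n. coeff P k * cheb m (Suc k)))" for t
  proof -
    have "(\<Sum>k<n. coeff P k * cheb (m(Suc n := t)) (Suc k)) = (\<Sum>k<n. coeff P k * cheb m (Suc k))"
      by (intro sum.cong refl arg_cong2[where f="(*)"] cheb_cong) auto
    then show ?thesis
      using degree_szego[of "cheb m" n] coeff_szego(1)[of "cheb m" n]
      by (simp add: Lam_shift[of _ n] P_def cheb_upd[of m n t] flip: lessThan_Suc_atMost)
  qed
  then show ?thesis unfolding P_def by blast
qed

lemma szego_upd:
  "Phi (cheb (m(Suc n := t))) n = Phi (cheb m) n" "En (cheb (m(Suc n := t))) n = En (cheb m) n"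
  using szego_cheb_cong[of n "m(Suc n := t)" m] by auto

lemma verblunsky_cheb_cong:
  assumes "\<And>j. 1 \<le> j \<Longrightarrow> j \<le> Suc n \<Longrightarrow> m j = m' j"
  shows "verblunsky (cheb m) n = verblunsky (cheb m') n"
proof -
  have "Phi (cheb m) n = Phi (cheb m') n" "En (cheb m) n = En (cheb m') n"
    using szego_cheb_cong[of n m m'] assms by auto
  moreover have "cheb m (Suc k) = cheb m' (Suc k)" if "k \<le> n" for k
    using assms that by (intro cheb_cong) auto
  ultimately show ?thesis
    using degree_szego[of "cheb m'" n] by (simp add: verblunsky_def Lam_shift[of _ n])
qed

text \<open>Over the moments of \<open>\<mu>\<close> up to n, the next moment t corresponds to the
  Verblunsky coefficient \<open>(\<tau> * t + \<beta>) / EM n \<mu>\<close>. Nonnegativity of the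
  next norm confines it to [-1, 1], and Bernstein-Szego measures realise every value of the open
  interval. If the norm is zero, at most one t remains.\<close>

lemma fibre:
  assumes C: "moment_constraint C" "max_index C \<le> n" and \<mu>: "\<mu> \<in> PC C"
    and \<beta>: "\<And>t. Lam (cheb ((mom \<mu>)(Suc n := t))) (pCons 0 (Phi (cheb (mom \<mu>)) n)) = \<tau> * t + \<beta>"
  shows "(free_moms C n \<mu>)(Suc n := t) \<in> proj_mom_space C (Suc n) \<Longrightarrow>
      free_En C (Suc n) ((free_moms C n \<mu>)(Suc n := t)) = EM n \<mu> * (1 - ((\<tau> * t + \<beta>) / EM n \<mu>)\<^sup>2)
      \<and> (EM n \<mu> > 0 \<longrightarrow> \<bar>(\<tau> * t + \<beta>) / EM n \<mu>\<bar> \<le> 1) \<and> (EM n \<mu> = 0 \<longrightarrow> \<tau> * t + \<beta> = 0)"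
    and "EM n \<mu> > 0 \<Longrightarrow> \<bar>(\<tau> * t + \<beta>) / EM n \<mu>\<bar> < 1 \<Longrightarrow>
      (free_moms C n \<mu>)(Suc n := t) \<in> proj_mom_space C (Suc n)"
proof -
  define m where "m = (mom \<mu>)(Suc n := t)"
  have E: "En (cheb m) n = EM n \<mu>" by (simp add: m_def szego_upd EM_def)
  have verblunsky: "verblunsky (cheb m) n = (\<tau> * t + \<beta>) / EM n \<mu>"
    by (simp add: verblunsky_def m_def szego_upd \<beta> EM_def)
  show "EM n \<mu> > 0 \<Longrightarrow> \<bar>(\<tau> * t + \<beta>) / EM n \<mu>\<bar> < 1 \<Longrightarrow>
      (free_moms C n \<mu>)(Suc n := t) \<in> proj_mom_space C (Suc n)"
  proof -
    assume pos: "EM n \<mu> > 0" and lt: "\<bar>(\<tau> * t + \<beta>) / EM n \<mu>\<bar> < 1"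
    have "\<forall>i<Suc n. \<bar>verblunsky (cheb m) i\<bar> < 1"
    proof (intro allI impI)
      fix i assume "i < Suc n"
      show "\<bar>verblunsky (cheb m) i\<bar> < 1"
      proof (cases "i = n")
        case False
        then have i: "i < n" using \<open>i < Suc n\<close> by simp
        then have "verblunsky (cheb m) i = verblunsky (cheb (mom \<mu>)) i" by (intro verblunsky_cheb_cong) (auto simp: m_def)
        then show ?thesis using EM_pos_verblunsky[OF PC_PM[OF \<mu>] pos i] by simp
      qed (use lt verblunsky in simp)
    qed
    from bernstein_szego[OF this] obtain \<nu>
      where \<nu>: "\<nu> \<in> PM" "\<And>j. 1 \<le> j \<Longrightarrow> j \<le> Suc n \<Longrightarrow> cheb (mom \<nu>) j = cheb m j" by blast
    have eq: "mom \<nu> j = m j" if "1 \<le> j" "j \<le> Suc n" for j by (rule cheb_inj[OF \<nu>(2) that])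
    have "\<nu> \<in> PC C"
      by (rule PC_cong[OF C(1) \<mu> \<nu>(1) C(2)]) (use eq in \<open>auto simp: m_def\<close>)
    moreover have "free_moms C (Suc n) \<nu> = (free_moms C n \<mu>)(Suc n := t)"
      by (rule free_moms_upd[OF C eq[unfolded m_def]])
    ultimately show ?thesis unfolding proj_mom_space_eq by (metis imageI)
  qed
  assume "(free_moms C n \<mu>)(Suc n := t) \<in> proj_mom_space C (Suc n)"
  then obtain \<nu> where \<nu>: "\<nu> \<in> PC C" "free_moms C (Suc n) \<nu> = (free_moms C n \<mu>)(Suc n := t)"
    by (auto simp: proj_mom_space_eq)
  have eq: "mom \<nu> j = m j" if j: "1 \<le> j" "j \<le> Suc n" for j
  proof (cases "j \<in> dom C")
    case True
    then have "j \<noteq> Suc n" using max_index_ge[OF C(1) True] C(2) by auto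
    then show ?thesis using True \<nu>(1) \<mu> by (simp add: PC_iff m_def)
  next
    case False
    then have "j \<in> free_indices C (Suc n)" using j by (simp add: free_indices_def)
    then have "mom \<nu> j = free_moms C (Suc n) \<nu> j" by (simp add: free_moms_def)
    also have "\<dots> = m j" unfolding \<nu>(2) using j False by (auto simp: m_def free_moms_def free_indices_def)
    finally show ?thesis .
  qed
  have s: "Phi (cheb (mom \<nu>)) n = Phi (cheb m) n" "EM n \<nu> = EM n \<mu>" "EM (Suc n) \<nu> = En (cheb m) (Suc n)"
    using szego_cheb_cong[of n "mom \<nu>" m] szego_cheb_cong[of "Suc n" "mom \<nu>" m] eq E
    unfolding EM_def[of _ \<nu>] by auto
  have f: "free_En C (Suc n) ((free_moms C n \<mu>)(Suc n := t)) = EM (Suc n) \<nu>"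
    using free_En_free_moms[OF \<nu>(1), of "Suc n"] by (simp add: \<nu>(2))
  also have "\<dots> = EM n \<mu> * (1 - ((\<tau> * t + \<beta>) / EM n \<mu>)\<^sup>2)"
    by (simp add: s(3) szego_Suc E verblunsky)
  finally have 1: "free_En C (Suc n) ((free_moms C n \<mu>)(Suc n := t)) = EM n \<mu> * (1 - ((\<tau> * t + \<beta>) / EM n \<mu>)\<^sup>2)" .
  have 2: "\<bar>(\<tau> * t + \<beta>) / EM n \<mu>\<bar> \<le> 1" if "EM n \<mu> > 0"
  proof -
    have "0 \<le> EM n \<mu> * (1 - ((\<tau> * t + \<beta>) / EM n \<mu>)\<^sup>2)"
      using EM_nonneg[OF PC_PM[OF \<nu>(1)], of "Suc n"] f 1 by simp
    then have "((\<tau> * t + \<beta>) / EM n \<mu>)\<^sup>2 \<le> 1" using that by (simp add: zero_le_mult_iff)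
    then show ?thesis by (simp only: abs_square_le_1)
  qed
  \<comment> \<open>A vanishing norm makes z times \<open>Phi\<close> zero almost everywhere, so its
    integral, which is affine in t, is zero.\<close>
  have 3: "\<tau> * t + \<beta> = 0" if z: "EM n \<mu> = 0"
  proof -
    have PM: "\<nu> \<in> PM" by (rule PC_PM[OF \<nu>(1)])
    define P where "P = Phi (cheb (mom \<nu>)) n"
    have "ip \<nu> P P = 0" using orth_Phi[OF PM refl, of n] s(2) z by (simp add: P_def EM_def)
    then have "ip \<nu> (pCons 0 P) (pCons 0 P) = 0" by (simp add: ip_shift[OF PM])
    then have "ip \<nu> (pCons 0 P) 1 = 0" by (rule ip_eq_0[OF PM])
    then have "Lam (cheb (mom \<nu>)) (pCons 0 P) = 0" by (simp add: Lam_ip[OF PM])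
    moreover have "Lam (cheb (mom \<nu>)) (pCons 0 P) = Lam (cheb m) (pCons 0 P)"
    proof -
      have "cheb (mom \<nu>) (Suc k) = cheb m (Suc k)" if "k \<le> n" for k
        using eq that by (intro cheb_cong) auto
      then show ?thesis using degree_szego[of "cheb (mom \<nu>)" n] by (simp add: P_def Lam_shift[of _ n])
    qed
    moreover have "P = Phi (cheb (mom \<mu>)) n" by (simp add: P_def s(1) m_def szego_upd)
    ultimately show ?thesis using \<beta>[of t] by (simp add: m_def)
  qed
  from 1 2 3 show "free_En C (Suc n) ((free_moms C n \<mu>)(Suc n := t)) = EM n \<mu> * (1 - ((\<tau> * t + \<beta>) / EM n \<mu>)\<^sup>2)
      \<and> (EM n \<mu> > 0 \<longrightarrow> \<bar>(\<tau> * t + \<beta>) / EM n \<mu>\<bar> \<le> 1) \<and> (EM n \<mu> = 0 \<longrightarrow> \<tau> * t + \<beta> = 0)"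
    by blast
qed

section \<open>Integrating out moments\<close>

text \<open>The reciprocal modulus of the slope in \<open>verblunsky_affine\<close> times a Beta
  integral over the Verblunsky coefficient. Only its positivity and finiteness enter, as it cancels
  in quotients.\<close>

definition fibre_const :: "nat \<Rightarrow> nat \<Rightarrow> ennreal" where
  "fibre_const n j = ennreal (1 / (2 * 4 ^ n)) * (\<integral>\<^sup>+x. ennreal (indicator {-1..1} x * (1 - x\<^sup>2) ^ j) \<partial>lborel)"

lemma fibre_const_pos: "0 < fibre_const n j" and fibre_const_finite: "fibre_const n j < \<infinity>"
proof -
  have sq: "x\<^sup>2 \<le> 1" if "x \<in> {-1..1}" for x :: real
    using that by (auto simp: abs_square_le_1 abs_le_iff)
  have "(\<integral>\<^sup>+x. ennreal (indicator {-1..1} x * (1 - x\<^sup>2) ^ j) \<partial>lborel) \<le> (\<integral>\<^sup>+x. indicator {-1..1::real} x \<partial>lborel)"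
    using sq by (intro nn_integral_mono) (auto simp: indicator_def power_le_one)
  also have "\<dots> < \<infinity>" by simp
  finally show "fibre_const n j < \<infinity>"
    by (simp add: fibre_const_def ennreal_mult_less_top)
  have "0 < ennreal ((3/4) ^ j) * emeasure lborel {-1/2..1/2::real}"
    by (simp add: ennreal_zero_less_mult_iff)
  also have "\<dots> = (\<integral>\<^sup>+x. ennreal ((3/4) ^ j) * indicator {-1/2..1/2::real} x \<partial>lborel)"
    by (subst nn_integral_cmult_indicator) simp_all
  also have "\<dots> \<le> (\<integral>\<^sup>+x. ennreal (indicator {-1..1} x * (1 - x\<^sup>2) ^ j) \<partial>lborel)"
  proof (rule nn_integral_mono)
    fix x :: real
    show "ennreal ((3/4) ^ j) * indicator {-1/2..1/2::real} x \<le> ennreal (indicator {-1..1} x * (1 - x\<^sup>2) ^ j)"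
    proof (cases "x \<in> {-1/2..1/2}")
      case True
      then have "\<bar>x\<bar> \<le> 1/2" by (auto simp: abs_le_iff)
      then have "\<bar>x\<bar>\<^sup>2 \<le> (1/2)\<^sup>2" by (intro power_mono) auto
      then have "3/4 \<le> 1 - x\<^sup>2" by (simp add: power2_eq_square)
      then have "(3/4) ^ j \<le> (1 - x\<^sup>2) ^ j" by (intro power_mono) auto
      then show ?thesis using True by (auto intro!: ennreal_leI)
    qed simp
  qed
  finally show "0 < fibre_const n j" by (simp add: fibre_const_def ennreal_zero_less_mult_iff)
qed

text \<open>Take the Verblunsky coefficient x as the variable: the integrand is the j-th power of E
  (1 - x^2), and the Jacobian contributes one more factor E. This raises the exponent to j +
  1.\<close>

lemma fibre_integral:
  assumes C: "moment_constraint C" "max_index C \<le> n" and v: "v \<in> space (free_lborel C n)"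
  shows "(\<integral>\<^sup>+t. indicator (proj_mom_space C (Suc n)) (v(Suc n := t)) * ennreal (free_En C (Suc n) (v(Suc n := t)) ^ j) \<partial>lborel) =
     fibre_const n j * weight C n (Suc j) v" (is "?L = ?R")
proof (cases "v \<in> proj_mom_space C n")
  case False
  have "v(Suc n := t) \<notin> proj_mom_space C (Suc n)" for t
  proof
    assume "v(Suc n := t) \<in> proj_mom_space C (Suc n)"
    then obtain \<nu> where \<nu>: "\<nu> \<in> PC C" "v(Suc n := t) = free_moms C (Suc n) \<nu>" by (auto simp: proj_mom_space_eq)
    have "v = free_moms C n \<nu>"
    proof
      fix i
      show "v i = free_moms C n \<nu> i"
        using fun_cong[OF \<nu>(2), of i] v Suc_notin_free_indices[of n C]
        by (cases "i \<in> free_indices C n")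
          (auto simp: free_moms_def free_indices_Suc[OF C] space_free_lborel extensional_def split: if_splits)
    qed
    with False \<nu>(1) show False by (simp add: proj_mom_space_eq)
  qed
  then show ?thesis using False by simp
next
  case True
  then obtain \<mu> where \<mu>: "\<mu> \<in> PC C" "v = free_moms C n \<mu>" by (auto simp: proj_mom_space_eq)
  define \<tau> E where "\<tau> = - 2 * (- 4 :: real) ^ n" "E = EM n \<mu>"
  note d = this
  have \<tau>: "\<tau> \<noteq> 0" "\<bar>\<tau>\<bar> = 2 * 4 ^ n" by (simp_all add: d abs_mult power_abs)
  obtain \<beta> where \<beta>: "\<And>t. Lam (cheb ((mom \<mu>)(Suc n := t))) (pCons 0 (Phi (cheb (mom \<mu>)) n)) = \<tau> * t + \<beta>"
    using verblunsky_affine[of "mom \<mu>" n] unfolding d by blast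
  note fib = fibre[OF C \<mu>(1) \<beta>, folded \<mu>(2) d(2)]
  have e: "free_En C n v = E" using free_En_free_moms[OF \<mu>(1)] by (simp add: \<mu>(2) d)
  have E0: "0 \<le> E" using EM_nonneg[OF PC_PM[OF \<mu>(1)]] by (simp add: d)
  show ?thesis
  proof (cases "E = 0")
    case z: True
    have "?L = (\<integral>\<^sup>+t. 0 \<partial>(lborel :: real measure))"
    proof (rule nn_integral_cong_AE)
      \<comment> \<open>A fibre over norm zero has at most this one point.\<close>
      have "AE t in lborel. t \<noteq> - \<beta> / \<tau>" by (rule AE_lborel_singleton)
      then show "AE t in lborel. indicator (proj_mom_space C (Suc n)) (v(Suc n := t)) *
          ennreal (free_En C (Suc n) (v(Suc n := t)) ^ j) = 0"
      proof eventually_elim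
        case (elim t)
        have "v(Suc n := t) \<notin> proj_mom_space C (Suc n)"
        proof
          assume "v(Suc n := t) \<in> proj_mom_space C (Suc n)"
          then have "\<tau> * t + \<beta> = 0" using fib(1)[of t] z by simp
          then have "t = - \<beta> / \<tau>" using \<tau>(1) by (simp add: field_simps add_eq_0_iff)
          then show False using elim by simp
        qed
        then show ?case by simp
      qed
    qed
    then show ?thesis using z by (simp add: e)
  next
    case False
    then have pos: "0 < E" using E0 by simp
    define f where "f = (\<lambda>t. ennreal (indicator {-1..1} ((\<tau> * t + \<beta>) / E) * (E * (1 - ((\<tau> * t + \<beta>) / E)\<^sup>2)) ^ j))"
    have fm: "f \<in> borel_measurable borel" unfolding f_def by measurable
    have "?L = (\<integral>\<^sup>+t. f t \<partial>lborel)"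
    proof (rule nn_integral_cong_AE)
      \<comment> \<open>These are the coefficients 1 and -1, where membership in the moment space is
        left open by \<open>fibre\<close>.\<close>
      have "AE t in lborel. t \<noteq> (E - \<beta>) / \<tau> \<and> t \<noteq> (- E - \<beta>) / \<tau>"
        by (intro AE_conjI AE_lborel_singleton)
      then show "AE t in lborel. indicator (proj_mom_space C (Suc n)) (v(Suc n := t)) *
          ennreal (free_En C (Suc n) (v(Suc n := t)) ^ j) = f t"
      proof eventually_elim
        case (elim t)
        define a where "a = (\<tau> * t + \<beta>) / E"
        have "a \<noteq> 1" "a \<noteq> - 1" using elim \<tau>(1) pos by (auto simp: a_def field_simps)
        then have iff: "v(Suc n := t) \<in> proj_mom_space C (Suc n) \<longleftrightarrow> a \<in> {-1..1}"
          using fib(1)[of t] fib(2)[of t] pos by (auto simp: a_def[symmetric] abs_le_iff abs_less_iff)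
        show ?case
        proof (cases "a \<in> {-1..1}")
          case True
          then show ?thesis using fib(1)[of t] iff by (simp add: f_def a_def[symmetric])
        next
          case False
          then have "indicat_real {-1..1} a = 0" "v(Suc n := t) \<notin> proj_mom_space C (Suc n)"
            using iff by simp_all
          then show ?thesis by (simp add: f_def a_def[symmetric])
        qed
      qed
    qed
    also have "\<dots> = ennreal \<bar>E / \<tau>\<bar> * (\<integral>\<^sup>+x. f (- \<beta> / \<tau> + E / \<tau> * x) \<partial>lborel)"
      by (rule nn_integral_real_affine[OF fm]) (use pos \<tau> in auto)
    also have "(\<lambda>x. f (- \<beta> / \<tau> + E / \<tau> * x)) = (\<lambda>x. ennreal (E ^ j) * ennreal (indicator {-1..1} x * (1 - x\<^sup>2) ^ j))"
    proof
      fix x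
      have "(\<tau> * (- \<beta> / \<tau> + E / \<tau> * x) + \<beta>) / E = x" using pos \<tau>(1) by (simp add: field_simps)
      then show "f (- \<beta> / \<tau> + E / \<tau> * x) = ennreal (E ^ j) * ennreal (indicator {-1..1} x * (1 - x\<^sup>2) ^ j)"
        using pos by (simp add: f_def power_mult_distrib mult.left_commute flip: ennreal_mult')
    qed
    also have "ennreal \<bar>E / \<tau>\<bar> * (\<integral>\<^sup>+x. ennreal (E ^ j) * ennreal (indicator {-1..1} x * (1 - x\<^sup>2) ^ j) \<partial>lborel) =
        fibre_const n j * ennreal (E ^ Suc j)"
    proof -
      have "ennreal \<bar>E / \<tau>\<bar> * ennreal (E ^ j) = ennreal (1 / (2 * 4 ^ n)) * ennreal (E ^ Suc j)"
        using pos \<tau>(2) by (simp add: abs_divide flip: ennreal_mult')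
      moreover define X where "X = (\<integral>\<^sup>+x. ennreal (indicator {-1..1} x * (1 - x\<^sup>2) ^ j) \<partial>(lborel :: real measure))"
      moreover have "(\<integral>\<^sup>+x. ennreal (E ^ j) * ennreal (indicator {-1..1} x * (1 - x\<^sup>2) ^ j) \<partial>(lborel :: real measure)) =
          ennreal (E ^ j) * X"
        unfolding X_def by (rule nn_integral_cmult) simp
      ultimately show ?thesis
        unfolding fibre_const_def X_def[symmetric] by (metis mult.assoc mult.commute)
    qed
    finally show ?thesis using True by (simp add: e fun_upd_def)
  qed
qed

interpretation lb: product_sigma_finite "\<lambda>_::nat. lborel :: real measure"
  by standard

lemma fubini_step:
  assumes C: "moment_constraint C" "max_index C \<le> n" and g: "g \<in> borel_measurable (free_lborel C n)"
  shows "(\<integral>\<^sup>+v. g (restrict v (free_indices C n)) *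
        weight C (Suc n) j v \<partial>free_lborel C (Suc n)) =
     fibre_const n j * (\<integral>\<^sup>+v. g v * weight C n (Suc j) v \<partial>free_lborel C n)"
proof -
  define h where "h = (\<lambda>v. indicator (proj_mom_space C (Suc n)) v * ennreal (free_En C (Suc n) v ^ j))"
  note F = free_indices_Suc[OF C]
  have hm: "h \<in> borel_measurable (free_lborel C (Suc n))"
    unfolding h_def using proj_mom_space_sets[of C "Suc n"] borel_measurable_free_En[of C "Suc n"] by measurable
  have rm: "(\<lambda>v. restrict v (free_indices C n)) \<in> measurable (free_lborel C (Suc n)) (free_lborel C n)"
    by (rule measurable_restrict_subset) (auto simp: F)
  have "(\<lambda>v. g (restrict v (free_indices C n)) * h v) \<in> borel_measurable (free_lborel C (Suc n))"
    using measurable_compose[OF rm g] hm by simp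
  then have "(\<integral>\<^sup>+v. g (restrict v (free_indices C n)) * h v \<partial>free_lborel C (Suc n)) =
      (\<integral>\<^sup>+v. \<integral>\<^sup>+t. g (restrict (v(Suc n := t)) (free_indices C n)) * h (v(Suc n := t)) \<partial>lborel \<partial>free_lborel C n)"
    unfolding F using Suc_notin_free_indices[of n C] by (subst lb.product_nn_integral_insert) auto
  also have "\<dots> = (\<integral>\<^sup>+v. g v * (fibre_const n j * weight C n (Suc j) v) \<partial>free_lborel C n)"
  proof (rule nn_integral_cong)
    fix v assume v: "v \<in> space (free_lborel C n)"
    have r: "restrict (v(Suc n := t)) (free_indices C n) = v" for t
      using v Suc_notin_free_indices[of n C] by (auto simp: space_free_lborel extensional_def restrict_def fun_eq_iff)
    have "v \<in> space (free_lborel C n) \<Longrightarrow> (\<lambda>t. v(Suc n := t)) \<in> measurable lborel (free_lborel C (Suc n))"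
      unfolding F by measurable
    from measurable_compose[OF this[OF v] hm]
    have "(\<lambda>t. h (v(Suc n := t))) \<in> borel_measurable lborel" .
    then have "(\<integral>\<^sup>+t. g v * h (v(Suc n := t)) \<partial>lborel) = g v * (\<integral>\<^sup>+t. h (v(Suc n := t)) \<partial>lborel)"
      by (rule nn_integral_cmult)
    then show "(\<integral>\<^sup>+t. g (restrict (v(Suc n := t)) (free_indices C n)) * h (v(Suc n := t)) \<partial>lborel) =
        g v * (fibre_const n j * weight C n (Suc j) v)"
      unfolding r by (simp only: h_def fibre_integral[OF C v])
  qed
  also have "\<dots> = (\<integral>\<^sup>+v. fibre_const n j * (g v * weight C n (Suc j) v) \<partial>free_lborel C n)"
    by (simp only: mult.left_commute)
  also have "\<dots> = fibre_const n j * (\<integral>\<^sup>+v. g v * weight C n (Suc j) v \<partial>free_lborel C n)"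
  proof (rule nn_integral_cmult, rule borel_measurable_times_ennreal[OF g])
    show "(\<lambda>v. indicator (proj_mom_space C n) v * ennreal (free_En C n v ^ Suc j)) \<in> borel_measurable (free_lborel C n)"
      using proj_mom_space_sets[of C n] borel_measurable_free_En[of C n] by measurable
  qed
  finally show ?thesis by (simp only: h_def)
qed

text \<open>The constant is chosen before g, so it is common to every event and to the total
  mass.\<close>

lemma fubini:
  assumes C: "moment_constraint C" "max_index C \<le> N"
  shows "\<exists>\<kappa>. 0 < \<kappa> \<and> \<kappa> < \<infinity> \<and> (\<forall>g\<in>borel_measurable (free_lborel C N).
     (\<integral>\<^sup>+v. g (restrict v (free_indices C N)) *
        weight C (N + k) j v \<partial>free_lborel C (N + k)) =
     \<kappa> * (\<integral>\<^sup>+v. g v * weight C N (j + k) v \<partial>free_lborel C N))"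
proof (induction k arbitrary: j)
  case 0
  have "restrict v (free_indices C N) = v" if "v \<in> space (free_lborel C N)" for v
    using that by (auto simp: space_free_lborel extensional_restrict)
  then have "(\<integral>\<^sup>+v. g (restrict v (free_indices C N)) * h v \<partial>free_lborel C N) = (\<integral>\<^sup>+v. g v * h v \<partial>free_lborel C N)" for g h
    by (intro nn_integral_cong) simp
  then show ?case
    by (intro exI[of _ 1] conjI ballI) (simp_all only: add_0_right mult_1 zero_less_one ennreal_one_less_top infinity_ennreal_def)
next
  case (Suc k)
  \<comment> \<open>The highest moment is integrated out first, which turns j into j + 1 for the
    remaining k moments.\<close>
  from Suc.IH[of "Suc j"] obtain \<kappa> where \<kappa>: "0 < \<kappa>" "\<kappa> < \<infinity>"
    "\<And>g. g \<in> borel_measurable (free_lborel C N) \<Longrightarrow> (\<integral>\<^sup>+v. g (restrict v (free_indices C N)) *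
        weight C (N + k) (Suc j) v \<partial>free_lborel C (N + k)) =
     \<kappa> * (\<integral>\<^sup>+v. g v * weight C N (Suc j + k) v \<partial>free_lborel C N)"
    by blast
  have sub: "free_indices C N \<subseteq> free_indices C (N + k)" by (auto simp: free_indices_def)
  have C': "max_index C \<le> N + k" using C by simp
  show ?case
  proof (intro exI[of _ "fibre_const (N + k) j * \<kappa>"] conjI ballI)
    show "0 < fibre_const (N + k) j * \<kappa>" using \<kappa> fibre_const_pos by (simp add: ennreal_zero_less_mult_iff)
    show "fibre_const (N + k) j * \<kappa> < \<infinity>" using \<kappa> fibre_const_finite by (simp add: ennreal_mult_less_top)
    fix g :: "(nat \<Rightarrow> real) \<Rightarrow> ennreal" assume g: "g \<in> borel_measurable (free_lborel C N)"
    define g' where "g' = (\<lambda>v. g (restrict v (free_indices C N)))"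
    have g': "g' \<in> borel_measurable (free_lborel C (N + k))"
      unfolding g'_def by (rule measurable_compose[OF measurable_restrict_subset[OF sub] g])
    have rr: "g' (restrict v (free_indices C (N + k))) = g' v" for v
      using sub by (simp add: g'_def Int_absorb1)
    show "(\<integral>\<^sup>+v. g (restrict v (free_indices C N)) *
        weight C (N + Suc k) j v \<partial>free_lborel C (N + Suc k)) =
      fibre_const (N + k) j * \<kappa> * (\<integral>\<^sup>+v. g v * weight C N (j + Suc k) v \<partial>free_lborel C N)"
      using fubini_step[OF C(1) C' g', of j] \<kappa>(3)[OF g] unfolding rr
      by (simp only: g'_def add_Suc_right add_Suc mult.assoc)
  qed
qed

text \<open>One-dimensional affine substitution, iterated over the coordinates. It measures
  homothetic copies of the moment space.\<close>

lemma nn_integral_affine_PiM: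
  assumes "finite I" "f \<in> borel_measurable (\<Pi>\<^sub>M j\<in>I. (lborel :: real measure))" "e > 0"
  shows "(\<integral>\<^sup>+v. f v \<partial>(\<Pi>\<^sub>M j\<in>(I :: nat set). lborel)) =
     ennreal (e ^ card I) * (\<integral>\<^sup>+v. f (\<lambda>j\<in>I. w j + e * v j) \<partial>(\<Pi>\<^sub>M j\<in>I. lborel))"
  using assms(1,2)
proof (induction I arbitrary: f)
  case empty
  show ?case by (simp add: PiM_empty nn_integral_count_space_finite)
next
  case (insert i I)
  let ?L = "\<lambda>I. \<Pi>\<^sub>M j\<in>(I :: nat set). (lborel :: real measure)"
  note f = insert.prems
  have aff: "(\<lambda>v. \<lambda>j\<in>J. w j + e * v j) \<in> measurable (?L J) (?L J)" for J
    by (intro measurable_restrict) simp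
  have fy: "(\<lambda>v. \<integral>\<^sup>+y. f (v(i := w i + e * y)) \<partial>lborel) \<in> borel_measurable (?L I)"
  proof -
    have "(\<lambda>(v, y). v(i := w i + e * y)) \<in> measurable (?L I \<Otimes>\<^sub>M lborel) (?L (insert i I))"
      by (simp add: split_beta') measurable
    from measurable_compose[OF this f] show ?thesis
      by (intro lborel.borel_measurable_nn_integral) (simp only: split_beta')
  qed
  have "(\<integral>\<^sup>+v. f v \<partial>?L (insert i I)) = (\<integral>\<^sup>+v. \<integral>\<^sup>+y. f (v(i := y)) \<partial>lborel \<partial>?L I)"
    using insert.hyps f by (rule lb.product_nn_integral_insert)
  also have "\<dots> = (\<integral>\<^sup>+v. ennreal e * (\<integral>\<^sup>+y. f (v(i := w i + e * y)) \<partial>lborel) \<partial>?L I)"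
  proof (rule nn_integral_cong)
    fix v assume v: "v \<in> space (?L I)"
    have "(\<lambda>y. v(i := y)) \<in> measurable lborel (?L (insert i I))" using v by measurable
    then have "(\<lambda>y. v(i := y)) \<in> measurable borel (?L (insert i I))"
      using measurable_cong_sets[OF sets_lborel refl] by blast
    from measurable_compose[OF this f] have "(\<lambda>y. f (v(i := y))) \<in> borel_measurable borel" .
    from nn_integral_real_affine[OF this, of e "w i"] assms(3)
    show "(\<integral>\<^sup>+y. f (v(i := y)) \<partial>lborel) = ennreal e * (\<integral>\<^sup>+y. f (v(i := w i + e * y)) \<partial>lborel)" by simp
  qed
  also have "\<dots> = ennreal e * (\<integral>\<^sup>+v. \<integral>\<^sup>+y. f (v(i := w i + e * y)) \<partial>lborel \<partial>?L I)"
    using fy by (rule nn_integral_cmult)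
  also have "\<dots> = ennreal e * (ennreal (e ^ card I) * (\<integral>\<^sup>+v. \<integral>\<^sup>+y. f ((\<lambda>j\<in>I. w j + e * v j)(i := w i + e * y)) \<partial>lborel \<partial>?L I))"
    by (subst insert.IH[OF fy]) (rule refl)
  also have "(\<integral>\<^sup>+v. \<integral>\<^sup>+y. f ((\<lambda>j\<in>I. w j + e * v j)(i := w i + e * y)) \<partial>lborel \<partial>?L I) =
      (\<integral>\<^sup>+v. \<integral>\<^sup>+y. f (\<lambda>j\<in>insert i I. w j + e * (v(i := y)) j) \<partial>lborel \<partial>?L I)"
  proof -
    have "(\<lambda>j\<in>I. w j + e * v j)(i := w i + e * y) = (\<lambda>j\<in>insert i I. w j + e * (v(i := y)) j)" for v y
      using insert.hyps by (auto simp: fun_eq_iff)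
    then show ?thesis by simp
  qed
  also have "\<dots> = (\<integral>\<^sup>+v. f (\<lambda>j\<in>insert i I. w j + e * v j) \<partial>?L (insert i I))"
    by (rule lb.product_nn_integral_insert[OF insert.hyps measurable_compose[OF aff f], symmetric])
  finally have "(\<integral>\<^sup>+v. f v \<partial>?L (insert i I)) = (ennreal e * ennreal (e ^ card I)) * (\<integral>\<^sup>+v. f (\<lambda>j\<in>insert i I. w j + e * v j) \<partial>?L (insert i I))"
    by (simp only: mult.assoc)
  also have "ennreal e * ennreal (e ^ card I) = ennreal (e ^ card (insert i I))"
    using insert.hyps assms(3) by (simp add: ennreal_mult)
  finally show ?case .
qed

text \<open>The unnormalised probability that the free moments up to N lie in S when k further
  moments have been integrated out.\<close>

definition fibre_mass :: "(nat \<rightharpoonup> real) \<Rightarrow> nat \<Rightarrow> nat \<Rightarrow> (nat \<Rightarrow> real) set \<Rightarrow> ennreal" where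
  "fibre_mass C N k S = (\<integral>\<^sup>+v. indicator S v * weight C N k v \<partial>free_lborel C N)"

abbreviation volume :: "(nat \<rightharpoonup> real) \<Rightarrow> nat \<Rightarrow> ennreal" where
  "volume C N \<equiv> emeasure (free_lborel C N) (proj_mom_space C N)"

lemma fibre_mass_le:
  assumes "0 \<le> s" "\<And>v. v \<in> S \<Longrightarrow> v \<in> proj_mom_space C N \<Longrightarrow> free_En C N v \<le> s"
  shows "fibre_mass C N k S \<le> ennreal (s ^ k) * volume C N"
proof -
  have "fibre_mass C N k S \<le> (\<integral>\<^sup>+v. ennreal (s ^ k) * indicator (proj_mom_space C N) v \<partial>free_lborel C N)"
    unfolding fibre_mass_def
  proof (rule nn_integral_mono)
    fix v
    show "indicator S v * weight C N k v \<le> ennreal (s ^ k) * indicator (proj_mom_space C N) v"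
    proof (cases "v \<in> S \<and> v \<in> proj_mom_space C N")
      case True
      then obtain \<mu> where "\<mu> \<in> PC C" "v = free_moms C N \<mu>" by (auto simp: proj_mom_space_eq)
      then have "0 \<le> free_En C N v" by (simp add: free_En_free_moms EM_nonneg PC_PM)
      then have "free_En C N v ^ k \<le> s ^ k" using True assms by (intro power_mono) auto
      then show ?thesis using True by (simp add: ennreal_leI)
    qed (auto simp: indicator_def)
  qed
  also have "\<dots> = ennreal (s ^ k) * volume C N"
    by (rule nn_integral_cmult_indicator[OF proj_mom_space_sets])
  finally show ?thesis .
qed

text \<open>The homothetic copy of the moment space, contracted towards the moments of \<open>\<mu>\<close> by the factor \<open>e\<close>,
  carries enough mass because \<^const>\<open>EM\<close> is concave.\<close>

lemma fibre_mass_ge: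
  assumes \<mu>: "\<mu> \<in> PC C" and e: "0 < e" "e < 1" and S: "S \<in> sets (free_lborel C N)"
    and sub: "\<And>\<nu>. \<nu> \<in> PC C \<Longrightarrow> free_moms C N (mix e \<mu> \<nu>) \<in> S"
  shows "ennreal (e ^ card (free_indices C N) * ((1 - e) * EM N \<mu>) ^ k) * volume C N \<le> fibre_mass C N k S"
proof -
  define F where "F = free_indices C N"
  define f where "f = (\<lambda>v. indicator S v * weight C N k v)"
  define T where "T = (\<lambda>v. \<lambda>j\<in>F. (1 - e) * mom \<mu> j + e * v j)"
  have fm: "f \<in> borel_measurable (free_lborel C N)"
    unfolding f_def using S proj_mom_space_sets[of C N] borel_measurable_free_En[of C N] by measurable
  have "ennreal (((1 - e) * EM N \<mu>) ^ k) * volume C N =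
      (\<integral>\<^sup>+v. ennreal (((1 - e) * EM N \<mu>) ^ k) * indicator (proj_mom_space C N) v \<partial>free_lborel C N)"
    by (rule nn_integral_cmult_indicator[OF proj_mom_space_sets, symmetric])
  also have "\<dots> \<le> (\<integral>\<^sup>+v. f (T v) \<partial>free_lborel C N)"
  proof (rule nn_integral_mono)
    fix v
    show "ennreal (((1 - e) * EM N \<mu>) ^ k) * indicator (proj_mom_space C N) v \<le> f (T v)"
    proof (cases "v \<in> proj_mom_space C N")
      case True
      then obtain \<nu> where \<nu>: "\<nu> \<in> PC C" "v = free_moms C N \<nu>" by (auto simp: proj_mom_space_eq)
      define \<rho> where "\<rho> = mix e \<mu> \<nu>"
      note P = PC_PM[OF \<mu>] PC_PM[OF \<nu>(1)]
      have \<rho>: "\<rho> \<in> PC C" unfolding \<rho>_def using \<mu> \<nu> e by (intro PC_mix) auto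
      have T: "T v = free_moms C N \<rho>"
        using mom_mix[OF P, of e] e by (auto simp: T_def \<nu>(2) free_moms_def F_def \<rho>_def)
      have "(1 - e) * EM N \<mu> + e * EM N \<nu> \<le> EM N \<rho>"
        unfolding \<rho>_def using e by (intro EM_mix_ge P) auto
      moreover have "0 \<le> e * EM N \<nu>" using e EM_nonneg[OF P(2)] by simp
      ultimately have "(1 - e) * EM N \<mu> \<le> EM N \<rho>" by linarith
      then have "((1 - e) * EM N \<mu>) ^ k \<le> EM N \<rho> ^ k"
        using e EM_nonneg[OF P(1)] by (intro power_mono) auto
      moreover have "T v \<in> S" "T v \<in> proj_mom_space C N" "free_En C N (T v) = EM N \<rho>"
        using sub[OF \<nu>(1)] \<rho> by (auto simp: T \<rho>_def[symmetric] proj_mom_space_eq free_En_free_moms)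
      ultimately show ?thesis using True by (simp add: f_def ennreal_leI)
    qed simp
  qed
  finally have "ennreal (e ^ card F) * (ennreal (((1 - e) * EM N \<mu>) ^ k) * volume C N) \<le>
      ennreal (e ^ card F) * (\<integral>\<^sup>+v. f (T v) \<partial>free_lborel C N)" by (rule mult_left_mono) simp
  also have "\<dots> = (\<integral>\<^sup>+v. f v \<partial>free_lborel C N)"
    unfolding T_def F_def by (rule nn_integral_affine_PiM[OF _ fm e(1), symmetric]) simp
  finally show ?thesis
    using e EM_nonneg[OF PC_PM[OF \<mu>], of N]
    by (simp add: fibre_mass_def f_def F_def ennreal_mult mult.assoc)
qed

lemma mom_bounds: "\<mu> \<in> PM \<Longrightarrow> 0 \<le> mom \<mu> j \<and> mom \<mu> j \<le> 1"
proof -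
  assume \<mu>: "\<mu> \<in> PM"
  interpret prob_space \<mu> using PM_D[OF \<mu>] by simp
  have "mom \<mu> j \<le> (\<integral>x. 1 \<partial>\<mu>)"
    unfolding mom_def using PM_D[OF \<mu>]
    by (intro integral_mono integrable_PM[OF \<mu>] continuous_intros) (auto intro: power_le_one)
  moreover have "0 \<le> mom \<mu> j"
    unfolding mom_def using PM_D[OF \<mu>] by (intro integral_nonneg_AE AE_I2) auto
  ultimately show ?thesis by (simp add: prob_space)
qed

lemma volume_finite: "volume C N < \<infinity>"
proof -
  have "volume C N \<le> emeasure (free_lborel C N) (PiE (free_indices C N) (\<lambda>_. {0..1}))"
    using mom_bounds PC_PM
    by (intro emeasure_mono sets_PiM_I_finite) (auto simp: proj_mom_space_eq free_moms_def)
  also have "\<dots> = 1" by (subst lb.emeasure_PiM) auto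
  finally show ?thesis by (auto intro: le_less_trans)
qed

section \<open>Large deviations\<close>

lemma space_borel_of [simp]: "space (borel_of X) = topspace X"
  by (simp add: borel_of_def space_measure_of_conv)

lemma sets_borel_of_open: "openin X U \<Longrightarrow> U \<in> sets (borel_of X)"
  by (auto simp: borel_of_def sets_measure_of_conv dest: openin_subset intro: sigma_sets.Basic)

lemma sets_borel_of_subset: "A \<in> sets (borel_of X) \<Longrightarrow> A \<subseteq> topspace X"
  using sets.sets_into_space[of A "borel_of X"] by simp

lemma measurable_mom: "(\<lambda>\<mu>. mom \<mu> j) \<in> borel_measurable (borel_of W)"
proof (rule borel_measurableI)
  fix S :: "real set" assume "open S"
  then have "openin W {\<mu> \<in> PM. mom \<mu> j \<in> S}" by (rule openin_W_mom)
  moreover have "(\<lambda>\<mu>. mom \<mu> j) -` S \<inter> space (borel_of W) = {\<mu> \<in> PM. mom \<mu> j \<in> S}"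
    by (auto simp: topspace_W)
  ultimately show "(\<lambda>\<mu>. mom \<mu> j) -` S \<inter> space (borel_of W) \<in> sets (borel_of W)"
    by (simp add: sets_borel_of_open)
qed

lemma measurable_fill_in: "fill_in C n \<in> measurable (free_lborel C n) (\<Pi>\<^sub>M j\<in>{1..n}. borel)"
  unfolding fill_in_def
proof (rule measurable_restrict)
  fix j assume "j \<in> {1..n}"
  then show "(\<lambda>v. case C j of None \<Rightarrow> v j | Some c \<Rightarrow> c) \<in> borel_measurable (free_lborel C n)"
    by (cases "C j") (auto simp: free_indices_def dom_def)
qed

section \<open>Random measures with uniform moment vectors\<close>

locale uniform_moments =
  fixes C :: "nat \<rightharpoonup> real" and n :: nat and \<Omega> :: "'w measure" and \<mu> :: "'w \<Rightarrow> real measure"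
  assumes C: "moment_constraint C" and n: "max_index C \<le> n"
    and prob: "prob_space \<Omega>"
    and meas: "\<mu> \<in> measurable \<Omega> (borel_of W)"
    and law: "distr \<Omega> (\<Pi>\<^sub>M j\<in>{1..n}. borel) (\<lambda>\<omega>. mom_vec n (\<mu> \<omega>)) = uniform_mom C n"
begin

sublocale prob_space \<Omega> by (rule prob)

lemma meas_mom: "(\<lambda>\<omega>. mom (\<mu> \<omega>) j) \<in> borel_measurable \<Omega>"
  by (rule measurable_compose[OF meas measurable_mom])

lemma meas_mom_vec: "(\<lambda>\<omega>. mom_vec n (\<mu> \<omega>)) \<in> measurable \<Omega> (\<Pi>\<^sub>M j\<in>{1..n}. borel)"
  unfolding mom_vec_def by (rule measurable_restrict) (rule meas_mom)

lemma in_PM: "\<omega> \<in> space \<Omega> \<Longrightarrow> \<mu> \<omega> \<in> PM"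
  using measurable_space[OF meas] by (simp add: topspace_W)

lemma emeasure_mom_vec:
  assumes S: "S \<in> sets (\<Pi>\<^sub>M j\<in>{1..n}. borel)"
  shows "emeasure \<Omega> {\<omega> \<in> space \<Omega>. mom_vec n (\<mu> \<omega>) \<in> S} =
     emeasure (free_lborel C n) (proj_mom_space C n \<inter> {v \<in> space (free_lborel C n). fill_in C n v \<in> S}) / volume C n"
proof -
  have "{\<omega> \<in> space \<Omega>. mom_vec n (\<mu> \<omega>) \<in> S} = (\<lambda>\<omega>. mom_vec n (\<mu> \<omega>)) -` S \<inter> space \<Omega>" by auto
  then have "emeasure \<Omega> {\<omega> \<in> space \<Omega>. mom_vec n (\<mu> \<omega>) \<in> S} = emeasure (uniform_mom C n) S"
    unfolding law[symmetric] by (simp only: emeasure_distr[OF meas_mom_vec S])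
  also have "\<dots> = emeasure (uniform_measure (free_lborel C n) (proj_mom_space C n)) (fill_in C n -` S \<inter> space (free_lborel C n))"
    unfolding uniform_mom_def using S measurable_fill_in
    by (subst emeasure_distr) (auto cong: measurable_cong_sets)
  also have "\<dots> = emeasure (free_lborel C n) (proj_mom_space C n \<inter> (fill_in C n -` S \<inter> space (free_lborel C n))) / volume C n"
    by (rule emeasure_uniform_measure[OF proj_mom_space_sets measurable_sets[OF measurable_fill_in S]])
  also have "fill_in C n -` S \<inter> space (free_lborel C n) = {v \<in> space (free_lborel C n). fill_in C n v \<in> S}" by auto
  finally show ?thesis .
qed

text \<open>As \<open>0 / 0 = 0\<close>, the uniform distribution on a set of volume zero would not be a probability law.\<close>

lemma volume_pos: "0 < volume C n"
proof (rule ccontr)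
  assume "\<not> 0 < volume C n"
  then have z: "volume C n = 0" by simp
  let ?S = "space (\<Pi>\<^sub>M j\<in>{1..n}. borel :: real measure)"
  have "{\<omega> \<in> space \<Omega>. mom_vec n (\<mu> \<omega>) \<in> ?S} = space \<Omega>"
    using measurable_space[OF meas_mom_vec] by auto
  then have "1 = emeasure \<Omega> {\<omega> \<in> space \<Omega>. mom_vec n (\<mu> \<omega>) \<in> ?S}" by (simp only: emeasure_space_1)
  also have "\<dots> = emeasure (free_lborel C n) (proj_mom_space C n \<inter> {v \<in> space (free_lborel C n). fill_in C n v \<in> ?S}) / volume C n"
    by (rule emeasure_mom_vec) simp
  also have "emeasure (free_lborel C n) (proj_mom_space C n \<inter> {v \<in> space (free_lborel C n). fill_in C n v \<in> ?S}) \<le> volume C n"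
    by (rule emeasure_mono[OF _ proj_mom_space_sets]) auto
  then have "emeasure (free_lborel C n) (proj_mom_space C n \<inter> {v \<in> space (free_lborel C n). fill_in C n v \<in> ?S}) = 0"
    using z by simp
  finally show False by simp
qed

text \<open>The hypothesis concerns the law, so the constraint holds only almost surely; later
  inclusions of events are therefore up to null sets.\<close>

lemma AE_PC: "AE \<omega> in \<Omega>. \<mu> \<omega> \<in> PC C"
proof -
  let ?P = "\<Pi>\<^sub>M j\<in>{1..n}. borel :: real measure"
  have dom: "i \<in> {1..n}" if "i \<in> dom C" for i using max_index_ge[OF C that] n by auto
  define S where "S = {w \<in> space ?P. \<forall>i\<in>dom C. w i = the (C i)}"
  have "finite (dom C)" using C by (simp add: moment_constraint_def)
  have S: "S \<in> sets ?P"
    unfolding S_def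
  proof (rule sets.sets_Collect_finite_All)
    show "{w \<in> space ?P. w i = the (C i)} \<in> sets ?P" if "i \<in> dom C" for i
      using dom[OF that] by measurable
  qed (use \<open>finite (dom C)\<close> in auto)
  have f: "fill_in C n v \<in> S" if "v \<in> space (free_lborel C n)" for v
    using measurable_space[OF measurable_fill_in that] dom by (auto simp: S_def fill_in_def dom_def)
  have "proj_mom_space C n \<inter> {v \<in> space (free_lborel C n). fill_in C n v \<in> S} = proj_mom_space C n"
    using f sets.sets_into_space[OF proj_mom_space_sets[of C n]] by auto
  then have "emeasure \<Omega> {\<omega> \<in> space \<Omega>. mom_vec n (\<mu> \<omega>) \<in> S} = volume C n / volume C n"
    by (simp only: emeasure_mom_vec[OF S])
  also have "\<dots> = 1" using volume_pos volume_finite by (intro ennreal_divide_self) auto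
  finally have "AE \<omega> in \<Omega>. \<omega> \<in> {\<omega> \<in> space \<Omega>. mom_vec n (\<mu> \<omega>) \<in> S}"
    using measurable_sets[OF meas_mom_vec S] by (subst AE_in_set_eq_1) (auto simp: measure_def vimage_def Int_def conj_commute)
  with AE_space show ?thesis
  proof eventually_elim
    case (elim \<omega>)
    then have "\<mu> \<omega> \<in> PM" "mom_vec n (\<mu> \<omega>) \<in> S" using in_PM by auto
    then show ?case using dom by (auto simp: PC_iff S_def mom_vec_def)
  qed
qed

lemma measurable_free_moms:
  "(\<lambda>\<omega>. free_moms C N (\<mu> \<omega>)) \<in> measurable \<Omega> (free_lborel C N)"
  unfolding free_moms_def
proof (rule measurable_restrict)
  show "(\<lambda>\<omega>. mom (\<mu> \<omega>) i) \<in> measurable \<Omega> lborel" for i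
    using meas_mom[of i] by simp
qed

text \<open>Apply \<open>fubini\<close> with exponent 0 at n both to S and to the whole space; the
  common constant cancels. A product instead of a quotient avoids dividing by the total
  mass.\<close>

lemma prob_free_moms:
  assumes N: "max_index C \<le> N" "N \<le> n" and S: "S \<in> sets (free_lborel C N)"
  shows "ennreal (prob {\<omega> \<in> space \<Omega>. free_moms C N (\<mu> \<omega>) \<in> S}) *
      fibre_mass C N (n - N) (space (free_lborel C N)) = fibre_mass C N (n - N) S"
proof -
  define k where "k = n - N"
  have nk: "N + k = n" using N by (simp add: k_def)
  obtain \<kappa> where \<kappa>: "0 < \<kappa>" "\<kappa> < \<infinity>"
    "\<And>g. g \<in> borel_measurable (free_lborel C N) \<Longrightarrow> (\<integral>\<^sup>+v. g (restrict v (free_indices C N)) *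
        weight C n 0 v \<partial>free_lborel C n) =
     \<kappa> * (\<integral>\<^sup>+v. g v * weight C N (0 + k) v \<partial>free_lborel C N)"
    using fubini[OF C N(1), of k 0] unfolding nk by blast
  have sub: "free_indices C N \<subseteq> free_indices C n" using N by (auto simp: free_indices_def)
  have mass: "emeasure (free_lborel C n) (proj_mom_space C n \<inter> {v \<in> space (free_lborel C n). restrict v (free_indices C N) \<in> T}) =
      \<kappa> * fibre_mass C N k T" if T: "T \<in> sets (free_lborel C N)" for T
  proof -
    have rm: "(\<lambda>v. restrict v (free_indices C N)) \<in> measurable (free_lborel C n) (free_lborel C N)"
      by (rule measurable_restrict_subset[OF sub])
    have "{v \<in> space (free_lborel C n). restrict v (free_indices C N) \<in> T} \<in> sets (free_lborel C n)"
      using measurable_sets[OF rm T] by (simp add: vimage_def Int_def conj_commute)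
    then have "emeasure (free_lborel C n) (proj_mom_space C n \<inter> {v \<in> space (free_lborel C n). restrict v (free_indices C N) \<in> T}) =
       (\<integral>\<^sup>+v. indicator (proj_mom_space C n \<inter> {v \<in> space (free_lborel C n). restrict v (free_indices C N) \<in> T}) v \<partial>free_lborel C n)"
      by (intro nn_integral_indicator[symmetric] sets.Int proj_mom_space_sets)
    also have "\<dots> = (\<integral>\<^sup>+v. indicator T (restrict v (free_indices C N)) *
        weight C n 0 v \<partial>free_lborel C n)"
      by (intro nn_integral_cong) (auto simp: indicator_def)
    also have "\<dots> = \<kappa> * fibre_mass C N k T"
      using \<kappa>(3)[of "indicator T"] T by (simp add: fibre_mass_def)
    finally show ?thesis .
  qed
  define T where "T = space (free_lborel C N)"
  have T: "T \<in> sets (free_lborel C N)" by (simp add: T_def)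
  have "proj_mom_space C n \<inter> {v \<in> space (free_lborel C n). restrict v (free_indices C N) \<in> T} = proj_mom_space C n"
    using sets.sets_into_space[OF proj_mom_space_sets[of C n]] by (auto simp: T_def space_free_lborel)
  then have vol: "volume C n = \<kappa> * fibre_mass C N k T" using mass[OF T] by simp
  define S' where "S' = {w \<in> space (\<Pi>\<^sub>M j\<in>{1..n}. borel :: real measure). restrict w (free_indices C N) \<in> S}"
  have sub': "free_indices C N \<subseteq> {1..n}" using N by (auto simp: free_indices_def)
  have rm': "(\<lambda>w. restrict w (free_indices C N)) \<in> measurable (\<Pi>\<^sub>M j\<in>{1..n}. borel) (free_lborel C N)"
  proof (rule measurable_restrict)
    show "(\<lambda>w. w i) \<in> measurable (\<Pi>\<^sub>M j\<in>{1..n}. borel) lborel" if "i \<in> free_indices C N" for i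
      using sub' that by auto
  qed
  have S': "S' \<in> sets (\<Pi>\<^sub>M j\<in>{1..n}. borel)"
    using measurable_sets[OF rm' S] by (simp add: S'_def vimage_def Int_def conj_commute)
  have r1: "restrict (mom_vec n \<rho>) (free_indices C N) = free_moms C N \<rho>" for \<rho>
    using sub' by (auto simp: mom_vec_def free_moms_def restrict_def fun_eq_iff)
  have r2: "restrict (fill_in C n v) (free_indices C N) = restrict v (free_indices C N)" for v
    using N by (auto simp: fill_in_def restrict_def fun_eq_iff free_indices_def dom_def)
  have e1: "{\<omega> \<in> space \<Omega>. mom_vec n (\<mu> \<omega>) \<in> S'} = {\<omega> \<in> space \<Omega>. free_moms C N (\<mu> \<omega>) \<in> S}"
    using measurable_space[OF meas_mom_vec] by (auto simp: S'_def r1)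
  have e2: "{v \<in> space (free_lborel C n). fill_in C n v \<in> S'} = {v \<in> space (free_lborel C n). restrict v (free_indices C N) \<in> S}"
    using measurable_space[OF measurable_fill_in[of C n]] by (auto simp: S'_def r2)
  have pr: "ennreal (prob {\<omega> \<in> space \<Omega>. free_moms C N (\<mu> \<omega>) \<in> S}) = \<kappa> * fibre_mass C N k S / volume C n"
    using emeasure_mom_vec[OF S'] unfolding e1 e2 mass[OF S] by (simp add: emeasure_eq_measure)
  have "ennreal (prob {\<omega> \<in> space \<Omega>. free_moms C N (\<mu> \<omega>) \<in> S}) * volume C n = \<kappa> * fibre_mass C N k S"
    unfolding pr using volume_pos volume_finite[of C n] by (simp add: ennreal_divide_times mult_divide_eq_ennreal)
  then have "\<kappa> * (ennreal (prob {\<omega> \<in> space \<Omega>. free_moms C N (\<mu> \<omega>) \<in> S}) * fibre_mass C N k T) = \<kappa> * fibre_mass C N k S"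
    unfolding vol by (simp only: mult.left_commute)
  then show ?thesis
    using \<kappa>(1,2) unfolding k_def[symmetric] T_def[symmetric] by (subst (asm) ennreal_mult_cancel_left) auto
qed

end

text \<open>If all norms at n vanished, every fibre would be a null set and the volume one index
  higher would be zero. The measure obtained gives rise to one of finite entropy.\<close>

lemma ex_EM_pos:
  assumes C: "moment_constraint C" "max_index C \<le> n" and vol: "0 < volume C (Suc n)"
  obtains \<mu> where "\<mu> \<in> PC C" "0 < EM n \<mu>"
proof -
  have "\<exists>\<mu>\<in>PC C. 0 < EM n \<mu>"
  proof (rule ccontr)
    assume "\<not> (\<exists>\<mu>\<in>PC C. 0 < EM n \<mu>)"
    then have z: "EM n \<mu> = 0" if "\<mu> \<in> PC C" for \<mu>
      using that EM_nonneg[OF PC_PM[OF that], of n] by fastforce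
    have "volume C (Suc n) = (\<integral>\<^sup>+v. indicator (proj_mom_space C (Suc n)) v \<partial>free_lborel C (Suc n))"
      by (rule nn_integral_indicator[symmetric, OF proj_mom_space_sets])
    also have "\<dots> = fibre_const n 0 * (\<integral>\<^sup>+v. 1 * weight C n (Suc 0) v \<partial>free_lborel C n)"
      using fubini_step[OF C, of "\<lambda>_. 1" 0] by simp
    also have "(\<integral>\<^sup>+v. 1 * weight C n (Suc 0) v \<partial>free_lborel C n) = (\<integral>\<^sup>+v. 0 \<partial>free_lborel C n)"
      by (intro nn_integral_cong) (auto simp: indicator_def proj_mom_space_eq free_En_free_moms z)
    finally show False using vol by simp
  qed
  with that show thesis by blast
qed

context uniform_moments
begin

text \<open>The mass of S is at least that of a homothetic copy contracted towards x, while the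
  total mass is at most \<open>exp (- a) ^ (n - N)\<close> times the volume. The volume
  cancels.\<close>

lemma prob_ge:
  assumes N: "max_index C \<le> N" "N \<le> n" and vol: "0 < volume C N"
    and a: "\<And>\<rho>. \<rho> \<in> PC C \<Longrightarrow> ereal a \<le> kl arcsine \<rho>"
    and x: "x \<in> PC C" and e: "0 < e" "e < 1" and S: "S \<in> sets (free_lborel C N)"
    and sub: "\<And>\<nu>. \<nu> \<in> PC C \<Longrightarrow> free_moms C N (mix e x \<nu>) \<in> S"
  shows "e ^ card (free_indices C N) * ((1 - e) * EM N x) ^ (n - N) \<le>
    prob {\<omega> \<in> space \<Omega>. free_moms C N (\<mu> \<omega>) \<in> S} * exp (- a) ^ (n - N)" (is "?X \<le> ?P * ?s")
proof -
  have "ennreal ?X * volume C N \<le> fibre_mass C N (n - N) S"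
    by (rule fibre_mass_ge[OF x e S sub])
  also have "\<dots> = ennreal ?P * fibre_mass C N (n - N) (space (free_lborel C N))"
    by (rule prob_free_moms[OF N S, symmetric])
  also have "\<dots> \<le> ennreal ?P * (ennreal ?s * volume C N)"
    by (intro mult_left_mono fibre_mass_le)
      (auto simp: proj_mom_space_eq free_En_free_moms intro: EM_le_inf_kl[OF C _ N(1) a])
  also have "\<dots> = ennreal (?P * ?s) * volume C N" by (simp add: ennreal_mult mult.assoc)
  finally have "volume C N * ennreal ?X \<le> volume C N * ennreal (?P * ?s)" by (simp only: mult.commute)
  then have "ennreal ?X \<le> ennreal (?P * ?s)"
    using vol volume_finite[of C N] by (subst (asm) ennreal_mult_le_mult_iff) auto
  then show ?thesis by (subst (asm) ennreal_le_iff) auto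
qed

text \<open>Here the homothetic copy bounds the total mass from below, and x is meant to be the
  minimizer; the event itself has density at most \<open>d ^ (n - N)\<close>.\<close>

lemma prob_le:
  assumes N: "max_index C \<le> N" "N \<le> n" and vol: "0 < volume C N"
    and x: "x \<in> PC C" and e: "0 < e" "e < 1" and d: "0 \<le> d"
  shows "prob {\<omega> \<in> space \<Omega>. free_moms C N (\<mu> \<omega>) \<in> {v \<in> space (free_lborel C N). free_En C N v < d}} *
    (e ^ card (free_indices C N) * ((1 - e) * EM N x) ^ (n - N)) \<le> d ^ (n - N)" (is "?P * ?X \<le> ?d")
proof -
  let ?S = "{v \<in> space (free_lborel C N). free_En C N v < d}"
  have S: "?S \<in> sets (free_lborel C N)"
    using borel_measurable_free_En[of C N] by measurable
  have X0: "0 \<le> ?X" using e EM_nonneg[OF PC_PM[OF x], of N] by simp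
  have "ennreal (?P * ?X) * volume C N = ennreal ?P * (ennreal ?X * volume C N)"
    using X0 by (simp add: ennreal_mult mult.assoc)
  also have "\<dots> \<le> ennreal ?P * fibre_mass C N (n - N) (space (free_lborel C N))"
    by (rule mult_left_mono[OF fibre_mass_ge[OF x e sets.top]]) (simp_all add: free_moms_def space_free_lborel)
  also have "\<dots> = fibre_mass C N (n - N) ?S" by (rule prob_free_moms[OF N S])
  also have "\<dots> \<le> ennreal ?d * volume C N" by (rule fibre_mass_le[OF d]) auto
  finally have "volume C N * ennreal (?P * ?X) \<le> volume C N * ennreal ?d" by (simp only: mult.commute)
  then have "ennreal (?P * ?X) \<le> ennreal ?d"
    using vol volume_finite[of C N] by (subst (asm) ennreal_mult_le_mult_iff) auto
  then show ?thesis using d by (subst (asm) ennreal_le_iff) auto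
qed

end

section \<open>The two bounds of the large deviations principle\<close>

lemma elog_ge: "0 < c \<Longrightarrow> c \<le> p \<Longrightarrow> 0 \<le> t \<Longrightarrow> ereal (t * ln c) \<le> ereal t * elog p"
  by (auto simp: elog_def intro!: mult_left_mono)

lemma elog_le: "0 < c \<Longrightarrow> p \<le> c \<Longrightarrow> 0 < t \<Longrightarrow> ereal t * elog p \<le> ereal (t * ln c)"
  by (auto simp: elog_def intro!: mult_left_mono)

context
  fixes C :: "nat \<rightharpoonup> real" and \<Omega> :: "nat \<Rightarrow> 'w measure" and \<mu> :: "nat \<Rightarrow> 'w \<Rightarrow> real measure" and a :: real
  assumes C: "moment_constraint C"
    and um: "\<And>n. max_index C \<le> n \<Longrightarrow> uniform_moments C n (\<Omega> n) (\<mu> n)"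
    and kl_min: "kl_minimizer C \<in> PC C" "kl arcsine (kl_minimizer C) = ereal a"
    and a: "\<And>\<rho>. \<rho> \<in> PC C \<Longrightarrow> ereal a \<le> kl arcsine \<rho>"
begin

abbreviation laws :: "nat \<Rightarrow> real measure measure" where
  "laws n \<equiv> distr (\<Omega> n) (borel_of W) (\<mu> n)"

lemma ldp_lower:
  assumes \<Gamma>: "\<Gamma> \<in> sets (borel_of W)" and x: "x \<in> W interior_of \<Gamma>"
  shows "- rate C x \<le> liminf (\<lambda>n. ereal (1 / real n) * elog (measure (laws n) \<Gamma>))"
proof (cases "rate C x = \<infinity>")
  case False
  then have xPC: "x \<in> PC C" and "kl arcsine x \<noteq> \<infinity>"
    by (auto simp: rate_eq[OF kl_min(2)] split: if_splits)
  then obtain k where k: "kl arcsine x = ereal k" using kl_nonneg[OF PC_PM[OF xPC]] by (cases "kl arcsine x") auto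
  have rate: "rate C x = ereal (k - a)" using xPC k by (simp add: rate_eq[OF kl_min(2)])
  obtain N1 r where r: "r > 0"
    "\<forall>\<nu>\<in>PM. (\<forall>j. 1 \<le> j \<and> j \<le> N1 \<longrightarrow> \<bar>mom \<nu> j - mom x j\<bar> < r) \<longrightarrow> \<nu> \<in> W interior_of \<Gamma>"
    by (rule W_neighbourhood[OF openin_interior_of x])
  \<comment> \<open>Reaching \<open>max_index C\<close> is what makes the reduction to N moments and
    the bound of \<open>EM N\<close> by the least entropy applicable.\<close>
  define N where "N = max N1 (max_index C)"
  have N: "max_index C \<le> N" "N1 \<le> N" by (simp_all add: N_def)
  have vol: "0 < volume C N" by (rule uniform_moments.volume_pos[OF um[OF N(1)]])
  define d where "d = card (free_indices C N)"
  define S where "S = {v \<in> space (free_lborel C N). \<forall>j\<in>free_indices C N. \<bar>v j - mom x j\<bar> < r}"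
  have S: "S \<in> sets (free_lborel C N)"
    unfolding S_def
  proof (rule sets.sets_Collect_finite_All)
    show "{v \<in> space (free_lborel C N). \<bar>v j - mom x j\<bar> < r} \<in> sets (free_lborel C N)" if "j \<in> free_indices C N" for j
      using that by measurable
  qed simp
  let ?r = "\<lambda>n. (real d * ln (1 / real n) + (real n - real N) * (ln (1 - 1 / real n) - k + a)) / real n"
  have ev: "eventually (\<lambda>n. ereal (?r n) \<le>
      ereal (1 / real n) * elog (measure (laws n) \<Gamma>)) sequentially"
  proof -
    have "(\<lambda>n. 1 / real n) \<longlonglongrightarrow> 0" by real_asymp
    from order_tendstoD(2)[OF this r(1)] have "eventually (\<lambda>n. 1 / real n < r) sequentially" .
    with eventually_gt_at_top[of "max N 1"] show ?thesis
    proof eventually_elim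
      case (elim n)
      then have nn: "N \<le> n" "1 < n" by auto
      interpret uniform_moments C n "\<Omega> n" "\<mu> n" using um N nn by simp
      \<comment> \<open>With this contraction \<open>e ^ d\<close> decays polynomially and
        \<open>(1 - e) ^ j\<close> stays bounded below, so neither is visible at speed n. Moreover e
        < r eventually, which puts the copy inside \<open>S\<close>.\<close>
      define e where "e = 1 / real n"
      have e: "0 < e" "e < 1" "e < r" using elim nn by (auto simp: e_def)
      define j where "j = n - N"
      have sub: "free_moms C N (mix e x \<nu>) \<in> S" if \<nu>: "\<nu> \<in> PC C" for \<nu>
      proof -
        have "\<bar>mom (mix e x \<nu>) i - mom x i\<bar> < r" for i
        proof -
          have "mom (mix e x \<nu>) i - mom x i = e * (mom \<nu> i - mom x i)"
            using mom_mix[OF PC_PM[OF xPC] PC_PM[OF \<nu>], of e i] e by (simp add: algebra_simps)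
          then have "\<bar>mom (mix e x \<nu>) i - mom x i\<bar> = e * \<bar>mom \<nu> i - mom x i\<bar>"
            using e by (simp add: abs_mult)
          moreover have "\<bar>mom \<nu> i - mom x i\<bar> \<le> 1"
            using mom_bounds[OF PC_PM[OF xPC], of i] mom_bounds[OF PC_PM[OF \<nu>], of i] by (simp add: abs_le_iff)
          then have "e * \<bar>mom \<nu> i - mom x i\<bar> \<le> e * 1" using e by (intro mult_left_mono) auto
          ultimately show ?thesis using e(3) by linarith
        qed
        then show ?thesis by (auto simp: S_def free_moms_def space_free_lborel)
      qed
      define P where "P = prob {\<omega> \<in> space (\<Omega> n). free_moms C N (\<mu> n \<omega>) \<in> S}"
      have "e ^ d * ((1 - e) * exp (- k)) ^ j \<le> e ^ d * ((1 - e) * EM N x) ^ j"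
        using e EM_ge_kl[OF PC_PM[OF xPC], of k N] k by (intro mult_left_mono power_mono) auto
      also have "\<dots> \<le> P * exp (- a) ^ j"
        unfolding P_def j_def d_def using prob_ge[OF N(1) nn(1) vol a xPC e(1,2) S sub] .
      finally have "e ^ d * ((1 - e) * exp (- k)) ^ j / exp (- a) ^ j \<le> P"
        by (simp add: pos_divide_le_eq)
      also have "P \<le> measure (laws n) \<Gamma>"
      proof -
        have "measure (laws n) \<Gamma> = prob (\<mu> n -` \<Gamma> \<inter> space (\<Omega> n))" by (rule measure_distr[OF meas \<Gamma>])
        moreover have "P \<le> prob (\<mu> n -` \<Gamma> \<inter> space (\<Omega> n))"
          unfolding P_def
        proof (rule finite_measure_mono_AE)
          show "AE \<omega> in \<Omega> n. \<omega> \<in> {\<omega> \<in> space (\<Omega> n). free_moms C N (\<mu> n \<omega>) \<in> S} \<longrightarrow> \<omega> \<in> \<mu> n -` \<Gamma> \<inter> space (\<Omega> n)"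
            using AE_PC
          proof eventually_elim
            case (elim \<omega>)
            show ?case
            proof
              assume \<omega>: "\<omega> \<in> {\<omega> \<in> space (\<Omega> n). free_moms C N (\<mu> n \<omega>) \<in> S}"
              \<comment> \<open>Constrained moments agree with those of x almost surely;
                \<open>S\<close> controls the free ones.\<close>
              have "\<bar>mom (\<mu> n \<omega>) i - mom x i\<bar> < r" if i: "1 \<le> i" "i \<le> N1" for i
              proof (cases "i \<in> dom C")
                case True
                then show ?thesis using elim xPC r(1) by (simp add: PC_iff)
              next
                case False
                then have "i \<in> free_indices C N" using i N by (simp add: free_indices_def)
                then show ?thesis using \<omega> by (auto simp: S_def free_moms_def)
              qed
              then have "\<mu> n \<omega> \<in> W interior_of \<Gamma>" using r(2) PC_PM[OF elim] by blast
              then show "\<omega> \<in> \<mu> n -` \<Gamma> \<inter> space (\<Omega> n)" using \<omega> interior_of_subset[of W \<Gamma>] by auto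
            qed
          qed
          show "\<mu> n -` \<Gamma> \<inter> space (\<Omega> n) \<in> events" by (rule measurable_sets[OF meas \<Gamma>])
        qed
        ultimately show ?thesis by simp
      qed
      finally have le: "e ^ d * ((1 - e) * exp (- k)) ^ j / exp (- a) ^ j \<le> measure (laws n) \<Gamma>" .
      have pos: "0 < e ^ d * ((1 - e) * exp (- k)) ^ j / exp (- a) ^ j" using e by simp
      have "ln (e ^ d * ((1 - e) * exp (- k)) ^ j / exp (- a) ^ j) =
          real d * ln e + real j * (ln (1 - e) + - k) - real j * (- a)"
        using e by (simp add: ln_div ln_mult ln_realpow)
      also have "\<dots> = real d * ln e + real j * (ln (1 - e) - k + a)" by (simp add: algebra_simps)
      finally have "ln (e ^ d * ((1 - e) * exp (- k)) ^ j / exp (- a) ^ j) = real d * ln e + real j * (ln (1 - e) - k + a)" .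
      moreover have "real j = real n - real N" using nn by (simp add: j_def)
      ultimately show ?case using elog_ge[OF pos le, of "1 / real n"] by (simp add: e_def)
    qed
  qed
  have "?r \<longlonglongrightarrow> a - k"
    by real_asymp
  then have "(\<lambda>n. ereal (?r n)) \<longlonglongrightarrow> ereal (a - k)"
    by simp
  then have "ereal (a - k) = liminf (\<lambda>n. ereal (?r n))"
    by (intro lim_imp_Liminf[symmetric]) auto
  also have "\<dots> \<le> liminf (\<lambda>n. ereal (1 / real n) * elog (measure (laws n) \<Gamma>))"
    using ev by (rule Liminf_mono)
  finally show ?thesis by (simp add: rate)
qed simp

lemma ldp_upper:
  assumes \<Gamma>: "\<Gamma> \<in> sets (borel_of W)" and b: "ereal b < (INF x \<in> W closure_of \<Gamma>. rate C x)"
  shows "limsup (\<lambda>n. ereal (1 / real n) * elog (measure (laws n) \<Gamma>)) \<le> ereal (- b)"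
proof -
  \<comment> \<open>By Szego's theorem a rate above b means that some \<open>EM m\<close> is below
    this value; a is the entropy of the minimizer.\<close>
  define \<delta> where "\<delta> = exp (- (a + b))"
  define V where "V = (\<lambda>m. {\<mu> \<in> PM. EM m \<mu> < \<delta>})"
  obtain N1 where N1: "W closure_of \<Gamma> \<inter> PC C \<subseteq> V N1"
  proof (rule W_increasing_cover[of "W closure_of \<Gamma> \<inter> PC C" V])
    show "W closure_of \<Gamma> \<inter> PC C \<subseteq> PM" using PC_PM by blast
    have "closedin W (PC C)"
      using openin_W_not_PC[of C] PC_PM by (auto simp: closedin_def topspace_W)
    then have "closedin W (W closure_of \<Gamma> \<inter> PC C)" by (intro closedin_Int closedin_closure_of)
    then show "openin W (PM - W closure_of \<Gamma> \<inter> PC C)" by (simp add: closedin_def topspace_W)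
    show "openin W (V m)" for m unfolding V_def by (rule openin_W_EM)
    show "mono V"
    proof (rule monoI)
      fix m n :: nat assume "m \<le> n"
      then show "V m \<subseteq> V n" unfolding V_def using EM_antimono by (auto intro: le_less_trans)
    qed
    show "W closure_of \<Gamma> \<inter> PC C \<subseteq> (\<Union>m. V m)"
    proof
      fix x assume x: "x \<in> W closure_of \<Gamma> \<inter> PC C"
      then have "ereal b < rate C x" using b by (auto intro: less_le_trans INF_lower)
      then have "ereal (a + b) < kl arcsine x" using x by (simp add: rate_gt_iff[OF kl_min(2)])
      then show "x \<in> (\<Union>m. V m)"
        using x PC_PM[of x C] by (auto simp: kl_gt_iff V_def \<delta>_def)
    qed
  qed
  define N where "N = max N1 (max_index C)"
  have N: "max_index C \<le> N" "N1 \<le> N" by (simp_all add: N_def)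
  have vol: "0 < volume C N" by (rule uniform_moments.volume_pos[OF um[OF N(1)]])
  define d where "d = card (free_indices C N)"
  let ?r = "\<lambda>n. (- real d * ln (1 / real n) - (real n - real N) * (ln (1 - 1 / real n) + b)) / real n"
  have ev: "eventually (\<lambda>n. ereal (1 / real n) * elog (measure (laws n) \<Gamma>) \<le>
      ereal (?r n)) sequentially"
    using eventually_gt_at_top[of "max N 1"]
  proof eventually_elim
    case (elim n)
    then have nn: "N \<le> n" "1 < n" by auto
    interpret uniform_moments C n "\<Omega> n" "\<mu> n" using um N nn by simp
    define e where "e = 1 / real n"
    have e: "0 < e" "e < 1" using nn by (auto simp: e_def)
    define j where "j = n - N"
    define P where "P = prob {\<omega> \<in> space (\<Omega> n). free_moms C N (\<mu> n \<omega>) \<in> {v \<in> space (free_lborel C N). free_En C N v < \<delta>}}"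
    have X: "0 < e ^ d * ((1 - e) * exp (- a)) ^ j" using e by simp
    \<comment> \<open>The minimizer has \<open>EM N\<close> at least exp (- a), so contracting
      towards it gives the sharp exponential order of the total mass.\<close>
    have "P * (e ^ d * ((1 - e) * exp (- a)) ^ j) \<le> P * (e ^ d * ((1 - e) * EM N (kl_minimizer C)) ^ j)"
      using e EM_ge_kl[OF PC_PM[OF kl_min(1)], of a N] kl_min(2)
      by (intro mult_left_mono power_mono) (auto simp: P_def)
    also have "\<dots> \<le> \<delta> ^ j"
      unfolding P_def j_def d_def by (rule prob_le[OF N(1) nn(1) vol kl_min(1) e]) (simp add: \<delta>_def)
    finally have "P \<le> \<delta> ^ j / (e ^ d * ((1 - e) * exp (- a)) ^ j)"
      using X by (simp add: pos_le_divide_eq)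
    moreover have "measure (laws n) \<Gamma> \<le> P"
    proof -
      have "{v \<in> space (free_lborel C N). free_En C N v < \<delta>} \<in> sets (free_lborel C N)"
        using borel_measurable_free_En[of C N] by measurable
      from measurable_sets[OF measurable_free_moms this]
      have ms: "{\<omega> \<in> space (\<Omega> n). free_moms C N (\<mu> n \<omega>) \<in> {v \<in> space (free_lborel C N). free_En C N v < \<delta>}} \<in> events"
        by (simp add: vimage_def Int_def conj_commute)
      have "measure (laws n) \<Gamma> = prob (\<mu> n -` \<Gamma> \<inter> space (\<Omega> n))" by (rule measure_distr[OF meas \<Gamma>])
      moreover have "prob (\<mu> n -` \<Gamma> \<inter> space (\<Omega> n)) \<le> P"
        unfolding P_def
      proof (rule finite_measure_mono_AE[OF _ ms])
        show "AE \<omega> in \<Omega> n. \<omega> \<in> \<mu> n -` \<Gamma> \<inter> space (\<Omega> n) \<longrightarrow>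
            \<omega> \<in> {\<omega> \<in> space (\<Omega> n). free_moms C N (\<mu> n \<omega>) \<in> {v \<in> space (free_lborel C N). free_En C N v < \<delta>}}"
          using AE_PC
        proof eventually_elim
          case (elim \<omega>)
          show ?case
          proof
            assume \<omega>: "\<omega> \<in> \<mu> n -` \<Gamma> \<inter> space (\<Omega> n)"
            then have "\<mu> n \<omega> \<in> W closure_of \<Gamma> \<inter> PC C"
              using elim closure_of_subset[OF sets_borel_of_subset[OF \<Gamma>]] by auto
            then have "EM N1 (\<mu> n \<omega>) < \<delta>" using N1 by (auto simp: V_def)
            then have "EM N (\<mu> n \<omega>) < \<delta>" using EM_antimono[OF PC_PM[OF elim] N(2)] by simp
            then show "\<omega> \<in> {\<omega> \<in> space (\<Omega> n). free_moms C N (\<mu> n \<omega>) \<in> {v \<in> space (free_lborel C N). free_En C N v < \<delta>}}"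
              using \<omega> measurable_space[OF measurable_free_moms, of \<omega> N] by (simp add: free_En_free_moms[OF elim])
          qed
        qed
      qed
      ultimately show ?thesis by simp
    qed
    ultimately have le: "measure (laws n) \<Gamma> \<le> \<delta> ^ j / (e ^ d * ((1 - e) * exp (- a)) ^ j)" by simp
    have pos: "0 < \<delta> ^ j / (e ^ d * ((1 - e) * exp (- a)) ^ j)" using X by (simp add: \<delta>_def)
    have "ln (\<delta> ^ j / (e ^ d * ((1 - e) * exp (- a)) ^ j)) =
        real j * (- (a + b)) - (real d * ln e + real j * (ln (1 - e) + - a))"
      using e by (simp add: \<delta>_def ln_div ln_mult ln_realpow)
    also have "\<dots> = - real d * ln e - real j * (ln (1 - e) + b)" by (simp add: algebra_simps)
    finally have "ln (\<delta> ^ j / (e ^ d * ((1 - e) * exp (- a)) ^ j)) = - real d * ln e - real j * (ln (1 - e) + b)" .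
    moreover have "real j = real n - real N" using nn by (simp add: j_def)
    ultimately show ?case using elog_le[OF pos le, of "1 / real n"] nn by (simp add: e_def)
  qed
  have "?r \<longlonglongrightarrow> - b"
    by real_asymp
  then have "(\<lambda>n. ereal (?r n)) \<longlonglongrightarrow> ereal (- b)"
    by simp
  then have eq: "limsup (\<lambda>n. ereal (?r n)) = ereal (- b)"
    by (intro lim_imp_Limsup) auto
  show ?thesis unfolding eq[symmetric] using ev by (rule Limsup_mono)
qed

lemma ldp: "LDP W laws real (rate C)"
  unfolding LDP_def
proof (intro conjI ballI)
  show "filterlim real at_top sequentially" by (rule filterlim_real_sequentially)
  show "rate_function W (rate C)" by (rule rate_function_rate[OF kl_min(2) a])
  fix \<Gamma> assume \<Gamma>: "\<Gamma> \<in> sets (borel_of W)"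
  let ?X = "\<lambda>n. ereal (1 / real n) * elog (measure (laws n) \<Gamma>)"
  have flip: "u \<le> - w" if "w \<le> - u" for u w :: ereal
    using ereal_minus_le_minus[of "- u" w] that by simp
  have "- liminf ?X \<le> (INF x \<in> W interior_of \<Gamma>. rate C x)"
  proof (rule INF_greatest)
    fix x assume "x \<in> W interior_of \<Gamma>"
    from ldp_lower[OF \<Gamma> this] show "- liminf ?X \<le> rate C x"
      by (subst ereal_uminus_le_reorder)
  qed
  then show "- (INF x \<in> W interior_of \<Gamma>. rate C x) \<le> liminf ?X"
    by (subst ereal_uminus_le_reorder)
  have "(INF x \<in> W closure_of \<Gamma>. rate C x) \<le> - limsup ?X"
  \<comment> \<open>Approaching the infimum from below by reals also settles the case of an infinite
    infimum.\<close>
  proof (rule dense_le)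
    fix y assume y: "y < (INF x \<in> W closure_of \<Gamma>. rate C x)"
    show "y \<le> - limsup ?X"
    proof (cases y)
      case (real b)
      then have "limsup ?X \<le> - y" using ldp_upper[OF \<Gamma>, of b] y by simp
      then show ?thesis by (rule flip)
    qed (use y in auto)
  qed
  then show "limsup ?X \<le> - (INF x \<in> W closure_of \<Gamma>. rate C x)" by (rule flip)
qed

end

theorem theorem2p8:
  fixes C :: "nat \<rightharpoonup> real"
    and \<Omega> :: "nat \<Rightarrow> 'w measure"
    and \<mu> :: "nat \<Rightarrow> 'w \<Rightarrow> real measure"
  assumes "moment_constraint C"
    and "admissible C {0..1}"
    and "\<And>n. max_index C \<le> n \<Longrightarrow> prob_space (\<Omega> n)"
    and "\<And>n. max_index C \<le> n \<Longrightarrow> \<mu> n \<in> measurable (\<Omega> n) (borel_of (weak_top {0..1}))"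
    and "\<And>n. max_index C \<le> n \<Longrightarrow>
           distr (\<Omega> n) (\<Pi>\<^sub>M j\<in>{1..n}. borel) (\<lambda>\<omega>. mom_vec n (\<mu> n \<omega>)) = uniform_mom C n"
  shows "LDP (weak_top {0..1}) (\<lambda>n. distr (\<Omega> n) (borel_of (weak_top {0..1})) (\<mu> n)) real (rate C)
       \<and> good_rate_function (weak_top {0..1}) (rate C)"
proof -
  have um: "uniform_moments C n (\<Omega> n) (\<mu> n)" if "max_index C \<le> n" for n
    using assms that by (intro uniform_moments.intro) auto
  \<comment> \<open>One index beyond the constraint: positive volume there provides a constrained
    measure with positive norm at \<open>max_index C\<close>.\<close>
  have "0 < volume C (Suc (max_index C))"
    by (rule uniform_moments.volume_pos[OF um]) simp
  from ex_EM_pos[OF assms(1) order.refl this] obtain x where x: "x \<in> PC C" "0 < EM (max_index C) x" .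
  \<comment> \<open>The measure x itself may have infinite entropy; its Bernstein-Szego measure has
    finite entropy and the same constrained moments.\<close>
  obtain \<nu> where \<nu>: "\<nu> \<in> PM" "\<And>j. 1 \<le> j \<Longrightarrow> j \<le> max_index C \<Longrightarrow> mom \<nu> j = mom x j"
    "kl arcsine \<nu> \<le> ereal (- ln (EM (max_index C) x))"
    using bernstein_szego_PM[OF PC_PM[OF x(1)] x(2)] by blast
  have "\<nu> \<in> PC C" by (rule PC_cong[OF assms(1) x(1) \<nu>(1) order.refl \<nu>(2)])
  moreover have "kl arcsine \<nu> \<noteq> \<infinity>" using \<nu>(3) by auto
  ultimately obtain a where a: "kl_minimizer C \<in> PC C" "kl arcsine (kl_minimizer C) = ereal a"
    "\<And>\<rho>. \<rho> \<in> PC C \<Longrightarrow> ereal a \<le> kl arcsine \<rho>"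
    using kl_minimizer_props[OF assms(1)] by blast
  show ?thesis
    using ldp[OF assms(1) um a] good_rate_function_rate[OF a(2,3)] by blast
qed

end
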